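(* Suppose that $(QIA_\infty)$ holds. Then for every prime $p$ and every non-negative function $\psi:\mathbb{N}\to\mathbb{R}$ we have $\mu_p(W_p(\psi))=1$ if $\sum_{n\in\mathbb{N}}\mu_p(\mathcal{E}_n(\psi))=\infty$, and $\mu_p(W_p(\psi))=0$ otherwise.
   Context: $\lambda$ denotes Lebesgue (Haar probability) measure on $\mathbb{R}/\mathbb{Z}$. For a non-negative $\psi:\mathbb{N}\to\mathbb{R}$ and $n\in\mathbb{N}$, $A_n(\psi)=\bigcup_{1\le a\le n,\ (a,n)=1}[a/n-\psi(n),a/n+\psi(n)]\subseteq\mathbb{R}/\mathbb{Z}$. We say $(QIA_\infty)$ holds if for every non-negative $\psi$ with $\sum_n\lambda(A_n(\psi))=\infty$ one has $\limsup_{N\to\infty}\left(\sum_{n\le N}\lambda(A_n(\psi))\right)^2\left(\sum_{m,n\le N}\lambda(A_m(\psi)\cap A_n(\psi))\right)^{-1}>0$. For a prime $p$, $|\cdot|_p$ is the $p$-adic absolute value, $\mathbb{Z}_p=\{x\in\mathbb{Q}_p:|x|_p\le1\}$, $\mu_p$ is the Haar probability measure on $\mathbb{Z}_p$, $\mathcal{E}_n(\psi)=\bigcup_{-n\le a\le n,\ (a,n)=1}\{x\in\mathbb{Z}_p:|x-a/n|_p\le\psi(n)\}$, and $W_p(\psi)$ is the set of $x\in\mathbb{Z}_p$ lying in $\mathcal{E}_n(\psi)$ for infinitely many $n$. *)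

theory Defs
  imports "HOL-Analysis.Analysis" "HOL-Algebra.QuotRing" "HOL-Computational_Algebra.Primes"
begin

section \<open>The real side\<close>

text \<open>
  The circle \<open>\<real>/\<int>\<close> is represented by the fundamental domain \<open>[0,1)\<close>, with \<^const>\<open>frac\<close> as the
  quotient map. Throughout, \<open>\<nat>\<close> is the set of positive integers; the value of \<open>\<psi>\<close> at \<open>0\<close> is
  irrelevant.
\<close>

definition circle_measure :: "real measure" where
  "circle_measure = restrict_space lborel {0..<1}"

definition approx_set :: "(nat \<Rightarrow> real) \<Rightarrow> nat \<Rightarrow> real set" where
  "approx_set \<psi> n =
     (\<Union>a\<in>{a. 1 \<le> a \<and> a \<le> n \<and> coprime a n}.
        frac ` {real a / real n - \<psi> n .. real a / real n + \<psi> n})"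

text \<open>The real number \<^term>\<open>inverse 0 = 0\<close> only matters for the finitely many \<open>N\<close> that precede the
  first \<open>n\<close> with \<open>\<lambda>(A\<^sub>n) > 0\<close>.\<close>

definition QIA_infty :: bool where
  "QIA_infty \<longleftrightarrow>
     (\<forall>\<psi> :: nat \<Rightarrow> real.
        (\<forall>n\<ge>1. \<psi> n \<ge> 0) \<longrightarrow>
        (\<Sum>n. emeasure circle_measure (approx_set \<psi> (Suc n))) = \<infinity> \<longrightarrow>
        limsup (\<lambda>N. ereal ((\<Sum>n=1..N. measure circle_measure (approx_set \<psi> n))\<^sup>2 *
          inverse (\<Sum>m=1..N. \<Sum>n=1..N.
            measure circle_measure (approx_set \<psi> m \<inter> approx_set \<psi> n)))) > 0)"


section \<open>The field of $p$-adic numbers as the completion of the rationals\<close>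

definition padic_val_rat :: "nat \<Rightarrow> rat \<Rightarrow> int" where
  "padic_val_rat p q =
     int (multiplicity (int p) (fst (quotient_of q))) -
     int (multiplicity (int p) (snd (quotient_of q)))"

definition padic_abs_rat :: "nat \<Rightarrow> rat \<Rightarrow> real" where
  "padic_abs_rat p q = (if q = 0 then 0 else real p powi (- padic_val_rat p q))"

definition padic_cauchy :: "nat \<Rightarrow> (nat \<Rightarrow> rat) set" where
  "padic_cauchy p =
     {X. \<forall>e>0. \<exists>N. \<forall>m\<ge>N. \<forall>n\<ge>N. padic_abs_rat p (X m - X n) < e}"

definition padic_cauchy_ring :: "nat \<Rightarrow> (nat \<Rightarrow> rat) ring" where
  "padic_cauchy_ring p =
     \<lparr>carrier = padic_cauchy p,
      mult = (\<lambda>X Y n. X n * Y n), one = (\<lambda>_. 1),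
      zero = (\<lambda>_. 0), add = (\<lambda>X Y n. X n + Y n)\<rparr>"

definition padic_null :: "nat \<Rightarrow> (nat \<Rightarrow> rat) set" where
  "padic_null p = {X. (\<lambda>n. padic_abs_rat p (X n)) \<longlonglongrightarrow> 0}"

definition Qp :: "nat \<Rightarrow> (nat \<Rightarrow> rat) set ring" where
  "Qp p = padic_cauchy_ring p Quot padic_null p"

definition padic_of_rat :: "nat \<Rightarrow> rat \<Rightarrow> (nat \<Rightarrow> rat) set" where
  "padic_of_rat p q = padic_null p +>\<^bsub>padic_cauchy_ring p\<^esub> (\<lambda>_. q)"

text \<open>The extension of the absolute value by continuity; for \<^term>\<open>x \<in> carrier (Qp p)\<close> the limit exists
  and does not depend on the chosen Cauchy sequence in the class \<open>x\<close>.\<close>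

definition padic_abs :: "nat \<Rightarrow> (nat \<Rightarrow> rat) set \<Rightarrow> real" where
  "padic_abs p x = (THE l. \<forall>X\<in>x. (\<lambda>n. padic_abs_rat p (X n)) \<longlonglongrightarrow> l)"

definition Zp :: "nat \<Rightarrow> (nat \<Rightarrow> rat) set set" where
  "Zp p = {x \<in> carrier (Qp p). padic_abs p x \<le> 1}"

text \<open>The value \<open>0\<close> outside the carrier is there because \<^locale>\<open>Metric_space\<close> demands non-negativity
  and symmetry on the whole type.\<close>

definition padic_dist :: "nat \<Rightarrow> (nat \<Rightarrow> rat) set \<Rightarrow> (nat \<Rightarrow> rat) set \<Rightarrow> real" where
  "padic_dist p x y =
     (if x \<in> carrier (Qp p) \<and> y \<in> carrier (Qp p) then padic_abs p (x \<ominus>\<^bsub>Qp p\<^esub> y) else 0)"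

definition is_haar_prob_Zp :: "nat \<Rightarrow> (nat \<Rightarrow> rat) set measure \<Rightarrow> bool" where
  "is_haar_prob_Zp p \<mu> \<longleftrightarrow>
     sets \<mu> = sigma_sets (Zp p) {U. openin (Metric_space.mtopology (Zp p) (padic_dist p)) U} \<and>
     emeasure \<mu> (Zp p) = 1 \<and>
     (\<forall>y\<in>Zp p. \<forall>A\<in>sets \<mu>. emeasure \<mu> ((\<lambda>x. x \<oplus>\<^bsub>Qp p\<^esub> y) ` A) = emeasure \<mu> A)"

definition haar_Zp :: "nat \<Rightarrow> (nat \<Rightarrow> rat) set measure" where
  "haar_Zp p = (THE \<mu>. is_haar_prob_Zp p \<mu>)"

definition padic_approx_set :: "nat \<Rightarrow> (nat \<Rightarrow> real) \<Rightarrow> nat \<Rightarrow> (nat \<Rightarrow> rat) set set" where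
  "padic_approx_set p \<psi> n =
     (\<Union>a\<in>{a::int. - int n \<le> a \<and> a \<le> int n \<and> coprime a (int n)}.
        {x \<in> Zp p. padic_abs p (x \<ominus>\<^bsub>Qp p\<^esub> padic_of_rat p (of_int a / of_nat n)) \<le> \<psi> n})"

definition padic_limsup_set :: "nat \<Rightarrow> (nat \<Rightarrow> real) \<Rightarrow> (nat \<Rightarrow> rat) set set" where
  "padic_limsup_set p \<psi> = {x \<in> Zp p. infinite {n. 1 \<le> n \<and> x \<in> padic_approx_set p \<psi> n}}"

end

theory Submission
  imports Defs "HOL-Number_Theory.Number_Theory"
begin

text \<open>
  The convergence half is the Borel--Cantelli lemma. For the divergence half, the digit map
  \<open>\<Sum> d\<^sub>i p\<^sup>-\<^sup>i\<^sup>-\<^sup>1 \<mapsto> \<Sum> d\<^sub>i p\<^sup>i\<close> carries Lebesgue measure on \<open>[0, 1)\<close> to Haar measure on \<open>\<int>\<^sub>p\<close>, and if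
  \<open>p\<close> does not divide \<open>n\<close> then \<open>\<bar>x - a/n\<bar> \<le> p\<^sup>-\<^sup>k\<close> only depends on the first \<open>k\<close> digits of \<open>x\<close>.

  Zero-one law: if \<open>x\<close> is close to \<open>b/n\<close> and \<open>x\<^sub>0\<close> is its first digit, then \<open>(x - x\<^sub>0)/p\<close> is close to
  \<open>a/n\<close> with \<open>a = (b - n x\<^sub>0)/p\<close>, which again is reduced and satisfies \<open>\<bar>a\<bar> \<le> n\<close>. So the digit shift
  maps the limsup set into the limsup set for radii enlarged by the factor \<open>p\<close>, and enlarging the
  radii does not change the measure.

  Positive measure: with \<open>J\<^sub>n = p\<^sup>k\<close> the inverse radius, correlations are governed by the number of
  pairs of reduced numerators \<open>(a, b)\<close> with \<open>a n - b m = t J\<^sub>m\<close>, hence \<open>\<bar>t\<bar> \<le> 2 m n / J\<^sub>m\<close>. Dividing by the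
  unit \<open>J\<^sub>m\<close> modulo \<open>m n\<close> turns them into pairs of reduced fractions at real distance at most \<open>2 / J\<^sub>m\<close>
  modulo 1. If \<open>J\<^sub>n > 2 n\<close> the real intervals of radius \<open>3 / J\<^sub>n\<close> overlap boundedly often, so the real
  and the \<open>p\<close>-adic correlations are comparable and the real variance hypothesis applies. If
  \<open>J\<^sub>n \<le> 2 n\<close> the number of pairs is bounded unconditionally by a sieve in which only primes \<open>q \<le> y\<close>
  with \<open>y\<^sup>y\<close> below the sieving range matter.
\<close>

section \<open>Reduced numerators and sums of periodic functions\<close>

text \<open>The variance hypothesis speaks of measures of unions, whereas the \<open>p\<close>-adic
  second moment counts pairs of balls. Count and measure are comparable only while the intervals
  about the fractions a/n overlap boundedly, so the indices are split at J_n = 2n. For larger radii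
  a union loses the multiplicities, and the count is bounded for every pair m, n: there J_m <= 2m
  and J_m <= 2n make the range 2mn/(gcd(m,n) J_m) of the sieve variable at least as long as the
  cofactors m/gcd(m,n) and n/gcd(m,n), which limits how many large primes can divide these. The real
  radius 3/J is 2/J for the distance of two fractions plus 1/J for a short interval placed next to
  one of them. Division by J modulo mn requires p to be prime to mn. If p divides n, all reduced a/n
  lie outside the \<open>p\<close>-adic integers and have the same distance from each
  \<open>p\<close>-adic integer, so that E_n is empty or everything. The enlargement of radii in the
  zero-one law is a density argument and requires radii tending to zero; this is why large radii are
  shrunk beforehand.\<close>

definition signed_totatives :: "nat \<Rightarrow> int set" where
  "signed_totatives n = {a. - int n \<le> a \<and> a \<le> int n \<and> coprime a (int n)}"

lemma finite_signed_totatives [simp, intro]: "finite (signed_totatives n)"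
  by (rule finite_subset[of _ "{- int n..int n}"]) (auto simp: signed_totatives_def)

lemma card_signed_totatives_ge: "totient n \<le> card (signed_totatives n)"
proof -
  have "card (int ` totatives n) \<le> card (signed_totatives n)"
    by (rule card_mono[OF finite_signed_totatives]) (auto simp: signed_totatives_def in_totatives_iff)
  moreover have "card (int ` totatives n) = totient n"
    by (simp add: card_image totient_def)
  ultimately show ?thesis by simp
qed

lemma coprime_add_mult_iff: "coprime (a + k * n) n \<longleftrightarrow> coprime a (n::int)"
  by (metis coprime_iff_gcd_eq_1 gcd.commute gcd_add_mult mult.commute add.commute)

lemma card_signed_totatives_le:
  assumes "n > 0"
  shows "card (signed_totatives n) \<le> 3 * totient n"
proof -
  let ?f = "\<lambda>k. (\<lambda>b. int b - int k * int n) ` totatives n"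
  have "signed_totatives n \<subseteq> (\<Union>k\<in>{0,1,2}. ?f k)"
  proof
    fix a assume a: "a \<in> signed_totatives n"
    \<comment> \<open>The shift by 2n is there for a = -n, which a shift by n would only take to
      0.\<close>
    obtain k :: nat where k: "k \<in> {0,1,2}" "0 < a + int k * int n" "a + int k * int n \<le> int n"
    proof -
      consider "a > 0" | "a \<le> 0" "a > - int n" | "a = - int n"
        using a by (force simp: signed_totatives_def)
      then show thesis
      proof cases
        case 1 then show ?thesis using a that[of 0] by (auto simp: signed_totatives_def)
      next
        case 2 then show ?thesis using that[of 1] by auto
      next
        case 3 then show ?thesis using that[of 2] assms by auto
      qed
    qed
    have "coprime (a + int k * int n) (int n)"
      using a by (simp add: coprime_add_mult_iff signed_totatives_def)
    then have "nat (a + int k * int n) \<in> totatives n"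
      using k by (auto simp: in_totatives_iff coprime_int_iff[symmetric])
    then have "a \<in> ?f k"
      using k by (intro image_eqI[of _ _ "nat (a + int k * int n)"]) auto
    then show "a \<in> (\<Union>k\<in>{0,1,2}. ?f k)" using k(1) by blast
  qed
  then have "card (signed_totatives n) \<le> card (\<Union>k\<in>{0,1,2}. ?f k)"
    by (intro card_mono) auto
  also have "\<dots> \<le> (\<Sum>k\<in>{0,1,2}. card (?f k))"
    by (rule card_UN_le) auto
  also have "\<dots> \<le> (\<Sum>k\<in>{0,1,2::nat}. totient n)"
    by (intro sum_mono) (simp add: totient_def card_image_le)
  finally show ?thesis by simp
qed

text \<open>By Gauss's identity n is the sum of phi(d) over its divisors d. Each term is at most
  phi(n), and there are at most 2 sqrt(n) divisors because d or n/d is at most sqrt(n).\<close>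

lemma le_totient_square: "n \<le> 4 * (totient n)\<^sup>2"
proof (cases "n = 0")
  case False
  define r where "r = floor_sqrt n"
  let ?D = "{d. d dvd n}"
  have fin: "finite ?D" using False by simp
  have r: "n < (Suc r)\<^sup>2" "r\<^sup>2 \<le> n" unfolding r_def by (auto simp: Suc_floor_sqrt_power2_gt)
  have "?D \<subseteq> {1..r} \<union> (\<lambda>d. n div d) ` {1..r}"
  proof
    fix d assume "d \<in> ?D"
    then obtain e where e: "n = d * e" by (auto elim: dvdE)
    have "d \<ge> 1" "e \<ge> 1" using e False by (auto simp: Suc_le_eq)
    show "d \<in> {1..r} \<union> (\<lambda>d. n div d) ` {1..r}"
    proof (cases "d \<le> r")
      case True then show ?thesis using \<open>d \<ge> 1\<close> by auto
    next
      case False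
      have "e \<le> r"
      proof (rule ccontr)
        assume "\<not> e \<le> r"
        then have "Suc r * Suc r \<le> d * e" using False by (intro mult_le_mono) auto
        then show False using r(1) e by (simp add: power2_eq_square)
      qed
      then show ?thesis using e \<open>e \<ge> 1\<close> by (intro UnI2 image_eqI[of _ _ e]) auto
    qed
  qed
  then have "card ?D \<le> card ({1..r} \<union> (\<lambda>d. n div d) ` {1..r})"
    by (intro card_mono) auto
  also have "\<dots> \<le> card {1..r} + card ((\<lambda>d. n div d) ` {1..r})" by (rule card_Un_le)
  also have "\<dots> \<le> r + r" using card_image_le[of "{1..r}" "\<lambda>d. n div d"] by simp
  finally have c: "card ?D \<le> 2 * r" by simp
  have "n = (\<Sum>d\<in>?D. totient d)" by (simp add: totient_divisor_sum)
  also have "\<dots> \<le> (\<Sum>d\<in>?D. totient n)"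
    using False by (intro sum_mono) (auto intro!: dvd_imp_le totient_dvd_mono)
  also have "\<dots> \<le> 2 * r * totient n" using c by simp
  finally have "n\<^sup>2 \<le> (2 * r * totient n)\<^sup>2" by (intro power_mono) auto
  also have "\<dots> = 4 * (totient n)\<^sup>2 * r\<^sup>2" by (simp add: power2_eq_square)
  also have "\<dots> \<le> 4 * (totient n)\<^sup>2 * n" using r(2) by simp
  finally show ?thesis using False by (simp add: power2_eq_square)
qed simp

text \<open>Chinese remainder theorem: \<open>F\<close> is a bijection from residues modulo the new
  product to pairs of residues, and the summand splits along it.\<close>

lemma sum_prod_coprime_periodic:
  fixes h :: "nat \<Rightarrow> int \<Rightarrow> real"
  assumes "finite Q" "\<And>q. q \<in> Q \<Longrightarrow> q > 0"
    and "\<And>q r. q \<in> Q \<Longrightarrow> r \<in> Q \<Longrightarrow> q \<noteq> r \<Longrightarrow> coprime q r"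
    and "\<And>q x. q \<in> Q \<Longrightarrow> h q (x mod int q) = h q x"
  shows "(\<Sum>x\<in>{0..<int (\<Prod>Q)}. \<Prod>q\<in>Q. h q x) = (\<Prod>q\<in>Q. \<Sum>x\<in>{0..<int q}. h q x)"
  using assms
proof (induction Q rule: finite_induct)
  case (insert q Q)
  let ?R = "\<Prod>Q"
  have q0: "q > 0" and R0: "?R > 0" using insert by (auto intro: prod_pos)
  have cop: "coprime (int ?R) (int q)"
  proof -
    have "coprime ?R q" using insert by (intro prod_coprime_left) auto
    then show ?thesis by (simp only: coprime_int_iff)
  qed
  define F where "F = (\<lambda>x. (x mod int ?R, x mod int q))"
  have inj: "inj_on F {0..<int ?R * int q}"
  proof (rule inj_onI)
    fix x y assume xy: "x \<in> {0..<int ?R * int q}" "y \<in> {0..<int ?R * int q}" "F x = F y"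
    then have "int ?R dvd x - y" "int q dvd x - y"
      by (auto simp: F_def mod_eq_dvd_iff simp del: of_nat_prod)
    then have "int ?R * int q dvd x - y" using cop by (simp add: divides_mult)
    moreover have "\<bar>x - y\<bar> < int ?R * int q" using xy(1,2) by (auto simp: abs_if simp del: of_nat_prod)
    ultimately show "x = y" using dvd_imp_le_int[of "x - y" "int ?R * int q"]
      by (cases "x = y") (auto simp del: of_nat_prod)
  qed
  have "F ` {0..<int ?R * int q} = {0..<int ?R} \<times> {0..<int q}"
  proof (rule card_subset_eq)
    show "F ` {0..<int ?R * int q} \<subseteq> {0..<int ?R} \<times> {0..<int q}"
      using q0 R0 by (auto simp: F_def simp del: of_nat_prod)
    show "card (F ` {0..<int ?R * int q}) = card ({0..<int ?R} \<times> {0..<int q})"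
      using inj by (simp add: card_image nat_mult_distrib del: of_nat_prod)
  qed auto
  then have bij: "bij_betw F {0..<int ?R * int q} ({0..<int ?R} \<times> {0..<int q})"
    using inj by (simp add: bij_betw_def)
  have red: "h r (x mod int ?R) = h r x" if "r \<in> Q" for r x
  proof -
    have "int r dvd int ?R" using dvd_prodI[OF insert(1) that, of "\<lambda>x. x"] by (simp del: of_nat_prod)
    then have "x mod int ?R mod int r = x mod int r" by (rule mod_mod_cancel)
    then show ?thesis using insert.prems(3)[of r] that by (metis insertCI)
  qed
  have "(\<Sum>x\<in>{0..<int (\<Prod>(insert q Q))}. \<Prod>r\<in>insert q Q. h r x)
      = (\<Sum>x\<in>{0..<int ?R * int q}. h q x * (\<Prod>r\<in>Q. h r x))"
    using insert by (simp add: mult.commute)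
  also have "\<dots> = (\<Sum>x\<in>{0..<int ?R * int q}. (\<lambda>(u,v). h q v * (\<Prod>r\<in>Q. h r u)) (F x))"
    using insert.prems(3)[of q] by (intro sum.cong) (auto simp: F_def red simp del: of_nat_prod)
  also have "\<dots> = (\<Sum>(u,v)\<in>{0..<int ?R} \<times> {0..<int q}. h q v * (\<Prod>r\<in>Q. h r u))"
    by (rule sum.reindex_bij_betw[OF bij])
  also have "\<dots> = (\<Sum>v\<in>{0..<int q}. h q v) * (\<Sum>u\<in>{0..<int ?R}. \<Prod>r\<in>Q. h r u)"
    by (subst sum.cartesian_product[symmetric], subst sum.swap)
       (simp add: sum_product del: of_nat_prod)
  finally show ?case using insert by simp
qed simp

lemma sum_periodic_window:
  fixes g :: "int \<Rightarrow> real"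
  assumes "R > 0" "\<And>x. g (x mod R) = g x"
  shows "(\<Sum>x\<in>{a..<a + int K * R}. g x) = real K * (\<Sum>x\<in>{0..<R}. g x)"
proof -
  have one: "(\<Sum>x\<in>{a..<a + R}. g x) = (\<Sum>x\<in>{0..<R}. g x)" for a
  proof -
    have inj: "inj_on (\<lambda>x. x mod R) {a..<a + R}"
    proof (rule inj_onI)
      fix x y assume xy: "x \<in> {a..<a + R}" "y \<in> {a..<a + R}" "x mod R = y mod R"
      then have "R dvd x - y" by (simp add: mod_eq_dvd_iff)
      moreover have "\<bar>x - y\<bar> < R" using xy by (auto simp: abs_if)
      ultimately show "x = y" using dvd_imp_le_int[of "x - y" R] assms(1) by fastforce
    qed
    have "(\<lambda>x. x mod R) ` {a..<a + R} = {0..<R}"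
      by (rule card_subset_eq) (use assms(1) inj in \<open>auto simp: card_image\<close>)
    with inj have bij: "bij_betw (\<lambda>x. x mod R) {a..<a + R} {0..<R}" by (simp add: bij_betw_def)
    show ?thesis using sum.reindex_bij_betw[OF bij, of g] assms(2) by simp
  qed
  show ?thesis
  proof (induction K)
    case (Suc K)
    have "{a..<a + int (Suc K) * R} = {a..<a + int K * R} \<union> {a + int K * R..<a + int K * R + R}"
    proof -
      have "a + int (Suc K) * R = a + int K * R + R" by (simp add: algebra_simps)
      moreover have "a \<le> a + int K * R" "a + int K * R \<le> a + int K * R + R" using assms(1) by simp_all
      ultimately show ?thesis
        using ivl_disj_un_two(3)[of a "a + int K * R" "a + int K * R + R"] by presburger
    qed
    then have "(\<Sum>x\<in>{a..<a + int (Suc K) * R}. g x) = (\<Sum>x\<in>{a..<a + int K * R}. g x) + (\<Sum>x\<in>{a + int K * R..<a + int K * R + R}. g x)"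
      by (simp add: sum.union_disjoint)
    then show ?case using Suc one[of "a + int K * R"] by (simp add: algebra_simps)
  qed simp
qed

text \<open>The product of the primes in \<open>Q\<close> divides v <= X^3 < (y+1)^(3(y+1)), and
  each of them exceeds y, so there are fewer than 3(y+1) of them. Each factor is at most 1 +
  1/y.\<close>

lemma prod_large_prime_factors_le:
  fixes v X y :: nat
  assumes "v > 0" "v \<le> X ^ 3" "X < Suc y ^ Suc y" "y > 0" "finite Q"
    and Q: "\<And>q. q \<in> Q \<Longrightarrow> prime q \<and> q dvd v \<and> q > y"
  shows "(\<Prod>q\<in>Q. inverse (1 - 1 / real q)) \<le> exp 6"
proof -
  have "\<Prod>Q dvd v"
    using assms(5) Q by (induction Q rule: finite_induct)
      (auto intro!: divides_mult prod_coprime_right primes_coprime)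
  then have "\<Prod>Q \<le> v" using assms(1) by (simp add: dvd_imp_le)
  have "Suc y ^ card Q = (\<Prod>q\<in>Q. Suc y)" by simp
  also have "\<dots> \<le> \<Prod>Q" using Q by (intro prod_mono) (auto simp: Suc_le_eq)
  also have "\<dots> \<le> X ^ 3" using \<open>\<Prod>Q \<le> v\<close> assms(2) by simp
  also have "\<dots> < (Suc y ^ Suc y) ^ 3" by (rule power_strict_mono[OF assms(3)]) simp_all
  also have "\<dots> = Suc y ^ (3 * Suc y)" by (metis power_mult mult.commute)
  finally have c: "card Q < 3 * Suc y" by (rule power_less_imp_less_exp[rotated]) (use assms(4) in simp)
  have "(\<Prod>q\<in>Q. inverse (1 - 1 / real q)) \<le> (\<Prod>q\<in>Q. 1 + 1 / real y)"
  proof (intro prod_mono conjI)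
    fix q assume "q \<in> Q"
    then have q: "real q \<ge> real y + 1" "q > y" using Q by force+
    then have "1 - 1 / real q \<ge> 1 - 1 / (real y + 1)" using assms(4) by (intro diff_mono divide_left_mono) auto
    moreover have "1 - 1 / (real y + 1) > 0" using assms(4) by simp
    ultimately have "inverse (1 - 1 / real q) \<le> inverse (1 - 1 / (real y + 1))" by (intro le_imp_inverse_le) auto
    also have "\<dots> = 1 + 1 / real y" using assms(4) by (simp add: field_simps)
    finally show "inverse (1 - 1 / real q) \<le> 1 + 1 / real y" .
    show "0 \<le> inverse (1 - 1 / real q)" using q by simp
  qed
  also have "\<dots> = (1 + 1 / real y) ^ card Q" by simp
  \<comment> \<open>3y + 2 <= 6y for y >= 1; here the constant \<open>exp 6\<close>
    originates.\<close>
  also have "\<dots> \<le> (1 + 1 / real y) ^ (6 * y)" using c assms(4) by (intro power_increasing) auto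
  also have "\<dots> \<le> exp (1 / real y) ^ (6 * y)" by (intro power_mono exp_ge_add_one_self) auto
  also have "\<dots> = exp 6" using assms(4) by (simp add: exp_of_nat_mult[symmetric] field_simps)
  finally show ?thesis .
qed

section \<open>Counting close pairs of fractions by a sieve\<close>

text \<open>The product depends on x only modulo the radical r of d. As r divides d, a window of K d
  integers consists of whole periods, and nonnegativity lets \<open>W\<close> be any part of
  it.\<close>

lemma sum_prod_periodic_mod:
  fixes h :: "nat \<Rightarrow> int \<Rightarrow> real" and d :: nat
  assumes "d > 0" "\<And>q x. q \<in> prime_factors d \<Longrightarrow> h q (x mod int q) = h q x"
    and "\<And>q x. q \<in> prime_factors d \<Longrightarrow> h q x \<ge> 0"
    and "W \<subseteq> {w..<w + int K * int d}"
  shows "(\<Sum>x\<in>W. \<Prod>q\<in>prime_factors d. h q x) \<le> 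
     real K * real d * (\<Prod>q\<in>prime_factors d. (\<Sum>x\<in>{0..<int q}. h q x) / real q)"
proof -
  let ?Q = "prime_factors d"
  define r where "r = \<Prod>?Q"
  have pr: "prime q" if "q \<in> ?Q" for q using that by auto
  have r0: "r > 0" unfolding r_def using pr by (auto intro!: prod_pos simp: prime_gt_0_nat)
  have "r dvd d"
  proof -
    have "r dvd (\<Prod>q\<in>?Q. q ^ multiplicity q d)" unfolding r_def
      by (intro prod_dvd_prod dvd_power) (auto simp: prime_factors_multiplicity)
    also have "\<dots> = d" using assms(1) prime_factorization_nat[of d] by simp
    finally show ?thesis .
  qed
  then obtain e where e: "d = r * e" by (auto elim: dvdE)
  let ?g = "\<lambda>x. \<Prod>q\<in>?Q. h q x"
  have per: "?g (x mod int r) = ?g x" for x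
  proof (rule prod.cong[OF refl])
    fix q assume q: "q \<in> ?Q"
    have "q dvd r" unfolding r_def using dvd_prodI[OF _ q, of "\<lambda>x. x"] by simp
    then have "x mod int r mod int q = x mod int q" by (intro mod_mod_cancel) simp
    then show "h q (x mod int r) = h q x" using assms(2)[OF q] by metis
  qed
  have "(\<Sum>x\<in>W. ?g x) \<le> (\<Sum>x\<in>{w..<w + int (K * e) * int r}. ?g x)"
  proof (rule sum_mono2)
    show "W \<subseteq> {w..<w + int (K * e) * int r}" using assms(4) by (simp add: e mult_ac)
  qed (use assms(3) in \<open>auto intro!: prod_nonneg\<close>)
  also have "\<dots> = real (K * e) * (\<Sum>x\<in>{0..<int r}. ?g x)"
    using r0 per by (intro sum_periodic_window) auto
  also have "(\<Sum>x\<in>{0..<int r}. ?g x) = (\<Prod>q\<in>?Q. \<Sum>x\<in>{0..<int q}. h q x)"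
    unfolding r_def using assms(2) pr
    by (intro sum_prod_coprime_periodic) (auto intro: primes_coprime prime_gt_0_nat)
  also have "\<dots> = real r * (\<Prod>q\<in>?Q. (\<Sum>x\<in>{0..<int q}. h q x) / real q)"
    using r0 by (simp add: prod_dividef r_def)
  finally show ?thesis by (simp add: e mult_ac)
qed

lemma linear_root_mod_prime:
  fixes q :: nat and u v :: int
  assumes "prime q" "\<not> int q dvd v"
  obtains k where "k \<in> {0..<int q}" "int q dvd u + k * v"
proof -
  have "coprime v (int q)" using assms prime_imp_coprime[of "int q" v] by (simp add: coprime_commute)
  then obtain w where "[v * w = 1] (mod int q)" using cong_solve_coprime_int by blast
  then have w: "int q dvd v * w - 1" by (simp add: cong_iff_dvd_diff)
  define k where "k = (- u * w) mod int q"
  have "int q dvd (- u * w) - k" by (simp add: k_def minus_mod_eq_mult_div)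
  then have "int q dvd v * ((- u * w) - k)" by simp
  moreover have "int q dvd u * (v * w - 1)" using w by simp
  ultimately have "int q dvd - (v * ((- u * w) - k)) - u * (v * w - 1)" by (intro dvd_diff) simp_all
  also have "- (v * ((- u * w) - k)) - u * (v * w - 1) = u + k * v" by (simp add: algebra_simps)
  finally have "int q dvd u + k * v" .
  moreover have "k \<in> {0..<int q}" using assms(1) by (auto simp: k_def prime_gt_0_nat)
  ultimately show thesis using that by blast
qed

text \<open>Local densities: the pairs \<open>(a, b) = (s u + k m', s v + k n')\<close> with \<open>u n' - v m' = J\<close>, a unit
  modulo \<open>q\<close>, are an invertible image of \<open>(s, k)\<close>, so that the two coprimality conditions at \<open>q\<close>
  are independent on average over \<open>s\<close>.\<close>

locale local_density =
  fixes q :: nat and M N :: bool and u v m' n' J :: int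
  assumes prime_q: "prime q" and det: "u * n' - v * m' = J" and J: "\<not> int q dvd J"
begin

definition good :: "int \<Rightarrow> int set" where
  "good s = {k\<in>{0..<int q}. (M \<longrightarrow> \<not> int q dvd s * u + k * m') \<and> (N \<longrightarrow> \<not> int q dvd s * v + k * n')}"

definition dens :: real where
  "dens = (if M then 1 - 1 / real q else 1) * (if N then 1 - 1 / real q else 1)"

lemma q_gt_1: "q > 1" using prime_q prime_gt_1_nat by blast

lemma finite_good: "finite (good s)"
  by (rule finite_subset[of _ "{0..<int q}"]) (auto simp: good_def)

lemma good_mod: "good (s mod int q) = good s"
proof -
  have "int q dvd (s mod int q) * u + k * m' \<longleftrightarrow> int q dvd s * u + k * m'" for u k m'
  proof -
    have "((s mod int q) * u + k * m') mod int q = (s * u + k * m') mod int q" by (metis mod_add_left_eq mod_mult_left_eq)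
    then show ?thesis by (simp add: dvd_eq_mod_eq_0)
  qed
  then show ?thesis by (simp add: good_def)
qed

text \<open>Cramer's rule: eliminating k or s leaves s J or k J, and J is a unit modulo q.\<close>

lemma det_dvd:
  assumes "int q dvd s * u + k * m'" "int q dvd s * v + k * n'"
  shows "int q dvd s" "int q dvd k"
proof -
  have pq: "prime (int q)" using prime_q by simp
  have "int q dvd n' * (s * u + k * m') - m' * (s * v + k * n')" using assms by simp
  also have "\<dots> = s * J" by (simp add: det[symmetric] algebra_simps)
  finally show "int q dvd s" using J pq prime_dvd_multD by blast
  have "int q dvd u * (s * v + k * n') - v * (s * u + k * m')" using assms by simp
  also have "\<dots> = k * J" by (simp add: det[symmetric] algebra_simps)
  finally show "int q dvd k" using J pq prime_dvd_multD by blast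
qed

lemma sum_good_le: "(\<Sum>s\<in>{0..<int q}. real (card (good s)) / real q) / real q \<le> dens"
proof -
  let ?I = "{0..<int q}"
  let ?S = "SIGMA s:?I. good s"
  define F where "F = (\<lambda>(s, k). ((s * u + k * m') mod int q, (s * v + k * n') mod int q))"
  define A where "A = (if M then {1..<int q} else ?I)"
  define B where "B = (if N then {1..<int q} else ?I)"
  have inj: "inj_on F ?S"
  proof (rule inj_onI)
    fix x y assume xy: "x \<in> ?S" "y \<in> ?S" "F x = F y"
    obtain s k s1 k1 where x: "x = (s, k)" and y: "y = (s1, k1)" by (cases x, cases y)
    from xy have *: "s \<in> ?I" "k \<in> good s" "s1 \<in> ?I" "k1 \<in> good s1" "F (s, k) = F (s1, k1)"
      by (auto simp: x y)
    then have "int q dvd (s * u + k * m') - (s1 * u + k1 * m')"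
      "int q dvd (s * v + k * n') - (s1 * v + k1 * n')"
      by (auto simp: F_def mod_eq_dvd_iff)
    then have "int q dvd (s - s1) * u + (k - k1) * m'" "int q dvd (s - s1) * v + (k - k1) * n'"
      by (simp_all add: algebra_simps)
    then have d: "int q dvd s - s1" "int q dvd k - k1" by (rule det_dvd)+
    have "k \<in> ?I" "k1 \<in> ?I" using * by (auto simp: good_def)
    have "s mod int q = s1 mod int q" "k mod int q = k1 mod int q"
      using d by (simp_all add: mod_eq_dvd_iff)
    with * \<open>k \<in> ?I\<close> \<open>k1 \<in> ?I\<close> show "x = y"
      by (simp add: x y)
  qed
  have "F ` ?S \<subseteq> A \<times> B"
  proof
    fix z assume "z \<in> F ` ?S"
    then obtain s k where z: "z = F (s, k)" and *: "s \<in> ?I" "k \<in> good s" by auto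
    have "x mod int q \<in> ?I" for x using q_gt_1 by simp
    moreover have "x mod int q \<in> {1..<int q}" if "\<not> int q dvd x" for x
    proof -
      have "x mod int q \<noteq> 0" using that by (simp add: dvd_eq_mod_eq_0)
      moreover have "x mod int q \<ge> 0" "x mod int q < int q" using q_gt_1 by simp_all
      ultimately show ?thesis by simp
    qed
    ultimately show "z \<in> A \<times> B" using * by (auto simp: z F_def A_def B_def good_def)
  qed
  then have "card ?S \<le> card (A \<times> B)"
    by (intro card_inj_on_le[OF inj]) (auto simp: A_def B_def)
  moreover have "real (card (A \<times> B)) = dens * (real q * real q)"
    using q_gt_1 by (auto simp: A_def B_def dens_def card_cartesian_product field_simps)
  moreover have "real (card ?S) = (\<Sum>s\<in>?I. real (card (good s)))"
    using finite_good by (simp add: card_SigmaI)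
  ultimately have "(\<Sum>s\<in>?I. real (card (good s))) \<le> dens * (real q * real q)" by (simp flip: of_nat_le_iff)
  then have "(\<Sum>s\<in>?I. real (card (good s))) / (real q * real q) \<le> dens"
    using q_gt_1 by (subst pos_divide_le_eq) auto
  then show ?thesis by (simp only: sum_divide_distrib[symmetric] divide_divide_eq_left)
qed

text \<open>If q divides m' n' s, the claim allows a loss of one factor 1 - 1/q. With one condition
  active the trivial bound q is then enough. With both active, m' and n' are not both divisible by q
  since J is a unit, so at least one k is excluded. If q does not divide m' n' s, each condition
  excludes one k. The two differ, as a common root would force q to divide s, and 1 - 2/q <= (1 -
  1/q)^2.\<close>

lemma card_good_le:
  assumes "M \<or> N" "\<not> (M \<and> N) \<Longrightarrow> int q dvd m' * n'"
  shows "real (card (good s)) / real q \<le> dens * (if int q dvd m' * n' * s then inverse (1 - 1 / real q) else 1)"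
proof -
  have q: "real q > 1" using q_gt_1 by simp
  have le_q: "card (good s) \<le> q"
  proof -
    have "good s \<subseteq> {0..<int q}" by (auto simp: good_def)
    from card_mono[OF _ this] show ?thesis by simp
  qed
  show ?thesis
  proof (cases "M \<and> N")
    case False
    with assms(1) have "dens = 1 - 1 / real q" by (auto simp: dens_def)
    moreover have "int q dvd m' * n' * s" using assms(2)[OF False] by simp
    ultimately show ?thesis using le_q q by simp
  next
    case True
    then have dens: "dens = (1 - 1 / real q) * (1 - 1 / real q)" unfolding dens_def by simp
    show ?thesis
    proof (cases "int q dvd m' * n' * s")
      case div: True
      have "\<not> (int q dvd m' \<and> int q dvd n')"
        using det J by (metis dvd_diff dvd_mult)
      then consider "\<not> int q dvd m'" | "\<not> int q dvd n'" by blast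
      then have "\<exists>k. k \<in> {0..<int q} \<and> k \<notin> good s"
      proof cases
          case 1
          then obtain k where "k \<in> {0..<int q}" "int q dvd s * u + k * m'"
            using linear_root_mod_prime[OF prime_q 1, of "s * u"] by blast
          then show ?thesis using True by (intro exI[of _ k]) (unfold good_def, auto)
        next
          case 2
          then obtain k where "k \<in> {0..<int q}" "int q dvd s * v + k * n'"
            using linear_root_mod_prime[OF prime_q 2, of "s * v"] by blast
          then show ?thesis using True by (intro exI[of _ k]) (unfold good_def, auto)
      qed
      then obtain k where k: "k \<in> {0..<int q}" "k \<notin> good s" by blast
      have "card (good s) \<le> card ({0..<int q} - {k})"
        using k(2) by (intro card_mono) (unfold good_def, auto)
      then have "card (good s) \<le> q - 1" using k(1) by simp
      then have "real (card (good s)) \<le> real q - 1" using q_gt_1 by linarith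
      then have "real (card (good s)) / real q \<le> (real q - 1) / real q" using q by (intro divide_right_mono) auto
      also have "\<dots> = 1 - 1 / real q" using q by (simp add: diff_divide_distrib)
      also have "\<dots> = dens * inverse (1 - 1 / real q)" using q by (simp add: dens)
      finally show ?thesis using div by simp
    next
      case ndiv: False
      then have "\<not> int q dvd m'" "\<not> int q dvd n'" "\<not> int q dvd s" by auto
      obtain k where k: "k \<in> {0..<int q}" "int q dvd s * u + k * m'"
        using linear_root_mod_prime[OF prime_q \<open>\<not> int q dvd m'\<close>, of "s * u"] by blast
      obtain l where l: "l \<in> {0..<int q}" "int q dvd s * v + l * n'"
        using linear_root_mod_prime[OF prime_q \<open>\<not> int q dvd n'\<close>, of "s * v"] by blast
      have "k \<noteq> l" using k l det_dvd(1) \<open>\<not> int q dvd s\<close> by blast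
      have "card (good s) \<le> card ({0..<int q} - {k, l})"
        using k l True by (intro card_mono) (unfold good_def, auto)
      also have "\<dots> = q - 2"
      proof -
        have "{k, l} \<subseteq> {0..<int q}" "card {k, l} = 2" using k(1) l(1) \<open>k \<noteq> l\<close> by auto
        then show ?thesis by (simp add: card_Diff_subset)
      qed
      finally have "real (card (good s)) \<le> real q - 2" using q_gt_1 by linarith
      then have "real (card (good s)) / real q \<le> (real q - 2) / real q" using q by (intro divide_right_mono) auto
      also have "\<dots> = 1 - 2 / real q" using q by (simp add: diff_divide_distrib)
      also have "\<dots> \<le> 1 - 2 / real q + (1 / real q) * (1 / real q)" by simp
      also have "\<dots> = dens" by (simp add: dens algebra_simps)
      finally show ?thesis using ndiv by simp
    qed
  qed
qed

end

text \<open>For J = p^k with p prime to mn, the divisibility says that a/m and b/n have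
  \<open>p\<close>-adic distance at most 1/J.\<close>

definition close_pairs :: "nat \<Rightarrow> nat \<Rightarrow> nat \<Rightarrow> (int \<times> int) set" where
  "close_pairs J m n = {(a, b). a \<in> signed_totatives m \<and> b \<in> signed_totatives n \<and>
     int J dvd a * int n - b * int m}"

lemma signed_totatives_cross_eq:
  assumes "a \<in> signed_totatives m" "b \<in> signed_totatives n" "a * int n = b * int m" "m > 0" "n > 0"
  shows "m = n \<and> a = b"
proof -
  have "int m dvd a * int n" "int n dvd b * int m" using assms(3) by (metis dvd_triv_right)+
  then have "int m dvd int n" "int n dvd int m"
    using assms(1,2) by (auto simp: signed_totatives_def coprime_dvd_mult_right_iff coprime_commute)
  then have "m = n" by (simp add: dvd_antisym)
  with assms show ?thesis by simp
qed

lemma primorial_threshold: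
  fixes X :: nat
  assumes "X \<ge> 1"
  obtains y where "y > 0" "y ^ y \<le> X" "X < Suc y ^ Suc y"
proof -
  define z where "z = (LEAST z. X < z ^ z)"
  have "X < Suc X ^ Suc X" using self_le_power[of "Suc X" "Suc X"] by linarith
  then have z: "X < z ^ z" unfolding z_def by (rule LeastI)
  \<comment> \<open>Both 0 ^ 0 and 1 ^ 1 equal 1 <= X, so the least z is at least 2 and y is
    positive.\<close>
  have "z \<noteq> 0" using z assms by (intro notI) simp
  moreover have "z \<noteq> 1" using z assms by (intro notI) simp
  ultimately obtain y where y: "z = Suc y" "y > 0" by (cases z) auto
  have "\<not> X < y ^ y" using not_less_Least[of y "\<lambda>z. X < z ^ z"] y(1) unfolding z_def by simp
  then show thesis using that[of y] y z by (simp only: not_less)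
qed

text \<open>Primes up to \<open>y\<close>, where \<open>y\<^sup>y \<le> X < (y + 1)\<^sup>y\<^sup>+\<^sup>1\<close>, have product at most \<open>X\<close>, so that the sum over them
  is evaluated by complete residue systems. A number below \<open>X\<^sup>3\<close> has fewer than \<open>3 (y + 1)\<close> prime
  factors above \<open>y\<close>, so the large primes only cost a bounded factor.\<close>

lemma sum_local_densities_le:
  fixes c :: "nat \<Rightarrow> int \<Rightarrow> real" and e :: "nat \<Rightarrow> real" and X v :: nat and PF :: "nat set"
  assumes "finite PF" "\<And>q. q \<in> PF \<Longrightarrow> prime q" "X \<ge> 1" "v > 0" "v \<le> X ^ 2"
    and c0: "\<And>q s. q \<in> PF \<Longrightarrow> c q s \<ge> 0"
    and per: "\<And>q s. q \<in> PF \<Longrightarrow> c q (s mod int q) = c q s"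
    and e0: "\<And>q. q \<in> PF \<Longrightarrow> e q \<ge> 0"
    and mean: "\<And>q. q \<in> PF \<Longrightarrow> (\<Sum>s\<in>{0..<int q}. c q s) / real q \<le> e q"
    and ptw: "\<And>q s. q \<in> PF \<Longrightarrow> c q s \<le> e q * (if int q dvd int v * s then inverse (1 - 1 / real q) else 1)"
  shows "(\<Sum>s\<in>{- int X..int X} - {0}. \<Prod>q\<in>PF. c q s) \<le> exp 6 * (4 * real X) * (\<Prod>q\<in>PF. e q)"
proof -
  obtain y where y: "y > 0" "y ^ y \<le> X" "X < Suc y ^ Suc y" using primorial_threshold assms(3) by blast
  define Q1 where "Q1 = {q\<in>PF. q \<le> y}"
  define Q2 where "Q2 = {q\<in>PF. q > y}"
  have PF: "PF = Q1 \<union> Q2" "Q1 \<inter> Q2 = {}" "finite Q1" "finite Q2"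
    using assms(1) by (auto simp: Q1_def Q2_def)
  have split: "(\<Prod>q\<in>PF. f q) = (\<Prod>q\<in>Q1. f q) * (\<Prod>q\<in>Q2. f q)" for f :: "nat \<Rightarrow> real"
    unfolding PF(1) by (rule prod.union_disjoint) (use PF in auto)
  have e2: "(\<Prod>q\<in>Q2. e q) \<ge> 0" "(\<Prod>q\<in>Q1. e q) \<ge> 0"
    using e0 by (auto intro!: prod_nonneg simp: Q2_def Q1_def)
  define R where "R = \<Prod>Q1"
  have R0: "R > 0" unfolding R_def using assms(2) by (auto intro!: prod_pos simp: Q1_def prime_gt_0_nat)
  have "R \<le> (\<Prod>q\<in>Q1. y)" unfolding R_def by (intro prod_mono) (auto simp: Q1_def)
  also have "\<dots> = y ^ card Q1" by simp
  also have "\<dots> \<le> y ^ y"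
  proof (rule power_increasing)
    have "Q1 \<subseteq> {1..y}" using assms(2) by (auto simp: Q1_def Suc_le_eq prime_gt_0_nat)
    from card_mono[OF _ this] show "card Q1 \<le> y" by simp
  qed (use y in auto)
  finally have RX: "R \<le> X" using y(2) by simp
  \<comment> \<open>For nonzero s the number v |s| is positive and at most X^3, so few large primes
    divide it. The value s = 0 is left out because every prime divides it.\<close>
  have large: "(\<Prod>q\<in>Q2. c q s) \<le> exp 6 * (\<Prod>q\<in>Q2. e q)" if s: "s \<in> {- int X..int X} - {0}" for s
  proof -
    let ?D = "{q\<in>Q2. int q dvd int v * s}"
    have "(\<Prod>q\<in>Q2. c q s) \<le> (\<Prod>q\<in>Q2. e q * (if int q dvd int v * s then inverse (1 - 1 / real q) else 1))"
      using c0 ptw by (intro prod_mono) (auto simp: Q2_def)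
    also have "\<dots> = (\<Prod>q\<in>Q2. e q) * (\<Prod>q\<in>?D. inverse (1 - 1 / real q))"
      using PF(4) by (simp add: prod.distrib prod.inter_filter)
    also have "(\<Prod>q\<in>?D. inverse (1 - 1 / real q)) \<le> exp 6"
    proof (rule prod_large_prime_factors_le[of "v * nat \<bar>s\<bar>" X y])
      show "v * nat \<bar>s\<bar> > 0" using s assms(4) by auto
      have "nat \<bar>s\<bar> \<le> X" using s by auto
      then have "v * nat \<bar>s\<bar> \<le> X ^ 2 * X" using assms(5) by (intro mult_le_mono)
      then show "v * nat \<bar>s\<bar> \<le> X ^ 3" by (simp add: power2_eq_square power3_eq_cube)
      show "prime q \<and> q dvd v * nat \<bar>s\<bar> \<and> y < q" if "q \<in> ?D" for q
      proof -
        have "int q dvd int (v * nat \<bar>s\<bar>)" using that by (auto simp: abs_if)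
        then have "q dvd v * nat \<bar>s\<bar>" by (simp only: of_nat_dvd_iff)
        then show ?thesis using that assms(2) by (auto simp: Q2_def)
      qed
    qed (use y PF in auto)
    finally show ?thesis using e2 by (simp add: mult_left_mono mult.commute[of "exp 6"])
  qed
  \<comment> \<open>So many periods of length R cover the 2X + 1 integers from -X to X; R <= X keeps
    their total length below 4X.\<close>
  define K where "K = (2 * X) div R + 1"
  have KR: "real K * real R \<le> 4 * real X" "2 * X + 1 \<le> K * R"
  proof -
    have "K * R \<le> 2 * X + R" by (simp add: K_def)
    then have "K * R \<le> 4 * X" using RX by linarith
    then have "real (K * R) \<le> real (4 * X)" by (simp only: of_nat_le_iff)
    then show "real K * real R \<le> 4 * real X" by simp
    have "2 * X < K * R" using R0 by (simp add: K_def dividend_less_div_times add.commute)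
    then show "2 * X + 1 \<le> K * R" by simp
  qed
  have red: "(\<Prod>q\<in>Q1. c q (s mod int R)) = (\<Prod>q\<in>Q1. c q s)" for s
  proof (rule prod.cong[OF refl])
    fix q assume q: "q \<in> Q1"
    have "q dvd R" unfolding R_def using dvd_prodI[OF PF(3) q, of "\<lambda>x. x"] by simp
    then have "s mod int R mod int q = s mod int q" by (intro mod_mod_cancel) simp
    then show "c q (s mod int R) = c q s" using per[of q s] per[of q "s mod int R"] q by (simp add: Q1_def)
  qed
  have c1: "(\<Prod>q\<in>Q1. c q s) \<ge> 0" for s using c0 by (auto intro!: prod_nonneg simp: Q1_def)
  have "(\<Sum>s\<in>{- int X..int X} - {0}. \<Prod>q\<in>PF. c q s)
      \<le> (\<Sum>s\<in>{- int X..int X} - {0}. (exp 6 * (\<Prod>q\<in>Q2. e q)) * (\<Prod>q\<in>Q1. c q s))"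
  proof (rule sum_mono)
    fix s assume "s \<in> {- int X..int X} - {0}"
    from mult_left_mono[OF large[OF this] c1[of s]]
    show "(\<Prod>q\<in>PF. c q s) \<le> (exp 6 * (\<Prod>q\<in>Q2. e q)) * (\<Prod>q\<in>Q1. c q s)"
      unfolding split by (simp add: mult_ac)
  qed
  also have "\<dots> = (exp 6 * (\<Prod>q\<in>Q2. e q)) * (\<Sum>s\<in>{- int X..int X} - {0}. \<Prod>q\<in>Q1. c q s)"
    by (simp add: sum_distrib_left)
  also have "\<dots> \<le> (exp 6 * (\<Prod>q\<in>Q2. e q)) * (\<Sum>s\<in>{- int X..<- int X + int K * int R}. \<Prod>q\<in>Q1. c q s)"
  proof (intro mult_left_mono sum_mono2)
    have "int (2 * X + 1) \<le> int (K * R)" using KR(2) by (simp only: of_nat_le_iff)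
    then have "2 * int X + 1 \<le> int K * int R" by simp
    then show "{- int X..int X} - {0} \<subseteq> {- int X..<- int X + int K * int R}" by auto
  qed (use c1 e2 in auto)
  also have "(\<Sum>s\<in>{- int X..<- int X + int K * int R}. \<Prod>q\<in>Q1. c q s) = real K * (\<Sum>s\<in>{0..<int R}. \<Prod>q\<in>Q1. c q s)"
    using R0 red by (intro sum_periodic_window) auto
  also have "(\<Sum>s\<in>{0..<int R}. \<Prod>q\<in>Q1. c q s) = (\<Prod>q\<in>Q1. \<Sum>s\<in>{0..<int q}. c q s)"
    unfolding R_def using assms(2) per PF(3)
    by (intro sum_prod_coprime_periodic) (auto simp: Q1_def intro: primes_coprime prime_gt_0_nat)
  also have "\<dots> \<le> (\<Prod>q\<in>Q1. real q * e q)"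
  proof (intro prod_mono conjI)
    fix q assume q: "q \<in> Q1"
    then have "prime q" "q \<in> PF" using assms(2) by (auto simp: Q1_def)
    then show "(\<Sum>s\<in>{0..<int q}. c q s) \<le> real q * e q"
      using mean[of q] by (simp add: pos_divide_le_eq prime_gt_0_nat mult.commute)
    show "0 \<le> (\<Sum>s\<in>{0..<int q}. c q s)" using c0 \<open>q \<in> PF\<close> by (intro sum_nonneg)
  qed
  also have "(\<Prod>q\<in>Q1. real q * e q) = real R * (\<Prod>q\<in>Q1. e q)" by (simp add: R_def prod.distrib)
  finally have "(\<Sum>s\<in>{- int X..int X} - {0}. \<Prod>q\<in>PF. c q s)
      \<le> (exp 6 * (\<Prod>q\<in>Q2. e q)) * (real K * (real R * (\<Prod>q\<in>Q1. e q)))"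
    using e2 by (simp add: mult_left_mono)
  also have "\<dots> = exp 6 * (real K * real R) * (\<Prod>q\<in>PF. e q)" by (simp add: split mult_ac)
  also have "\<dots> \<le> exp 6 * (4 * real X) * (\<Prod>q\<in>PF. e q)"
    using KR(1) e2 by (intro mult_right_mono mult_left_mono) (auto simp: split)
  finally show ?thesis .
qed

lemma prod_prime_density:
  assumes "m > 0" "n > 0"
  shows "(\<Prod>q\<in>prime_factors (m * n). local_density.dens q (q dvd m) (q dvd n)) =
     real (totient m) * real (totient n) / (real m * real n)"
proof -
  have PF: "prime_factors (m * n) = prime_factors m \<union> prime_factors n"
    using assms by (intro prime_factors_product) auto
  have dvd: "q dvd k \<longleftrightarrow> q \<in> prime_factors k" if "q \<in> prime_factors (m * n)" "k > 0" for q k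
    using that by (auto simp: in_prime_factors_iff)
  have one: "(\<Prod>q\<in>prime_factors (m * n). if q dvd k then 1 - 1 / real q else 1) = real (totient k) / real k"
    if k: "k > 0" "prime_factors k \<subseteq> prime_factors (m * n)" for k
  proof -
    have "(\<Prod>q\<in>prime_factors (m * n). if q dvd k then 1 - 1 / real q else 1)
        = (\<Prod>q\<in>prime_factors (m * n). if q \<in> prime_factors k then 1 - 1 / real q else 1)"
      using dvd[OF _ k(1)] by (intro prod.cong) auto
    also have "\<dots> = (\<Prod>q\<in>prime_factors (m * n) \<inter> prime_factors k. 1 - 1 / real q)"
      by (subst prod.inter_restrict) auto
    also have "prime_factors (m * n) \<inter> prime_factors k = prime_factors k" using k(2) by blast
    finally show ?thesis using k(1) by (simp add: totient_formula2)
  qed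
  have "(\<Prod>q\<in>prime_factors (m * n). local_density.dens q (q dvd m) (q dvd n)) =
     (\<Prod>q\<in>prime_factors (m * n). (if q dvd m then 1 - 1 / real q else 1) * (if q dvd n then 1 - 1 / real q else 1))"
  proof (rule prod.cong[OF refl])
    fix q assume "q \<in> prime_factors (m * n)"
    \<comment> \<open>\<open>dens\<close> depends only on q and the two conditions, so the identity
      matrix with determinant 1 serves for the other parameters.\<close>
    then interpret local_density q "q dvd m" "q dvd n" 1 0 0 1 1
      by unfold_locales (auto dest!: in_prime_factors_imp_prime not_prime_unit)
    show "dens = (if q dvd m then 1 - 1 / real q else 1) * (if q dvd n then 1 - 1 / real q else 1)"
      by (simp add: dens_def)
  qed
  also have "\<dots> = (real (totient m) / real m) * (real (totient n) / real n)"
    unfolding prod.distrib using one[of m] one[of n] assms PF by auto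
  finally show ?thesis by simp
qed

text \<open>With d = gcd(m, n), m = m' d and n = n' d, the solutions of a n' - b m' = s J are (a, b)
  = (s u + k m', s v + k n'). For fixed s the parameter k lies in a window of 5d integers, where the
  sieve by the primes of d is exact. Summing over 0 < |s| <= X with dX <= 2mn/J gives the constant 5
  * 4 * 2 = 40, and s = 0 gives the diagonal term.\<close>

proposition card_close_pairs_le:
  assumes "m > 0" "n > 0" "J > 0" "coprime J m" "coprime J n" "J \<le> 2 * m" "J \<le> 2 * n"
  shows "real (card (close_pairs J m n)) \<le> 
    40 * exp 6 * (real (totient m) * real (totient n) / real J) + (if m = n then 3 * real (totient n) else 0)"
proof -
  define d where "d = gcd m n"
  have d0: "d > 0" using assms by (simp add: d_def)
  obtain m' n' where mn: "m = m' * d" "n = n' * d" "coprime m' n'"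
    using gcd_coprime_exists[of m n] d0 unfolding d_def by auto
  have mn0: "m' > 0" "n' > 0" using mn assms by (auto intro!: gr0I)
  obtain x y where "int m' * x + int n' * y = 1"
    using bezout_int[of "int m'" "int n'"] mn(3) by (auto simp: algebra_simps)
  then have bez: "y * int n' - (- x) * int m' = 1" by (simp add: algebra_simps)
  \<comment> \<open>(u, v) is the Bezout solution for determinant 1 multiplied by J.\<close>
  define u where "u = int J * y"
  define v where "v = int J * (- x)"
  have det: "u * int n' - v * int m' = int J"
    using arg_cong[OF bez, of "\<lambda>t. int J * t"] by (simp add: u_def v_def algebra_simps)
  define X where "X = (2 * m * n) div (d * J)"
  \<comment> \<open>Here J <= 2m and J <= 2n enter; they give m' n' <= X^2, as the sum over local
    densities demands.\<close>
  have Xge: "m' \<le> X" "n' \<le> X"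
    using assms(3,6,7) d0 mn0 by (auto simp: X_def less_eq_div_iff_mult_less_eq mn)
  have X1: "X \<ge> 1" using Xge mn0 by linarith
  define PF where "PF = prime_factors (m * n)"
  define c where "c = (\<lambda>q s. real (card (local_density.good q (q dvd m) (q dvd n) u v (int m') (int n') s)) / real q)"
  have ld: "local_density q u v (int m') (int n') (int J)" if "q \<in> PF" for q
  proof
    show p: "prime q" using that by (auto simp: PF_def)
    have "\<not> q dvd J" 
    proof
      assume "q dvd J"
      moreover have "q dvd m \<or> q dvd n" using that p by (auto simp: PF_def in_prime_factors_iff prime_dvd_mult_iff)
      ultimately have "is_unit q" using assms(4,5) by (meson coprime_common_divisor)
      then show False using p by auto
    qed
    then show "\<not> int q dvd int J" by simp
  qed (rule det)
  define T where "T = (\<lambda>s. {k. s * u + k * int m' \<in> signed_totatives m \<and> s * v + k * int n' \<in> signed_totatives n})"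
  \<comment> \<open>Two admissible k differ by at most 2m/m' = 2d, so all of them lie among 4d + 1
    <= 5d consecutive integers.\<close>
  have window: "T s \<subseteq> {k - 2 * int d..<k - 2 * int d + int 5 * int d}" if "k \<in> T s" for s k
  proof
    fix l assume l: "l \<in> T s"
    have "\<bar>l - k\<bar> * int m' = \<bar>(s * u + l * int m') - (s * u + k * int m')\<bar>"
      by (simp add: abs_mult flip: left_diff_distrib)
    also have "\<dots> \<le> 2 * int m" using l that by (auto simp: T_def signed_totatives_def abs_if)
    also have "\<dots> = (2 * int d) * int m'" by (simp add: mn)
    finally have "\<bar>l - k\<bar> \<le> 2 * int d" using mn0 by simp
    then show "l \<in> {k - 2 * int d..<k - 2 * int d + int 5 * int d}" using d0 by auto
  qed
  have finT: "finite (T s)" for s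
  proof (cases "T s = {}")
    case False
    then obtain k where "k \<in> T s" by blast
    from window[OF this] show ?thesis by (rule finite_subset) simp
  qed simp
  have slice: "real (card (T s)) \<le> 5 * real d * (\<Prod>q\<in>PF. c q s)" for s
  proof (cases "T s = {}")
    case True
    then show ?thesis by (auto simp: c_def intro!: prod_nonneg mult_nonneg_nonneg)
  next
    case False
    then obtain k0 where k0: "k0 \<in> T s" by blast
    define P where "P = prime_factors d"
    have PPF: "P \<subseteq> PF" using assms d0 mn by (auto simp: P_def PF_def in_prime_factors_iff)
    have ndvd: "q dvd m \<Longrightarrow> \<not> int q dvd s * u + k * int m'" "q dvd n \<Longrightarrow> \<not> int q dvd s * v + k * int n'"
      if "k \<in> T s" "q \<in> PF" for q k
    proof -
      have p: "prime (int q)" using ld[OF that(2)] by (simp add: local_density_def)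
      have "\<not> is_unit (int q)" using p by auto
      then show "q dvd m \<Longrightarrow> \<not> int q dvd s * u + k * int m'" "q dvd n \<Longrightarrow> \<not> int q dvd s * v + k * int n'"
        using that(1) by (auto simp: T_def signed_totatives_def dest: coprime_common_divisor)
    qed
    have mod: "k mod int q \<in> local_density.good q (q dvd m) (q dvd n) u v (int m') (int n') s"
      if "k \<in> T s" "q \<in> PF" for k q
    proof -
      interpret local_density q "q dvd m" "q dvd n" u v "int m'" "int n'" "int J" by (rule ld[OF that(2)])
      have "(a + (k mod int q) * b) mod int q = (a + k * b) mod int q" for a b
        by (metis mod_add_right_eq mod_mult_left_eq)
      then have "int q dvd a + (k mod int q) * b \<longleftrightarrow> int q dvd a + k * b" for a b
        by (simp add: dvd_eq_mod_eq_0)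
      then show ?thesis using ndvd[OF that] q_gt_1 by (auto simp: good_def)
    qed
    \<comment> \<open>A prime q of mn that does not divide d divides exactly one of m and n, hence
      m' or n' respectively. Its condition then does not involve k, and it holds because it holds at
      \<open>k0\<close>.\<close>
    have rest: "c q s = 1" if "q \<in> PF - P" for q
    proof -
      have qPF: "q \<in> PF" using that by blast
      interpret local_density q "q dvd m" "q dvd n" u v "int m'" "int n'" "int J" by (rule ld[OF qPF])
      have nd: "\<not> q dvd d" using that prime_q d0 by (auto simp: P_def in_prime_factors_iff)
      then have nb: "\<not> (q dvd m \<and> q dvd n)" by (auto simp: d_def)
      have *: "q dvd m \<Longrightarrow> int q dvd int m'" "q dvd n \<Longrightarrow> int q dvd int n'"
        using nd prime_q by (auto simp: mn prime_dvd_mult_iff)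
      have "good s = {0..<int q}"
        using ndvd[OF k0 qPF] * nb by (auto simp: good_def dvd_add_left_iff)
      then show ?thesis using q_gt_1 by (simp add: c_def)
    qed
    define h where "h = (\<lambda>q k. if k mod int q \<in> local_density.good q (q dvd m) (q dvd n) u v (int m') (int n') s then 1 else 0 :: real)"
    have "real (card (T s)) = (\<Sum>k\<in>T s. \<Prod>q\<in>P. h q k)"
      using mod PPF by (simp add: h_def subset_iff)
    also have "\<dots> \<le> real 5 * real d * (\<Prod>q\<in>P. (\<Sum>k\<in>{0..<int q}. h q k) / real q)"
      unfolding P_def by (rule sum_prod_periodic_mod[OF d0 _ _ window[OF k0]]) (auto simp: h_def)
    also have "(\<Prod>q\<in>P. (\<Sum>k\<in>{0..<int q}. h q k) / real q) = (\<Prod>q\<in>P. c q s)"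
    proof (rule prod.cong[OF refl])
      fix q assume "q \<in> P"
      then have "q \<in> PF" using PPF by blast
      interpret local_density q "q dvd m" "q dvd n" u v "int m'" "int n'" "int J" by (rule ld[OF \<open>q \<in> PF\<close>])
      have "(\<Sum>k\<in>{0..<int q}. h q k) = (\<Sum>k\<in>{0..<int q}. if k \<in> good s then 1 else 0)"
        by (intro sum.cong) (auto simp: h_def)
      also have "\<dots> = (\<Sum>k\<in>{0..<int q} \<inter> good s. 1)" by (subst sum.inter_restrict) auto
      also have "{0..<int q} \<inter> good s = good s" by (auto simp: good_def)
      finally show "(\<Sum>k\<in>{0..<int q}. h q k) / real q = c q s" by (simp add: c_def)
    qed
    also have "\<dots> = (\<Prod>q\<in>PF. c q s)"
      using PPF rest by (intro prod.mono_neutral_left) (auto simp: PF_def)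
    finally show ?thesis by simp
  qed
  \<comment> \<open>For s = 0 the fractions a/m and b/n are equal, and both are reduced.\<close>
  have zero: "real (card (T 0)) \<le> (if m = n then 3 * real (totient n) else 0)"
  proof -
    have eq: "m = n" if "k \<in> T 0" for k
      using that signed_totatives_cross_eq[of "k * int m'" m "k * int n'" n] assms(1,2)
      by (auto simp: T_def mn)
    have "inj_on (\<lambda>k. k * int m') (T 0)" using mn0 by (auto intro: inj_onI)
    moreover have "(\<lambda>k. k * int m') ` T 0 \<subseteq> signed_totatives m" by (auto simp: T_def)
    ultimately have "card (T 0) \<le> card (signed_totatives m)" by (intro card_inj_on_le) auto
    also have "\<dots> \<le> 3 * totient m" by (rule card_signed_totatives_le[OF assms(1)])
    finally have "real (card (T 0)) \<le> real (3 * totient m)" by (simp only: of_nat_le_iff)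
    moreover have "card (T 0) = 0" if "m \<noteq> n" using eq that by (metis card.empty equals0I)
    ultimately show ?thesis by auto
  qed
  \<comment> \<open>The inverse of the parametrisation: s from the determinant, k from the Bezout
    coefficients.\<close>
  define F where "F = (\<lambda>(a, b). ((a * int n' - b * int m') div int J, y * b - (- x) * a))"
  have F: "s * u + k * int m' = a \<and> s * v + k * int n' = b \<and> s \<in> {- int X..int X}"
    if ab: "(a, b) \<in> close_pairs J m n" and Fab: "F (a, b) = (s, k)" for a b s k
  proof -
    have "int J dvd int d * (a * int n' - b * int m')"
      using ab by (simp add: close_pairs_def mn algebra_simps)
    moreover have "coprime (int J) (int d)" using assms(4) by (simp add: mn)
    ultimately have "int J dvd a * int n' - b * int m'" by (simp add: coprime_dvd_mult_right_iff)
    then have sJ: "s * int J = a * int n' - b * int m'" using Fab by (auto simp: F_def)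
    have k: "k = y * b - (- x) * a" using Fab by (simp add: F_def)
    have "s * u + k * int m' = (s * int J) * y + k * int m'" by (simp add: u_def algebra_simps)
    also have "\<dots> = a * (y * int n' - (- x) * int m')" unfolding sJ k by (simp add: algebra_simps)
    finally have 1: "s * u + k * int m' = a" by (simp only: bez)
    have "s * v + k * int n' = (s * int J) * (- x) + k * int n'" by (simp add: v_def algebra_simps)
    also have "\<dots> = b * (y * int n' - (- x) * int m')" unfolding sJ k by (simp add: algebra_simps)
    finally have 2: "s * v + k * int n' = b" by (simp only: bez)
    have "\<bar>s\<bar> * int (d * J) = \<bar>int d * (s * int J)\<bar>" by (simp add: abs_mult)
    also have "\<dots> = \<bar>a * int n - b * int m\<bar>" unfolding sJ by (simp add: mn algebra_simps)
    also have "\<dots> \<le> \<bar>a\<bar> * int n + \<bar>b\<bar> * int m" by (rule order_trans[OF abs_triangle_ineq4]) (simp add: abs_mult)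
    also have "\<dots> \<le> int m * int n + int n * int m"
      using ab by (intro add_mono mult_right_mono) (auto simp: close_pairs_def signed_totatives_def)
    also have "\<dots> = int (2 * m * n)" by simp
    finally have "int (nat \<bar>s\<bar> * (d * J)) \<le> int (2 * m * n)" by simp
    then have "nat \<bar>s\<bar> * (d * J) \<le> 2 * m * n" by (simp only: of_nat_le_iff)
    then have "nat \<bar>s\<bar> \<le> X" unfolding X_def using d0 assms(3) by (simp add: less_eq_div_iff_mult_less_eq)
    then have "s \<in> {- int X..int X}" by auto
    with 1 2 show ?thesis by blast
  qed
  have "inj_on F (close_pairs J m n)"
  proof (rule inj_onI)
    fix z w assume zw: "z \<in> close_pairs J m n" "w \<in> close_pairs J m n" "F z = F w"
    obtain s k where sk: "F z = (s, k)" by fastforce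
    show "z = w"
      using F[of "fst z" "snd z" s k] F[of "fst w" "snd w" s k] zw sk by (simp add: prod_eq_iff)
  qed
  moreover have "F ` close_pairs J m n \<subseteq> (SIGMA s:{- int X..int X}. T s)"
  proof
    fix z assume "z \<in> F ` close_pairs J m n"
    then obtain a b where ab: "(a, b) \<in> close_pairs J m n" "z = F (a, b)" by auto
    obtain s k where sk: "z = (s, k)" by fastforce
    show "z \<in> (SIGMA s:{- int X..int X}. T s)"
    proof -
      have "F (a, b) = (s, k)" using ab(2) sk by simp
      from F[OF ab(1) this] ab(1) have "k \<in> T s" "s \<in> {- int X..int X}"
        by (auto simp: T_def close_pairs_def)
      then show ?thesis unfolding sk by blast
    qed
  qed
  ultimately have "card (close_pairs J m n) \<le> card (SIGMA s:{- int X..int X}. T s)"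
    using finT by (intro card_inj_on_le) auto
  also have "\<dots> = (\<Sum>s\<in>{- int X..int X}. card (T s))" using finT by simp
  also have "\<dots> = card (T 0) + (\<Sum>s\<in>{- int X..int X} - {0}. card (T s))"
    by (subst sum.remove[of _ 0]) auto
  finally have "real (card (close_pairs J m n)) \<le> real (card (T 0)) + (\<Sum>s\<in>{- int X..int X} - {0}. real (card (T s)))"
    by (simp flip: of_nat_sum of_nat_add)
  also have "(\<Sum>s\<in>{- int X..int X} - {0}. real (card (T s))) \<le> (\<Sum>s\<in>{- int X..int X} - {0}. 5 * real d * (\<Prod>q\<in>PF. c q s))"
    by (rule sum_mono[OF slice])
  also have "\<dots> = 5 * real d * (\<Sum>s\<in>{- int X..int X} - {0}. \<Prod>q\<in>PF. c q s)" by (simp add: sum_distrib_left)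
  also have "(\<Sum>s\<in>{- int X..int X} - {0}. \<Prod>q\<in>PF. c q s) \<le>
      exp 6 * (4 * real X) * (\<Prod>q\<in>PF. local_density.dens q (q dvd m) (q dvd n))"
  proof (rule sum_local_densities_le[where v = "m' * n'"])
    show "m' * n' \<le> X ^ 2" using Xge by (simp add: power2_eq_square mult_le_mono)
    fix q assume q: "q \<in> PF"
    interpret local_density q "q dvd m" "q dvd n" u v "int m'" "int n'" "int J" by (rule ld[OF q])
    have e: "q dvd m \<or> q dvd n" using q prime_q by (auto simp: PF_def in_prime_factors_iff prime_dvd_mult_iff)
    have nb: "int q dvd int m' * int n'" if "\<not> (q dvd m \<and> q dvd n)"
    proof -
      have "\<not> q dvd d" using that by (auto simp: mn)
      then have "q dvd m' \<or> q dvd n'" using e prime_q by (auto simp: mn prime_dvd_mult_iff)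
      then show ?thesis by auto
    qed
    show "prime q" by (rule prime_q)
    show "0 \<le> dens" unfolding dens_def using q_gt_1 by (auto intro!: mult_nonneg_nonneg)
    show "(\<Sum>s\<in>{0..<int q}. c q s) / real q \<le> dens" unfolding c_def by (rule sum_good_le)
    show "c q s \<ge> 0" "c q (s mod int q) = c q s" for s
      unfolding c_def good_mod by simp_all
    show "c q s \<le> dens * (if int q dvd int (m' * n') * s then inverse (1 - 1 / real q) else 1)" for s
      using card_good_le[OF e nb, of s] unfolding c_def of_nat_mult .
  qed (use X1 mn0 in \<open>auto simp: PF_def\<close>)
  also have "(\<Prod>q\<in>PF. local_density.dens q (q dvd m) (q dvd n)) = real (totient m) * real (totient n) / (real m * real n)"
    unfolding PF_def by (rule prod_prime_density[OF assms(1,2)])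
  finally have *: "real (card (close_pairs J m n)) \<le> real (card (T 0)) +
      5 * real d * (exp 6 * (4 * real X) * (real (totient m) * real (totient n) / (real m * real n)))"
    by (simp add: mult_left_mono)
  have "X * (d * J) \<le> 2 * m * n" unfolding X_def by (rule div_times_less_eq_dividend)
  then have "real (X * (d * J)) \<le> real (2 * m * n)" by (simp only: of_nat_le_iff)
  then have dX: "real d * real X \<le> 2 * (real m * real n) / real J"
    using assms(3) by (simp add: field_simps)
  define Y where "Y = real (totient m) * real (totient n)"
  have "5 * real d * (exp 6 * (4 * real X) * (Y / (real m * real n)))
      = (real d * real X) * (20 * exp 6 * (Y / (real m * real n)))" by simp
  also have "\<dots> \<le> (2 * (real m * real n) / real J) * (20 * exp 6 * (Y / (real m * real n)))"
    by (rule mult_right_mono[OF dX]) (simp add: Y_def)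
  also have "\<dots> = 40 * exp 6 * (Y / real J)" using assms(1,2) by (simp add: field_simps)
  finally show ?thesis using * zero unfolding Y_def by linarith
qed

section \<open>Close pairs of fractions and real approximation sets\<close>

lemma space_circle [simp]: "space circle_measure = {0..<1}"
  and sets_circle: "sets circle_measure = {A. A \<subseteq> {0..<1} \<and> A \<in> sets borel}"
proof -
  show "space circle_measure = {0..<1}" by (simp add: circle_measure_def space_restrict_space)
  show "sets circle_measure = {A. A \<subseteq> {0..<1} \<and> A \<in> sets borel}"
  proof (rule Set.set_eqI)
    fix A :: "real set"
    show "A \<in> sets circle_measure \<longleftrightarrow> A \<in> {A. A \<subseteq> {0..<1} \<and> A \<in> sets borel}"
      using sets_restrict_space_iff[of "{0..<1}" lborel A] by (simp add: circle_measure_def)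
  qed
qed

lemma prob_space_circle: "emeasure circle_measure (space circle_measure) = 1"
  by (simp add: circle_measure_def space_restrict_space emeasure_restrict_space)

lemma measure_circle: "A \<in> sets circle_measure \<Longrightarrow> measure circle_measure A = measure lborel A"
  unfolding circle_measure_def by (subst measure_restrict_space) (auto simp: sets_restrict_space)

lemma emeasure_circle: "A \<in> sets circle_measure \<Longrightarrow> emeasure circle_measure A = emeasure lborel A"
  unfolding circle_measure_def by (subst emeasure_restrict_space) (auto simp: sets_restrict_space)

lemma finite_measure_circle: "finite_measure circle_measure"
  by (rule finite_measureI) (simp add: prob_space_circle del: space_circle)

lemma frac_image_Icc: "frac ` {l..u} = (\<Union>z::int. {l - of_int z..u - of_int z} \<inter> {0..<1::real})"
proof safe
  fix x assume "x \<in> {l..u}"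
  then show "frac x \<in> (\<Union>z::int. {l - of_int z..u - of_int z} \<inter> {0..<1::real})"
    by (intro UN_I[of "\<lfloor>x\<rfloor>"]) (auto simp: frac_def frac_lt_1[unfolded frac_def])
next
  fix x :: real and z :: int assume "x \<in> {l - of_int z..u - of_int z}" "x \<in> {0..<1}"
  then have "x + of_int z \<in> {l..u}" "frac (x + of_int z) = x" by (auto simp: frac_unique_iff)
  then show "x \<in> frac ` {l..u}" by (metis image_eqI)
qed

lemma sets_approx_set [measurable, intro]: "approx_set \<psi> n \<in> sets circle_measure"
proof -
  have "frac ` {l..u} \<in> sets circle_measure" for l u :: real
  proof -
    have "frac ` {l..u} \<in> sets borel" unfolding frac_image_Icc by measurable
    then show ?thesis by (auto simp: sets_circle frac_lt_1)
  qed
  moreover have "finite {a. 1 \<le> a \<and> a \<le> n \<and> coprime a n}" by (rule finite_subset[of _ "{..n}"]) auto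
  ultimately show ?thesis unfolding approx_set_def by (intro sets.finite_UN) auto
qed

lemma approx_set_totatives:
  "approx_set \<psi> n = (\<Union>a\<in>totatives n. frac ` {real a / real n - \<psi> n .. real a / real n + \<psi> n})"
  unfolding approx_set_def by (rule arg_cong[of _ _ "\<lambda>S. \<Union>a\<in>S. _ a"]) (auto simp: in_totatives_iff)

text \<open>An interval of radius at most 3/2 about a point of [0, 1] meets at most five unit cells,
  and each piece has length at most 2 psi(n). The limit 3/2 is the radius 3/J at J = 2.\<close>

lemma measure_approx_set_le:
  assumes "n > 0" "0 \<le> \<psi> n" "\<psi> n \<le> 3 / 2"
  shows "measure circle_measure (approx_set \<psi> n) \<le> 10 * real (totient n) * \<psi> n"
proof -
  let ?I = "\<lambda>a. {real a / real n - \<psi> n .. real a / real n + \<psi> n}"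
  let ?J = "\<lambda>a z. {real a / real n - \<psi> n - of_int z .. real a / real n + \<psi> n - of_int z} \<inter> {0..<1}"
  have meas: "?J a z \<in> sets circle_measure" for a z by (auto simp: sets_circle)
  have "approx_set \<psi> n \<subseteq> (\<Union>a\<in>totatives n. \<Union>z\<in>{-2..2::int}. ?J a z)"
    unfolding approx_set_totatives
  proof (rule UN_mono[OF subset_refl])
    fix a assume "a \<in> totatives n"
    then have a: "0 \<le> real a / real n" "real a / real n \<le> 1" by (auto simp: in_totatives_iff divide_simps)
    show "frac ` ?I a \<subseteq> (\<Union>z\<in>{-2..2::int}. ?J a z)"
      unfolding frac_image_Icc
    proof safe
      fix x :: real and z :: int assume x: "x \<in> {real a / real n - \<psi> n - of_int z..real a / real n + \<psi> n - of_int z}" "x \<in> {0..<1}"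
      then have "real_of_int z < 3" "real_of_int z > -3" using a assms by (auto simp only: atLeastAtMost_iff atLeastLessThan_iff)
      then have "z \<in> {-2..2}" by auto
      then show "x \<in> (\<Union>z\<in>{-2..2::int}. ?J a z)" using x by blast
    qed
  qed
  then have "measure circle_measure (approx_set \<psi> n) \<le> measure circle_measure (\<Union>a\<in>totatives n. \<Union>z\<in>{-2..2::int}. ?J a z)"
    by (rule finite_measure.finite_measure_mono[OF finite_measure_circle]) (intro sets.finite_UN meas; simp)
  also have "\<dots> \<le> (\<Sum>a\<in>totatives n. measure circle_measure (\<Union>z\<in>{-2..2::int}. ?J a z))"
    by (intro measure_UNION_le sets.finite_UN meas) simp_all
  also have "\<dots> \<le> (\<Sum>a\<in>totatives n. \<Sum>z\<in>{-2..2::int}. measure circle_measure (?J a z))"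
    by (intro sum_mono measure_UNION_le meas) simp_all
  also have "\<dots> \<le> (\<Sum>a\<in>totatives n. \<Sum>z\<in>{-2..2::int}. 2 * \<psi> n)"
  proof (intro sum_mono)
    fix a z
    have "measure circle_measure (?J a z) = measure lborel (?J a z)" by (rule measure_circle[OF meas])
    also have "\<dots> \<le> measure lborel {real a / real n - \<psi> n - of_int z .. real a / real n + \<psi> n - of_int z}"
      by (intro measure_mono_fmeasurable) (auto simp: fmeasurable_def emeasure_lborel_Icc_eq)
    also have "\<dots> = 2 * \<psi> n" using assms(2) by simp
    finally show "measure circle_measure (?J a z) \<le> 2 * \<psi> n" .
  qed
  also have "\<dots> = 10 * real (totient n) * \<psi> n" by (simp add: totient_def)
  finally show ?thesis .
qed

text \<open>Intervals of length 1/L to the left of distinct b/n are disjoint because L >= n. Taken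
  half-open and to the left, they stay inside [0, 1) even for b = n, so nothing wraps
  around.\<close>

lemma measure_circle_ge_card:
  assumes "n > 0" "B \<subseteq> totatives n" "n \<le> L" "S \<in> sets circle_measure"
    and sub: "\<And>b. b \<in> B \<Longrightarrow> {real b / real n - 1 / real L..<real b / real n} \<subseteq> S"
  shows "real (card B) / real L \<le> measure circle_measure S"
proof -
  let ?I = "\<lambda>b. {real b / real n - 1 / real L..<real b / real n}"
  have fin: "finite B" using finite_subset[OF assms(2)] by simp
  have L: "1 / real L \<le> 1 / real n" "L > 0" using assms(1,3) by (auto simp: frac_le)
  have meas: "?I b \<in> sets circle_measure" if "b \<in> B" for b
  proof -
    have "?I b \<subseteq> {0..<1}" by (rule subset_trans[OF sub[OF that]]) (use sets.sets_into_space[OF assms(4)] in simp)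
    then show ?thesis unfolding sets_circle mem_Collect_eq by (rule conjI) simp
  qed
  have disj: "disjoint_family_on ?I B"
    unfolding disjoint_family_on_def
  proof (intro ballI impI)
    fix b c assume "b \<in> B" "c \<in> B" "b \<noteq> c"
    have *: "?I b \<inter> ?I c = {}" if "b < c" for b c :: nat
    proof -
      have "(real b + 1) / real n \<le> real c / real n" using that assms(1) by (intro divide_right_mono) auto
      then have "real b / real n \<le> real c / real n - 1 / real L" using L by (simp add: add_divide_distrib)
      then show ?thesis by auto
    qed
    then show "?I b \<inter> ?I c = {}" using *[of b c] *[of c b] \<open>b \<noteq> c\<close> by (cases "b < c") auto
  qed
  have "real (card B) / real L = (\<Sum>b\<in>B. 1 / real L)" by simp
  also have "\<dots> = (\<Sum>b\<in>B. measure circle_measure (?I b))"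
    using meas by (intro sum.cong) (auto simp: measure_circle)
  also have "\<dots> = measure circle_measure (\<Union>b\<in>B. ?I b)"
    using meas disj fin
    by (intro finite_measure.finite_measure_finite_Union[OF finite_measure_circle, symmetric]) auto
  also have "\<dots> \<le> measure circle_measure S"
    using sub assms(4) by (intro finite_measure.finite_measure_mono[OF finite_measure_circle]) auto
  finally show ?thesis .
qed

text \<open>The radius 3/J is the distance 2/J of the two fractions modulo 1 plus the length 1/L <=
  1/J of the interval.\<close>

lemma interval_subset_approx_set:
  assumes "n > 0" "b \<in> totatives n" "n \<le> L" "J \<le> L" "J > 0" "a \<in> totatives m" "\<psi> m = 3 / real J"
    and close: "\<bar>real a / real m - real b / real n - of_int z\<bar> \<le> 2 / real J"
  shows "{real b / real n - 1 / real L..<real b / real n} \<subseteq> approx_set \<psi> m"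
proof
  fix x assume x: "x \<in> {real b / real n - 1 / real L..<real b / real n}"
  have "1 / real L \<le> 1 / real J" using assms(4,5) by (auto simp: frac_le)
  moreover have "\<bar>x - real b / real n\<bar> \<le> 1 / real L" using x by auto
  ultimately have "\<bar>x + of_int z - real a / real m\<bar> \<le> 3 / real J"
    using close by (simp add: abs_le_iff)
  then have mem: "x + of_int z \<in> {real a / real m - \<psi> m..real a / real m + \<psi> m}"
    using assms(7) by (auto simp: abs_le_iff)
  have "1 / real L \<le> 1 / real n" "1 / real n \<le> real b / real n" "real b / real n \<le> 1"
    using assms(1,2,3) by (auto simp: in_totatives_iff frac_le divide_simps)
  then have "0 \<le> x" "x < 1" using x by auto
  then have "frac (x + of_int z) = x" by (simp add: frac_unique_iff)
  then have "x \<in> frac ` {real a / real m - \<psi> m..real a / real m + \<psi> m}" using mem by (metis image_eqI)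
  then show "x \<in> approx_set \<psi> m" unfolding approx_set_totatives using assms(6) by blast
qed

lemma measure_approx_set_ge:
  assumes "n > 0" "\<psi> n = 3 / real J" "n \<le> J"
  shows "real (totient n) / real J \<le> measure circle_measure (approx_set \<psi> n)"
  unfolding totient_def
proof (rule measure_circle_ge_card)
  fix b assume "b \<in> totatives n"
  with assms show "{real b / real n - 1 / real J..<real b / real n} \<subseteq> approx_set \<psi> n"
    by (intro interval_subset_approx_set[where J = J and a = b and z = 0]) auto
qed (use assms in auto)

text \<open>The representative is taken in {1..n} and not in {0..<n}, to match the range of
  \<open>totatives\<close>, which contains 1 for n = 1.\<close>

definition residue_rep :: "nat \<Rightarrow> int \<Rightarrow> nat" where
  "residue_rep n x = nat ((x - 1) mod int n + 1)"

lemma residue_rep_cong: "n > 0 \<Longrightarrow> int n dvd int (residue_rep n x) - x"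
proof -
  assume "n > 0"
  then have "int (residue_rep n x) = (x - 1) mod int n + 1" by (simp add: residue_rep_def)
  then have "int (residue_rep n x) - x = (x - 1) mod int n - (x - 1)" by simp
  also have "int n dvd \<dots>" by (simp add: mod_eq_dvd_iff[symmetric])
  finally show ?thesis .
qed

lemma residue_rep_eq_iff:
  assumes "n > 0"
  shows "residue_rep n x = residue_rep n y \<longleftrightarrow> int n dvd x - y"
proof -
  have "residue_rep n x = residue_rep n y \<longleftrightarrow> (x - 1) mod int n = (y - 1) mod int n"
    using assms by (auto simp: residue_rep_def nat_eq_iff)
  also have "\<dots> \<longleftrightarrow> int n dvd x - y" by (simp add: mod_eq_dvd_iff)
  finally show ?thesis .
qed

lemma residue_rep_id: "b \<in> {1..n} \<Longrightarrow> residue_rep n (int b) = b"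
  by (simp add: residue_rep_def)

lemma residue_rep_totatives:
  assumes "n > 0" "coprime x (int n)"
  shows "residue_rep n x \<in> totatives n"
proof -
  obtain k where k: "int (residue_rep n x) - x = int n * k" using residue_rep_cong[OF assms(1)] by (auto elim: dvdE)
  then have "int (residue_rep n x) = x + k * int n" by (simp add: algebra_simps)
  then have "coprime (residue_rep n x) n"
    using assms(2) coprime_add_mult_iff[of x k "int n"] by (simp flip: coprime_int_iff)
  moreover have "(x - 1) mod int n \<ge> 0" "(x - 1) mod int n + 1 \<le> int n"
    using assms(1) pos_mod_bound[of "int n" "x - 1"] pos_mod_sign[of "int n" "x - 1"] by linarith+
  ultimately show ?thesis using assms(1) unfolding residue_rep_def in_totatives_iff by linarith
qed

text \<open>Let w be an inverse of J modulo mn and a n - b m = J t. The residues a' of w a and b' of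
  w b satisfy a' n - b' m = t modulo mn with |t| <= 2mn/J, so a'/m and b'/n are within 2/J modulo 1.
  The constant is 18 = 9 * 2: reduction of a modulo m and of b modulo n forgets at most 3 * 3
  blocks, and at most two a' belong to one b' because 2/J < 1/m.\<close>

proposition card_close_pairs_le_measure:
  assumes "m > 0" "n > 0" "2 * m < J" "2 * n < L" "J \<le> L" "coprime J m" "coprime J n"
    and "\<psi> m = 3 / real J" "\<psi> n = 3 / real L"
  shows "real (card (close_pairs J m n)) / real L \<le>
    18 * measure circle_measure (approx_set \<psi> m \<inter> approx_set \<psi> n)"
proof -
  have "coprime (int J) (int (m * n))" using assms(6,7) by simp
  then obtain w where "[int J * w = 1] (mod int (m * n))" using cong_solve_coprime_int by blast
  then have w: "int (m * n) dvd int J * w - 1" by (simp only: cong_iff_dvd_diff)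
  have wcop: "coprime w (int m)" "coprime w (int n)"
  proof -
    have "coprime w (int (m * n))"
    proof (rule coprimeI)
      fix c assume c: "c dvd w" "c dvd int (m * n)"
      have "c dvd int J * w" by (rule dvd_mult[OF c(1)])
      moreover have "c dvd int J * w - 1" by (rule dvd_trans[OF c(2) w])
      ultimately have "c dvd int J * w - (int J * w - 1)" by (rule dvd_diff)
      then show "is_unit c" by simp
    qed
    then show "coprime w (int m)" "coprime w (int n)" by auto
  qed
  \<comment> \<open>Pairs of positive reduced numerators with |a/m - b/n - z| <= 2/J for some
    integer z, cleared of denominators.\<close>
  define P where "P = {(a, b). a \<in> totatives m \<and> b \<in> totatives n \<and>
     (\<exists>z::int. int J * \<bar>int a * int n - int b * int m - z * int (m * n)\<bar> \<le> int (2 * m * n))}"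
  \<comment> \<open>The last two components record the block of length m or n that contains the
    numerator; with them the reduction becomes injective.\<close>
  define h where "h = (\<lambda>(a, b). ((residue_rep m (w * a), residue_rep n (w * b)), ((a + int m) div int m, (b + int n) div int n)))"
  have finP: "finite P" by (rule finite_subset[of _ "totatives m \<times> totatives n"]) (auto simp: P_def)
  have "inj_on h (close_pairs J m n)"
  proof (rule inj_onI)
    fix s t assume st: "s \<in> close_pairs J m n" "t \<in> close_pairs J m n" "h s = h t"
    obtain a b a' b' where s: "s = (a, b)" and t: "t = (a', b')" by (cases s, cases t)
    have *: "x = y" if "int k dvd w * x - w * y" "coprime w (int k)" "(x + int k) div int k = (y + int k) div int k" "k > 0" for x y k
    proof -
      have "int k dvd w * (x - y)" using that(1) by (simp add: algebra_simps)
      then have "int k dvd x - y" using that(2) by (simp add: coprime_dvd_mult_right_iff coprime_commute)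
      then have "int k dvd (x + int k) - (y + int k)" by simp
      then have "(x + int k) mod int k = (y + int k) mod int k" by (simp only: mod_eq_dvd_iff)
      then have "(x + int k) div int k * int k + (x + int k) mod int k = (y + int k) div int k * int k + (y + int k) mod int k"
        by (simp only: that(3))
      then have "x + int k = y + int k" by (simp only: div_mult_mod_eq)
      then show ?thesis by simp
    qed
    have "a = a'" by (rule *[of m]) (use st(3) assms(1) wcop(1) in \<open>auto simp: h_def s t residue_rep_eq_iff\<close>)
    moreover have "b = b'" by (rule *[of n]) (use st(3) assms(2) wcop(2) in \<open>auto simp: h_def s t residue_rep_eq_iff\<close>)
    ultimately show "s = t" by (simp add: s t)
  qed
  moreover have "h ` close_pairs J m n \<subseteq> P \<times> ({0..2} \<times> {0..2})"
  proof
    fix t assume "t \<in> h ` close_pairs J m n"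
    then obtain a b where ab: "(a, b) \<in> close_pairs J m n" and t: "t = h (a, b)" by auto
    define a' b' where "a' = residue_rep m (w * a)" and "b' = residue_rep n (w * b)"
    have st: "a \<in> signed_totatives m" "b \<in> signed_totatives n" using ab by (auto simp: close_pairs_def)
    have tot: "a' \<in> totatives m" "b' \<in> totatives n"
      using st wcop assms(1,2) by (auto simp: a'_def b'_def signed_totatives_def intro!: residue_rep_totatives)
    have rng: "(x + int k) div int k \<in> {0..2}" if "- int k \<le> x" "x \<le> int k" "k > 0" for x k
    proof -
      have "(x + int k) div int k \<le> (2 * int k) div int k" using that by (intro zdiv_mono1) auto
      moreover have "(2 * int k) div int k = 2" using that by simp
      moreover have "0 \<le> (x + int k) div int k"
        using pos_imp_zdiv_nonneg_iff[of "int k" "x + int k"] that by linarith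
      ultimately show ?thesis by (simp only: atLeastAtMost_iff)
    qed
    obtain i where i: "int a' - w * a = int m * i" using residue_rep_cong[OF assms(1)] by (auto simp: a'_def elim: dvdE)
    obtain j where j: "int b' - w * b = int n * j" using residue_rep_cong[OF assms(2)] by (auto simp: b'_def elim: dvdE)
    obtain t' where t': "a * int n - b * int m = int J * t'" using ab by (auto simp: close_pairs_def elim: dvdE)
    obtain l where l: "int J * w - 1 = int (m * n) * l" using w by (auto elim: dvdE)
    have "int a' * int n - int b' * int m = w * (a * int n - b * int m) + (i - j) * int (m * n)"
      using i j by (simp add: algebra_simps)
    also have "\<dots> = (int J * w) * t' + (i - j) * int (m * n)" by (simp add: t')
    also have "\<dots> = t' + (l * t' + i - j) * int (m * n)"
      using l by (simp add: algebra_simps)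
    finally have eq: "int a' * int n - int b' * int m - (l * t' + i - j) * int (m * n) = t'" by simp
    have "int J * \<bar>t'\<bar> = \<bar>a * int n - b * int m\<bar>" by (simp add: t' abs_mult)
    also have "\<dots> \<le> \<bar>a\<bar> * int n + \<bar>b\<bar> * int m" by (rule order_trans[OF abs_triangle_ineq4]) (simp add: abs_mult)
    also have "\<dots> \<le> int m * int n + int n * int m"
      using st by (intro add_mono mult_right_mono) (auto simp: signed_totatives_def)
    also have "\<dots> = int (2 * m * n)" by simp
    finally have "int J * \<bar>int a' * int n - int b' * int m - (l * t' + i - j) * int (m * n)\<bar> \<le> int (2 * m * n)"
      by (simp only: eq)
    then have "(a', b') \<in> P" using tot unfolding P_def by blast
    moreover have "(a + int m) div int m \<in> {0..2}" "(b + int n) div int n \<in> {0..2}"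
      using st assms(1,2) by (auto simp only: signed_totatives_def mem_Collect_eq intro!: rng)
    ultimately show "t \<in> P \<times> ({0..2} \<times> {0..2})" by (simp add: t h_def a'_def b'_def)
  qed
  ultimately have "card (close_pairs J m n) \<le> card (P \<times> ({0..2::int} \<times> {0..2::int}))"
    using finP by (intro card_inj_on_le) auto
  then have c1: "card (close_pairs J m n) \<le> 9 * card P" by (simp add: card_cartesian_product)
  define B where "B = snd ` P"
  have B: "B \<subseteq> totatives n" by (auto simp: B_def P_def)
  have finB: "finite B" using finP by (simp add: B_def)
  have close: "\<bar>real a / real m - real b / real n - of_int z\<bar> \<le> 2 / real J"
    if "int J * \<bar>int a * int n - int b * int m - z * int (m * n)\<bar> \<le> int (2 * m * n)" for a b z
  proof -
    have "real_of_int (int J * \<bar>int a * int n - int b * int m - z * int (m * n)\<bar>) \<le> real_of_int (int (2 * m * n))"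
      using that by (simp only: of_int_le_iff)
    then have "real J * \<bar>real a * real n - real b * real m - of_int z * (real m * real n)\<bar> \<le> 2 * (real m * real n)"
      by simp
    also have "real a * real n - real b * real m - of_int z * (real m * real n) =
        (real a / real m - real b / real n - of_int z) * (real m * real n)"
      using assms(1,2) by (simp add: field_simps)
    finally have "(real J * \<bar>real a / real m - real b / real n - of_int z\<bar>) * (real m * real n) \<le> 2 * (real m * real n)"
      by (simp add: abs_mult mult.assoc)
    then have "real J * \<bar>real a / real m - real b / real n - of_int z\<bar> \<le> 2"
      using assms(1,2) by (simp add: mult_le_cancel_right)
    then show ?thesis using assms(3) by (simp add: pos_le_divide_eq mult.commute)
  qed
  have fib: "card {a. (a, b) \<in> P} \<le> 2" for b
  proof -
    define f where "f = \<lfloor>real b / real n * real m\<rfloor>"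
    have "{a. (a, b) \<in> P} \<subseteq> residue_rep m ` {f, f + 1}"
    proof
      fix a assume "a \<in> {a. (a, b) \<in> P}"
      then obtain z where a: "a \<in> totatives m" and z: "\<bar>real a / real m - real b / real n - of_int z\<bar> \<le> 2 / real J"
        unfolding P_def using close by blast
      \<comment> \<open>Hence a - z m is an integer at distance less than 1 from b m/n, which leaves
        only \<open>f\<close> and \<open>f + 1\<close>.\<close>
      have "2 / real J < 1 / real m" using assms(1,3) by (simp add: field_simps flip: of_nat_mult) 
      then have "\<bar>real a / real m - real b / real n - of_int z\<bar> * real m < 1 / real m * real m"
        using z assms(1) by (intro mult_strict_right_mono) auto
      then have "\<bar>(real a / real m - real b / real n - of_int z) * real m\<bar> < 1"
        using assms(1) by (simp add: abs_mult)
      also have "(real a / real m - real b / real n - of_int z) * real m = of_int (int a - z * int m) - real b / real n * real m"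
        using assms(1) by (simp add: algebra_simps)
      finally have "int a - z * int m = f \<or> int a - z * int m = f + 1"
        unfolding f_def by linarith
      moreover have "a = residue_rep m (int a - z * int m)"
      proof -
        have "residue_rep m (int a) = residue_rep m (int a - z * int m)"
          using assms(1) by (simp add: residue_rep_eq_iff)
        then show ?thesis using residue_rep_id[of a m] a by (simp add: in_totatives_iff)
      qed
      ultimately show "a \<in> residue_rep m ` {f, f + 1}" by auto
    qed
    then have "card {a. (a, b) \<in> P} \<le> card (residue_rep m ` {f, f + 1})" by (intro card_mono) auto
    also have "\<dots> \<le> card {f, f + 1}" by (rule card_image_le) simp
    finally show ?thesis by simp
  qed
  have "P \<subseteq> (\<Union>b\<in>B. (\<lambda>a. (a, b)) ` {a. (a, b) \<in> P})" by (force simp: B_def)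
  moreover have finA: "finite {a. (a, b) \<in> P}" for b
    by (rule finite_subset[of _ "fst ` P"]) (use finP in force)+
  ultimately have "card P \<le> card (\<Union>b\<in>B. (\<lambda>a. (a, b)) ` {a. (a, b) \<in> P})"
    using finB by (intro card_mono) auto
  also have "\<dots> \<le> (\<Sum>b\<in>B. card ((\<lambda>a. (a, b)) ` {a. (a, b) \<in> P}))" by (rule card_UN_le[OF finB])
  also have "\<dots> \<le> (\<Sum>b\<in>B. 2)"
    by (intro sum_mono order_trans[OF card_image_le[OF finA] fib])
  finally have c2: "card P \<le> 2 * card B" by simp
  \<comment> \<open>Each b in \<open>B\<close> places an interval of length 1/L into both sets at
    once; it is the finer radius that fixes the length.\<close>
  have "real (card B) / real L \<le> measure circle_measure (approx_set \<psi> m \<inter> approx_set \<psi> n)"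
  proof (rule measure_circle_ge_card[OF assms(2) B])
    fix b assume "b \<in> B"
    then obtain a z where ab: "a \<in> totatives m" "b \<in> totatives n"
      "int J * \<bar>int a * int n - int b * int m - z * int (m * n)\<bar> \<le> int (2 * m * n)"
      by (auto simp: B_def P_def)
    have "{real b / real n - 1 / real L..<real b / real n} \<subseteq> approx_set \<psi> m"
      using assms ab(1,2) close[OF ab(3)] by (intro interval_subset_approx_set) auto
    moreover have "{real b / real n - 1 / real L..<real b / real n} \<subseteq> approx_set \<psi> n"
      using assms ab(2) by (intro interval_subset_approx_set[where J = L and a = b and z = 0]) auto
    ultimately show "{real b / real n - 1 / real L..<real b / real n} \<subseteq> approx_set \<psi> m \<inter> approx_set \<psi> n" by blast
  qed (use assms in auto)
  moreover have "card (close_pairs J m n) \<le> 18 * card B" using c1 c2 by linarith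
  then have "real (card (close_pairs J m n)) / real L \<le> real (18 * card B) / real L"
    by (intro divide_right_mono) (simp_all only: of_nat_le_iff of_nat_0_le_iff)
  ultimately show ?thesis by simp
qed

section \<open>The digit shift and the zero-one law\<close>

definition shift :: "nat \<Rightarrow> real \<Rightarrow> real" where
  "shift p y = frac (real p * y)"

text \<open>The base-\<open>p\<close> digits of \<open>y \<in> [0, 1)\<close>, read in the order after the point, are taken as the
  \<open>p\<close>-adic digits in increasing order of the powers of \<open>p\<close>.\<close>

fun digits :: "nat \<Rightarrow> nat \<Rightarrow> real \<Rightarrow> nat" where
  "digits p 0 y = 0"
| "digits p (Suc k) y = nat \<lfloor>real p * y\<rfloor> + p * digits p k (shift p y)"

lemma shift_in_unit [simp]: "0 \<le> shift p y" "shift p y < 1"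
  by (simp_all add: shift_def frac_lt_1)

lemma shift_funpow_in_unit: "y \<in> {0..<1} \<Longrightarrow> (shift p ^^ i) y \<in> {0..<1}"
  by (cases i) auto

lemma first_digit_less: "y \<in> {0..<1} \<Longrightarrow> p > 0 \<Longrightarrow> nat \<lfloor>real p * y\<rfloor> < p"
proof -
  assume y: "y \<in> {0..<1}" and p: "p > 0"
  have "real p * y < real p * 1" using y p by (intro mult_strict_left_mono) auto
  then have "\<lfloor>real p * y\<rfloor> < int p" by (simp add: floor_less_iff)
  then show ?thesis using p by simp
qed

lemma digits_less: "y \<in> {0..<1} \<Longrightarrow> p > 0 \<Longrightarrow> digits p k y < p ^ k"
proof (induction k arbitrary: y)
  case (Suc k)
  have "digits p k (shift p y) + 1 \<le> p ^ k" using Suc by (simp add: Suc_le_eq)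
  then have "p * (digits p k (shift p y) + 1) \<le> p * p ^ k" by (rule mult_le_mono2)
  then show ?case using first_digit_less[OF Suc.prems] by simp
qed simp

lemma digits_mod: "y \<in> {0..<1} \<Longrightarrow> p > 0 \<Longrightarrow> l \<le> k \<Longrightarrow> digits p k y mod p ^ l = digits p l y"
proof (induction l arbitrary: y k)
  case (Suc l)
  then obtain k' where k: "k = Suc k'" "l \<le> k'" by (cases k) auto
  have IH: "digits p k' (shift p y) mod p ^ l = digits p l (shift p y)"
    using Suc.IH[of "shift p y" k'] Suc.prems(2) k(2) by simp
  have d: "nat \<lfloor>real p * y\<rfloor> < p" by (rule first_digit_less[OF Suc.prems(1,2)])
  have "digits p k y mod (p * p ^ l) = p * (digits p k y div p mod p ^ l) + digits p k y mod p"
    by (rule mod_mult2_eq)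
  also have "digits p k y div p = digits p k' (shift p y)" using d by (simp add: k(1) div_add1_eq)
  also have "digits p k y mod p = nat \<lfloor>real p * y\<rfloor>" using d by (simp add: k(1))
  finally show ?case by (simp add: IH)
qed simp

lemma dist_le_of_digits_eq:
  assumes "digits p k x = digits p k y" "x \<in> {0..<1}" "y \<in> {0..<1}" "p > 0"
  shows "\<bar>x - y\<bar> \<le> 1 / real p ^ k"
  using assms
proof (induction k arbitrary: x y)
  case 0
  then show ?case by auto
next
  case (Suc k)
  have fx: "nat \<lfloor>real p * x\<rfloor> < p" and fy: "nat \<lfloor>real p * y\<rfloor> < p"
    using first_digit_less Suc.prems by blast+
  have "(nat \<lfloor>real p * x\<rfloor> + p * digits p k (shift p x)) mod p = (nat \<lfloor>real p * y\<rfloor> + p * digits p k (shift p y)) mod p"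
    using Suc.prems(1) by simp
  then have eq: "nat \<lfloor>real p * x\<rfloor> = nat \<lfloor>real p * y\<rfloor>" using fx fy by simp
  then have "digits p k (shift p x) = digits p k (shift p y)" using Suc.prems(1,4) by simp
  from Suc.IH[OF this] have IH: "\<bar>shift p x - shift p y\<bar> \<le> 1 / real p ^ k" using Suc.prems(4) by simp
  have "\<lfloor>real p * x\<rfloor> \<ge> 0" "\<lfloor>real p * y\<rfloor> \<ge> 0" using Suc.prems by simp_all
  then have "\<lfloor>real p * x\<rfloor> = \<lfloor>real p * y\<rfloor>" using eq by (simp only: eq_nat_nat_iff)
  then have "shift p x - shift p y = real p * (x - y)" by (simp add: shift_def frac_def algebra_simps)
  then have "real p * \<bar>x - y\<bar> \<le> 1 / real p ^ k" using IH by (simp add: abs_mult)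
  then show ?case using Suc.prems(4) by (simp add: field_simps)
qed

lemma measurable_shift [measurable]: "shift p \<in> measurable circle_measure circle_measure"
  unfolding circle_measure_def shift_def
  by (intro measurable_restrict_space2 measurable_restrict_space1) (auto simp: frac_lt_1, simp add: frac_def)

lemma measurable_shift_funpow [measurable]: "shift p ^^ i \<in> measurable circle_measure circle_measure"
proof (induction i)
  case (Suc i)
  have "shift p \<circ> (shift p ^^ i) \<in> measurable circle_measure circle_measure"
    by (rule measurable_comp[OF Suc measurable_shift])
  then show ?case by simp
qed (simp add: id_def)

lemma measurable_digits [measurable]: "digits p k \<in> measurable circle_measure (count_space UNIV)"
proof (induction k)
  case (Suc k)
  have 1: "(\<lambda>y. digits p k (shift p y)) \<in> measurable circle_measure (count_space UNIV)"
    by (rule measurable_compose[OF measurable_shift Suc])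
  have 2: "(\<lambda>y. \<lfloor>real p * y\<rfloor>) \<in> measurable circle_measure (count_space UNIV)"
    unfolding circle_measure_def by (rule measurable_restrict_space1) measurable
  show ?case using 1 2 by simp
qed (simp add: )

lemma digits_vimage_sets [measurable]: "{y \<in> {0..<1}. digits p k y = j} \<in> sets circle_measure"
proof -
  have "{y \<in> space circle_measure. digits p k y = j} \<in> sets circle_measure" by measurable
  then show ?thesis by simp
qed

text \<open>On the branch with first digit j the shift is affine with slope p and maps onto the
  whole circle.\<close>

lemma measure_first_digit_branch:
  assumes "p > 0" "j < p" "A \<in> sets circle_measure"
  shows "measure circle_measure {y \<in> {0..<1}. nat \<lfloor>real p * y\<rfloor> = j \<and> shift p y \<in> A} = measure circle_measure A / real p"
proof -
  let ?S = "{y. - real j + real p * y \<in> A}"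
  have A: "A \<subseteq> {0..<1}" "A \<in> sets borel" using assms(3) by (auto simp: sets_circle)
  have S: "{y \<in> {0..<1}. nat \<lfloor>real p * y\<rfloor> = j \<and> shift p y \<in> A} = ?S"
  proof (intro equalityI subsetI)
    fix y assume y: "y \<in> {y \<in> {0..<1}. nat \<lfloor>real p * y\<rfloor> = j \<and> shift p y \<in> A}"
    then have "\<lfloor>real p * y\<rfloor> = int j" using assms(1) by auto
    then have "shift p y = - real j + real p * y" by (simp add: shift_def frac_def)
    then show "y \<in> ?S" using y by simp
  next
    fix y assume y: "y \<in> ?S"
    then have r: "real j \<le> real p * y" "real p * y < real j + 1" using A(1) by auto
    then have fl: "\<lfloor>real p * y\<rfloor> = int j" by linarith
    have "0 \<le> real p * y" using r by linarith
    then have "0 \<le> y" using assms(1) by (simp add: zero_le_mult_iff)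
    have "real j + 1 \<le> real p" using assms(2) by linarith
    then have "real p * y < real p * 1" using r by linarith
    then have "y < 1" using assms(1) by (simp add: mult_less_cancel_left)
    have "shift p y \<in> A" using y fl by (simp add: shift_def frac_def)
    with \<open>0 \<le> y\<close> \<open>y < 1\<close> fl show "y \<in> {y \<in> {0..<1}. nat \<lfloor>real p * y\<rfloor> = j \<and> shift p y \<in> A}" by simp
  qed
  have Sb: "?S \<in> sets borel" using A(2) by measurable
  have Sc: "?S \<in> sets circle_measure" unfolding sets_circle using Sb S by blast
  have "emeasure lborel A = emeasure (density (distr lborel borel (\<lambda>x. - real j + real p * x)) (\<lambda>_. ennreal \<bar>real p\<bar>)) A"
    using assms(1) by (subst lborel_real_affine[of "real p" "- real j"]) auto
  also have "\<dots> = ennreal (real p) * emeasure lborel ?S"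
    using A(2) by (simp add: emeasure_density_const emeasure_distr vimage_def)
  finally have "measure lborel A = real p * measure lborel ?S"
    by (simp add: measure_def enn2real_mult)
  moreover have "measure circle_measure {y \<in> {0..<1}. nat \<lfloor>real p * y\<rfloor> = j \<and> shift p y \<in> A} = measure lborel ?S"
    by (simp only: S measure_circle[OF Sc])
  ultimately show ?thesis using assms(1) by (simp add: measure_circle[OF assms(3)])
qed

text \<open>Independence of the first k digits from the tail, by k-fold use of the single branch. It
  yields the measure of the cylinders and the scaling step of the zero-one law.\<close>

lemma measure_digits_branch:
  assumes "p > 0" "j < p ^ k" "A \<in> sets circle_measure"
  shows "measure circle_measure {y \<in> {0..<1}. digits p k y = j \<and> (shift p ^^ k) y \<in> A} = measure circle_measure A / real p ^ k"
  using assms(2)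
proof (induction k arbitrary: j)
  case 0
  have "A \<subseteq> {0..<1}" using assms(3) by (auto simp: sets_circle)
  then have "{y \<in> {0..<1}. digits p 0 y = j \<and> (shift p ^^ 0) y \<in> A} = A" using 0 by auto
  then show ?case by simp
next
  case (Suc k)
  let ?A = "{y \<in> {0..<1}. digits p k y = j div p \<and> (shift p ^^ k) y \<in> A}"
  have "{y \<in> space circle_measure. digits p k y = j div p \<and> (shift p ^^ k) y \<in> A} \<in> sets circle_measure"
    using assms(3) by measurable
  then have meas: "?A \<in> sets circle_measure" by simp
  have "{y \<in> {0..<1}. digits p (Suc k) y = j \<and> (shift p ^^ Suc k) y \<in> A}
      = {y \<in> {0..<1}. nat \<lfloor>real p * y\<rfloor> = j mod p \<and> shift p y \<in> ?A}"
  proof (rule Collect_cong, rule conj_cong[OF refl])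
    fix y :: real assume y: "y \<in> {0..<1}"
    have f: "nat \<lfloor>real p * y\<rfloor> < p" by (rule first_digit_less[OF y assms(1)])
    have "digits p (Suc k) y = j \<longleftrightarrow> nat \<lfloor>real p * y\<rfloor> = j mod p \<and> digits p k (shift p y) = j div p"
    proof
      assume "digits p (Suc k) y = j"
      then show "nat \<lfloor>real p * y\<rfloor> = j mod p \<and> digits p k (shift p y) = j div p"
        using f by (auto simp: div_add1_eq)
    next
      assume "nat \<lfloor>real p * y\<rfloor> = j mod p \<and> digits p k (shift p y) = j div p"
      then show "digits p (Suc k) y = j" by (simp add: mod_mult_div_eq)
    qed
    moreover have "(shift p ^^ Suc k) y = (shift p ^^ k) (shift p y)" by (simp only: funpow_Suc_right o_apply)
    moreover have "shift p y \<in> {0..<1}" by simp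
    ultimately show "(digits p (Suc k) y = j \<and> (shift p ^^ Suc k) y \<in> A) \<longleftrightarrow>
      (nat \<lfloor>real p * y\<rfloor> = j mod p \<and> shift p y \<in> ?A)"
      by (simp only: mem_Collect_eq simp_thms conj_assoc)
  qed
  also have "measure circle_measure \<dots> = measure circle_measure ?A / real p"
    using assms(1) by (intro measure_first_digit_branch meas) auto
  also have "measure circle_measure ?A = measure circle_measure A / real p ^ k"
    using Suc.prems by (intro Suc.IH) (simp add: less_mult_imp_div_less mult.commute)
  finally show ?case using assms(1) by (simp add: field_simps)
qed

lemma measure_digits_eq:
  assumes "p > 0" "j < p ^ k"
  shows "measure circle_measure {y \<in> {0..<1}. digits p k y = j} = 1 / real p ^ k"
proof -
  have "measure circle_measure {0..<1} = 1" using prob_space_circle by (simp add: measure_def)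
  moreover have "{y \<in> {0..<1}. digits p k y = j} = {y \<in> {0..<1}. digits p k y = j \<and> (shift p ^^ k) y \<in> {0..<1}}"
    using shift_funpow_in_unit by blast
  moreover have "{0..<1} \<in> sets circle_measure" by (simp add: sets_circle)
  ultimately show ?thesis using measure_digits_branch[OF assms, of "{0..<1}"] by simp
qed

section \<open>Cylinders, density points and enlarged radii\<close>

definition cylinder :: "nat \<Rightarrow> nat \<Rightarrow> real \<Rightarrow> real set" where
  "cylinder p k x = {y \<in> {0..<1}. digits p k y = digits p k x}"

lemma cylinder_sets [measurable]: "cylinder p k x \<in> sets circle_measure"
  unfolding cylinder_def by measurable

lemma measure_cylinder: "p > 0 \<Longrightarrow> x \<in> {0..<1} \<Longrightarrow> measure circle_measure (cylinder p k x) = 1 / real p ^ k"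
  unfolding cylinder_def by (intro measure_digits_eq digits_less)

text \<open>An ultrametric Vitali covering argument: the maximal admissible cylinders inside an open
  neighbourhood of \<open>D\<close> are pairwise disjoint.\<close>

lemma measure_zero_if_thin_cylinders:
  assumes p: "p \<ge> 2" and D: "D \<in> sets circle_measure" and c: "0 < c" "c \<le> 1"
    and thin: "\<And>x K. x \<in> D \<Longrightarrow> \<exists>l\<ge>K. measure circle_measure (D \<inter> cylinder p l x) \<le> (1 - c) / real p ^ l"
  shows "measure circle_measure D = 0"
proof -
  interpret finite_measure circle_measure by (rule finite_measure_circle)
  let ?\<mu> = "emeasure circle_measure"
  have p0: "p > 0" using p by simp
  have D1: "D \<subseteq> {0..<1}" "D \<in> sets borel" using D by (auto simp: sets_circle)
  \<comment> \<open>With e tending to 0 this becomes c times the measure of \<open>D\<close> <= 0.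
    The error e is the excess of the open neighbourhood \<open>U\<close> over
    \<open>D\<close>.\<close>
  have key: "measure circle_measure D \<le> (1 - c) * (measure circle_measure D + e)" if e: "e > 0" for e
  proof -
    obtain U where U: "open U" "D \<subseteq> U" "emeasure lborel (U - D) < e"
      using outer_regular_lborel[OF D1(2) e] by blast
    define P where "P = (\<lambda>x l. cylinder p l x \<subseteq> U \<and> measure circle_measure (D \<inter> cylinder p l x) \<le> (1 - c) / real p ^ l)"
    have exP: "\<exists>l. P x l" if x: "x \<in> D" for x
    proof -
      obtain r where r: "r > 0" "ball x r \<subseteq> U" using U(1,2) x by (meson open_contains_ball subsetD)
      obtain K where K: "(1 / real p) ^ K < r" using real_arch_pow_inv[of r "1 / real p"] r(1) p by auto
      obtain l where l: "l \<ge> K" "measure circle_measure (D \<inter> cylinder p l x) \<le> (1 - c) / real p ^ l"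
        using thin[OF x, of K] by blast
      have "(1 / real p) ^ l \<le> (1 / real p) ^ K" using p l(1) by (intro power_decreasing) auto
      then have lr: "1 / real p ^ l < r" using K by (simp add: power_one_over)
      have "cylinder p l x \<subseteq> ball x r"
      proof
        fix y assume y: "y \<in> cylinder p l x"
        then have "\<bar>x - y\<bar> \<le> 1 / real p ^ l"
          using x D1(1) p0 by (intro dist_le_of_digits_eq) (auto simp: cylinder_def)
        then show "y \<in> ball x r" using lr by (simp add: dist_real_def)
      qed
      then show ?thesis using l(2) r(2) unfolding P_def by blast
    qed
    \<comment> \<open>The least admissible level, that is the largest admissible cylinder about
      x.\<close>
    define L where "L = (\<lambda>x. LEAST l. P x l)"
    have PL: "P x (L x)" if "x \<in> D" for x unfolding L_def using exP[OF that] by (rule LeastI_ex)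
    have leL: "L x \<le> l" if "P x l" for x l unfolding L_def using that by (rule Least_le)
    define F where "F = (\<lambda>x. cylinder p (L x) x) ` D"
    have self: "x \<in> cylinder p l x" if "x \<in> D" for x l using that D1(1) by (auto simp: cylinder_def)
    have cyl_eq: "cylinder p l x = cylinder p l y" if "y \<in> cylinder p l x" for x y l
      using that by (auto simp: cylinder_def)
    have "disjoint_family_on (\<lambda>C. C) F"
    proof -
      \<comment> \<open>If the cylinders meet, the coarser one about x is also a cylinder about y.
        Admissibility is a property of the set alone, so minimality of \<open>L y\<close> forces
        equal levels.\<close>
      have "cylinder p (L x) x = cylinder p (L y) y"
        if xy: "x \<in> D" "y \<in> D" "cylinder p (L x) x \<inter> cylinder p (L y) y \<noteq> {}" "L x \<le> L y" for x y
      proof -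
        obtain z where z: "z \<in> cylinder p (L x) x" "z \<in> cylinder p (L y) y" using xy(3) by blast
        have zyx: "z \<in> {0..<1}" "y \<in> {0..<1}" "x \<in> {0..<1}" using z xy D1(1) by (auto simp: cylinder_def)
        have "digits p (L y) z = digits p (L y) y" "digits p (L x) z = digits p (L x) x"
          using z by (auto simp: cylinder_def)
        then have "digits p (L x) y = digits p (L x) x"
          using digits_mod[OF zyx(1) p0 xy(4)] digits_mod[OF zyx(2) p0 xy(4)] by simp
        then have "y \<in> cylinder p (L x) x" using zyx by (simp add: cylinder_def)
        then have eq: "cylinder p (L x) x = cylinder p (L x) y" by (rule cyl_eq)
        then have "P y (L x)" using PL[OF xy(1)] by (simp add: P_def)
        then have "L y = L x" using leL xy(4) by (simp add: antisym)
        then show ?thesis using eq by simp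
      qed
      note * = this
      have "cylinder p (L x) x = cylinder p (L y) y"
        if xy: "x \<in> D" "y \<in> D" "cylinder p (L x) x \<inter> cylinder p (L y) y \<noteq> {}" for x y
        using *[of x y] *[of y x] xy by (cases "L x \<le> L y") (auto simp: Int_commute)
      then show ?thesis unfolding disjoint_family_on_def F_def by auto
    qed
    moreover have "countable F"
    proof (rule countable_subset)
      show "F \<subseteq> (\<lambda>(l, j). {y \<in> {0..<1}. digits p l y = j}) ` UNIV"
        by (auto simp: F_def cylinder_def)
    qed simp
    ultimately have F: "disjoint_family_on (\<lambda>C. C) F" "countable F" .
    have Fsets: "C \<in> sets circle_measure" if "C \<in> F" for C using that by (auto simp: F_def)
    have DF: "D = (\<Union>C\<in>F. D \<inter> C)" unfolding F_def using self by fastforce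
    have "?\<mu> D = ?\<mu> (\<Union>C\<in>F. D \<inter> C)" using DF by simp
    also have "\<dots> = (\<integral>\<^sup>+C. ?\<mu> (D \<inter> C) \<partial>count_space F)"
      using F D Fsets by (intro emeasure_UN_countable) (auto simp: disjoint_family_on_def)
    also have "\<dots> \<le> (\<integral>\<^sup>+C. ennreal (1 - c) * ?\<mu> C \<partial>count_space F)"
    proof (rule nn_integral_mono)
      fix C assume "C \<in> space (count_space F)"
      then obtain x where x: "x \<in> D" "C = cylinder p (L x) x" by (auto simp: F_def)
      have "measure circle_measure (D \<inter> C) \<le> (1 - c) * measure circle_measure C"
        using PL[OF x(1)] x D1(1) p0 by (simp add: P_def measure_cylinder subset_iff)
      then show "?\<mu> (D \<inter> C) \<le> ennreal (1 - c) * ?\<mu> C"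
        using c by (simp add: emeasure_eq_measure ennreal_mult[symmetric])
    qed
    also have "\<dots> = ennreal (1 - c) * (\<integral>\<^sup>+C. ?\<mu> C \<partial>count_space F)"
      by (subst nn_integral_cmult) auto
    also have "(\<integral>\<^sup>+C. ?\<mu> C \<partial>count_space F) = ?\<mu> (\<Union>C\<in>F. C)"
      using F Fsets by (intro emeasure_UN_countable[symmetric]) auto
    also have "\<dots> \<le> ?\<mu> (D \<union> (U - D) \<inter> {0..<1})"
    proof (rule emeasure_mono)
      show "(\<Union>C\<in>F. C) \<subseteq> D \<union> (U - D) \<inter> {0..<1}"
        using PL by (auto simp: F_def P_def cylinder_def)
      show "D \<union> (U - D) \<inter> {0..<1} \<in> sets circle_measure"
        using D1 U(1) by (auto simp: sets_circle)
    qed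
    also have "\<dots> \<le> ?\<mu> D + ?\<mu> ((U - D) \<inter> {0..<1})"
      using D D1 U(1) by (intro emeasure_subadditive) (auto simp: sets_circle)
    also have "?\<mu> ((U - D) \<inter> {0..<1}) = emeasure lborel ((U - D) \<inter> {0..<1})"
      using D1 U(1) by (intro emeasure_circle) (auto simp: sets_circle)
    also have "\<dots> \<le> emeasure lborel (U - D)" using D1 U(1) by (intro emeasure_mono) auto
    also have "\<dots> \<le> ennreal e" using U(3) by simp
    finally have "?\<mu> D \<le> ennreal (1 - c) * (?\<mu> D + ennreal e)" by (simp add: mult_left_mono add_left_mono)
    then have "ennreal (measure circle_measure D) \<le> ennreal ((1 - c) * (measure circle_measure D + e))"
      using c e by (simp add: emeasure_eq_measure ennreal_mult' flip: ennreal_plus)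
    then show ?thesis using c e by (subst (asm) ennreal_le_iff) auto
  qed
  have "c * measure circle_measure D \<le> e" if "e > 0" for e
  proof -
    have "(1 - c) * (measure circle_measure D + e) \<le> (1 - c) * measure circle_measure D + e"
      using c that by (simp add: algebra_simps)
    then show ?thesis using key[OF that] by (simp add: algebra_simps)
  qed
  then have "c * measure circle_measure D \<le> 0" by (rule field_le_epsilon[of _ 0, simplified])
  then show ?thesis using c by (simp add: mult_le_0_iff measure_le_0_iff)
qed

text \<open>If p does not divide n, this is the preimage under the digit map of the union of the
  balls of radius p^-k about the reduced a/n: multiplication by the unit n does not change
  \<open>p\<close>-adic distances.\<close>

definition hit :: "nat \<Rightarrow> nat \<Rightarrow> nat \<Rightarrow> real set" where
  "hit p k n = {y \<in> {0..<1}. \<exists>a\<in>signed_totatives n. int (p ^ k) dvd int n * int (digits p k y) - a}"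

lemma hit_sets [measurable]: "hit p k n \<in> sets circle_measure"
proof -
  have "{y \<in> space circle_measure. \<exists>a\<in>signed_totatives n. int (p ^ k) dvd int n * int (digits p k y) - a} \<in> sets circle_measure"
    by measurable
  then show ?thesis by (simp add: hit_def)
qed

lemma shift_mem_hit:
  assumes p: "p \<ge> 2" and y: "y \<in> hit p k n" and cop: "coprime p n"
  shows "shift p y \<in> hit p (k - 1) n"
proof (cases k)
  case 0
  then show ?thesis using y by (auto simp: hit_def)
next
  case (Suc l)
  obtain b where b: "b \<in> signed_totatives n" "int (p ^ k) dvd int n * int (digits p k y) - b"
    using y by (auto simp: hit_def)
  define d where "d = nat \<lfloor>real p * y\<rfloor>"
  have d: "d < p" unfolding d_def using y p by (intro first_digit_less) (auto simp: hit_def)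
  obtain t where t: "int n * int (digits p k y) - b = int (p ^ k) * t" using b(2) by (auto elim: dvdE)
  \<comment> \<open>The number (b - n d)/p, with \<open>t\<close> used to write it as an integer
    without a division.\<close>
  define a where "a = int n * int (digits p l (shift p y)) - int (p ^ l) * t"
  have bpa: "b = int n * int d + int p * a"
    using t by (simp add: a_def Suc d_def algebra_simps)
  have cop_a: "coprime a (int n)"
  proof (rule coprimeI)
    fix e assume e: "e dvd a" "e dvd int n"
    then have "e dvd b" unfolding bpa by simp
    then show "is_unit e" using b(1) e(2) coprime_common_divisor[of b "int n" e] by (simp add: signed_totatives_def)
  qed
  \<comment> \<open>From p a = b - n d with 0 <= d <= p - 1 one gets p |a| <= n + n (p - 1), so the
    range [-n, n] of numerators is preserved.\<close>
  have "\<bar>int p * a\<bar> \<le> int n + int n * int d" 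
  proof -
    have "0 \<le> int n * int d" by simp
    moreover have "- int n \<le> b" "b \<le> int n" using b(1) by (simp_all add: signed_totatives_def)
    ultimately show ?thesis using bpa unfolding abs_le_iff by linarith
  qed
  also have "\<dots> = int n * (1 + int d)" by (simp add: algebra_simps)
  also have "\<dots> \<le> int n * int p" using d by (intro mult_left_mono) auto
  finally have "int p * \<bar>a\<bar> \<le> int p * int n" by (simp add: abs_mult mult.commute)
  then have "\<bar>a\<bar> \<le> int n" using p by simp
  then have "a \<in> signed_totatives n" using cop_a by (auto simp: signed_totatives_def abs_le_iff)
  moreover have "int (p ^ l) dvd int n * int (digits p l (shift p y)) - a" by (simp add: a_def)
  ultimately show ?thesis by (auto simp: hit_def Suc)
qed

lemma shift_funpow_mem_hit:
  "p \<ge> 2 \<Longrightarrow> coprime p n \<Longrightarrow> y \<in> hit p k n \<Longrightarrow> (shift p ^^ i) y \<in> hit p (k - i) n"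
proof (induction i)
  case (Suc i)
  then have "shift p ((shift p ^^ i) y) \<in> hit p (k - i - 1) n" by (intro shift_mem_hit) auto
  then show ?case by simp
qed simp

definition hit_limsup :: "nat \<Rightarrow> (nat \<Rightarrow> nat) \<Rightarrow> nat set \<Rightarrow> real set" where
  "hit_limsup p \<kappa> N = {y \<in> {0..<1}. infinite {n \<in> N. y \<in> hit p (\<kappa> n) n}}"

lemma hit_limsup_sets [measurable]: "hit_limsup p \<kappa> N \<in> sets circle_measure"
proof -
  have "hit_limsup p \<kappa> N = {y \<in> space circle_measure. \<forall>K. \<exists>n>K. n \<in> N \<and> y \<in> hit p (\<kappa> n) n}"
    by (simp add: hit_limsup_def infinite_nat_iff_unbounded)
  also have "\<dots> \<in> sets circle_measure" by measurable
  finally show ?thesis .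
qed

lemma exists_congruent_root:
  assumes "coprime p n" "p > 0"
  obtains j where "j < p ^ k" "int (p ^ k) dvd int n * int j - a"
proof -
  have "coprime (int n) (int (p ^ k))" using assms by (simp add: coprime_commute)
  then obtain w where "[int n * w = 1] (mod int (p ^ k))" using cong_solve_coprime_int by blast
  then have w: "int (p ^ k) dvd int n * w - 1" by (simp only: cong_iff_dvd_diff)
  define j where "j = nat ((w * a) mod int (p ^ k))"
  have pos: "int (p ^ k) > 0" using assms(2) by simp
  have j: "int j = (w * a) mod int (p ^ k)" unfolding j_def using pos by simp
  have "int (p ^ k) dvd int j - w * a" unfolding j by (simp add: mod_eq_dvd_iff[symmetric])
  then have "int (p ^ k) dvd int n * (int j - w * a) + (int n * w - 1) * a"
    by (intro dvd_add dvd_mult dvd_mult2 w)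
  also have "int n * (int j - w * a) + (int n * w - 1) * a = int n * int j - a" by (simp add: algebra_simps)
  finally have 1: "int (p ^ k) dvd int n * int j - a" .
  have "int j < int (p ^ k)" unfolding j using pos by (rule pos_mod_bound)
  then have "j < p ^ k" by (simp only: of_nat_less_iff)
  then show thesis using 1 by (rule that)
qed

lemma congruent_root_unique:
  assumes "coprime p n" "int (p ^ k) dvd int n * i - a" "int (p ^ k) dvd int n * j - a"
  shows "int (p ^ k) dvd i - j"
proof -
  have "int (p ^ k) dvd (int n * i - a) - (int n * j - a)" using assms(2,3) by (rule dvd_diff)
  then have "int (p ^ k) dvd int n * (i - j)" by (simp add: algebra_simps)
  moreover have "coprime (int (p ^ k)) (int n)" using assms(1) by simp
  ultimately show ?thesis by (simp only: coprime_dvd_mult_right_iff)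
qed

text \<open>Every ball of the enlarged family contains a ball of the original family of proportion \<open>p\<^sup>-\<^sup>i\<close>,
  which the exceptional set misses from some index on: the exceptional set is thin in the above sense.\<close>

lemma measure_hit_limsup_enlarge_le:
  assumes p: "p \<ge> 2" and N: "\<And>n. n \<in> N \<Longrightarrow> coprime p n"
    and \<kappa>: "\<And>K. finite {n \<in> N. \<kappa> n < K}"
  shows "measure circle_measure (hit_limsup p (\<lambda>n. \<kappa> n - i) N) \<le> measure circle_measure (hit_limsup p \<kappa> N)"
proof -
  interpret finite_measure circle_measure by (rule finite_measure_circle)
  define V where "V = hit_limsup p (\<lambda>n. \<kappa> n - i) N"
  \<comment> \<open>The points of the enlarged limsup set that avoid every original set from index K
    on; their union over K contains all exceptional points.\<close>
  define D where "D = (\<lambda>K. V - (\<Union>n\<in>{n \<in> N. n \<ge> K}. hit p (\<kappa> n) n))"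
  have Dsets: "D K \<in> sets circle_measure" for K unfolding D_def V_def by measurable
  have p0: "p > 0" using p by simp
  have "measure circle_measure (D K) = 0" for K
  proof (rule measure_zero_if_thin_cylinders[OF p Dsets, of "1 / real p ^ i"])
    show "0 < 1 / real p ^ i" "1 / real p ^ i \<le> 1" using p by simp_all
    fix x K'
    assume x: "x \<in> D K"
    then have x1: "x \<in> {0..<1}" by (simp add: D_def V_def hit_limsup_def)
    have "infinite {n \<in> N. x \<in> hit p (\<kappa> n - i) n}" using x by (simp add: D_def V_def hit_limsup_def)
    \<comment> \<open>Discarding finitely many n ensures both a level of at least \<open>K'\<close>
      after enlargement and an index of at least \<open>K\<close>, whose original set
      \<open>D K\<close> avoids.\<close>
    then have "infinite ({n \<in> N. x \<in> hit p (\<kappa> n - i) n} - ({n \<in> N. \<kappa> n < K' + i} \<union> {..<K}))"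
      using \<kappa> by (intro Diff_infinite_finite) auto
    then obtain n where "n \<in> {n \<in> N. x \<in> hit p (\<kappa> n - i) n} - ({n \<in> N. \<kappa> n < K' + i} \<union> {..<K})"
      using infinite_imp_nonempty by blast
    then have n: "n \<in> N" "x \<in> hit p (\<kappa> n - i) n" "K' + i \<le> \<kappa> n" "K \<le> n" by auto
    define l where "l = \<kappa> n - i"
    have kl: "\<kappa> n = l + i" "l \<ge> K'" using n(3) by (auto simp: l_def)
    obtain a where a: "a \<in> signed_totatives n" "int (p ^ l) dvd int n * int (digits p l x) - a"
      using n(2) by (auto simp: hit_def l_def)
    \<comment> \<open>The residue at the finer level for the same numerator a. Its cylinder lies
      inside that of x, since both residues solve the same congruence modulo p^l.\<close>
    obtain j where j: "j < p ^ \<kappa> n" "int (p ^ \<kappa> n) dvd int n * int j - a"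
      using exists_congruent_root[OF N[OF n(1)] p0] by blast
    have "int (p ^ l) dvd int (p ^ \<kappa> n)" by (simp add: kl power_add)
    then have "int (p ^ l) dvd int n * int j - a" using j(2) by (rule dvd_trans)
    then have "int (p ^ l) dvd int j - int (digits p l x)"
      using a(2) by (rule congruent_root_unique[OF N[OF n(1)]])
    then have "int j mod int (p ^ l) = int (digits p l x) mod int (p ^ l)" by (simp only: mod_eq_dvd_iff)
    then have jl: "j mod p ^ l = digits p l x"
      using digits_less[OF x1 p0, of l] by (simp flip: of_nat_mod of_nat_power)
    define S where "S = {y \<in> {0..<1}. digits p (\<kappa> n) y = j}"
    have S1: "S \<subseteq> hit p (\<kappa> n) n" using j a(1) by (auto simp: S_def hit_def)
    have S2: "S \<subseteq> cylinder p l x"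
    proof
      fix y assume "y \<in> S"
      then have "y \<in> {0..<1}" "digits p (\<kappa> n) y = j" by (auto simp: S_def)
      then show "y \<in> cylinder p l x"
        using digits_mod[of y p l "\<kappa> n"] p0 kl jl by (simp add: cylinder_def)
    qed
    have Ssets: "S \<in> sets circle_measure" unfolding S_def by measurable
    have "D K \<inter> cylinder p l x \<subseteq> cylinder p l x - S"
      using S1 n(1,4) by (auto simp: D_def)
    then have "measure circle_measure (D K \<inter> cylinder p l x) \<le> measure circle_measure (cylinder p l x - S)"
      using Ssets by (intro finite_measure_mono) auto
    also have "\<dots> = measure circle_measure (cylinder p l x) - measure circle_measure S"
      using S2 Ssets by (intro finite_measure_Diff) auto
    also have "\<dots> = 1 / real p ^ l - 1 / real p ^ \<kappa> n"
      unfolding S_def measure_cylinder[OF p0 x1] measure_digits_eq[OF p0 j(1)] ..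
    also have "\<dots> = (1 - 1 / real p ^ i) / real p ^ l"
      using p0 by (simp add: kl power_add field_simps)
    finally show "\<exists>l\<ge>K'. measure circle_measure (D K \<inter> cylinder p l x) \<le> (1 - 1 / real p ^ i) / real p ^ l"
      using kl(2) by blast
  qed
  then have "D K \<in> null_sets circle_measure" for K
    using Dsets by (auto simp: null_sets_def emeasure_eq_measure)
  then have null: "(\<Union>K. D K) \<in> null_sets circle_measure" by (rule null_sets_UN)
  have "V \<subseteq> hit_limsup p \<kappa> N \<union> (\<Union>K. D K)"
  proof
    fix x assume x: "x \<in> V"
    show "x \<in> hit_limsup p \<kappa> N \<union> (\<Union>K. D K)"
    proof (cases "x \<in> hit_limsup p \<kappa> N")
      case False
      have "x \<in> {0..<1}" using x by (simp add: V_def hit_limsup_def)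
      with False have "finite {n \<in> N. x \<in> hit p (\<kappa> n) n}" by (simp add: hit_limsup_def)
      then obtain K where "\<forall>n\<in>{n \<in> N. x \<in> hit p (\<kappa> n) n}. n < K"
        using finite_nat_set_iff_bounded by blast
      then have "x \<in> D K" using x by (auto simp: D_def)
      then show ?thesis by blast
    qed simp
  qed
  then have "measure circle_measure V \<le> measure circle_measure (hit_limsup p \<kappa> N \<union> (\<Union>K. D K))"
    using null by (intro finite_measure_mono) auto
  also have "\<dots> = measure circle_measure (hit_limsup p \<kappa> N)"
    using null by (intro measure_Un_null_set) auto
  finally show ?thesis by (simp add: V_def)
qed

text \<open>Around a density point a cylinder of some level K is filled up to a proportion e. The
  K-th power of the shift scales it to the whole circle and carries the limsup set into the one with
  levels lowered by K, which therefore has measure above 1 - e. The level K depends on e, but the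
  enlargement lemma holds for each fixed shift of levels.\<close>

proposition zero_one_hit_limsup:
  assumes p: "p \<ge> 2" and N: "\<And>n. n \<in> N \<Longrightarrow> coprime p n"
    and \<kappa>: "\<And>K. finite {n \<in> N. \<kappa> n < K}"
    and pos: "measure circle_measure (hit_limsup p \<kappa> N) > 0"
  shows "measure circle_measure (hit_limsup p \<kappa> N) = 1"
proof -
  interpret finite_measure circle_measure by (rule finite_measure_circle)
  have p0: "p > 0" using p by simp
  let ?W = "hit_limsup p \<kappa> N"
  have "1 - e \<le> measure circle_measure ?W" if e: "0 < e" "e \<le> 1" for e
  proof -
    \<comment> \<open>A density point: if thin cylinders occurred at arbitrarily fine levels about
      every point, the measure would vanish.\<close>
    obtain x K where x: "x \<in> ?W" and K: "\<And>l. l \<ge> K \<Longrightarrow> measure circle_measure (?W \<inter> cylinder p l x) > (1 - e) / real p ^ l"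
    proof -
      have "\<not> (\<forall>x\<in>?W. \<forall>K. \<exists>l\<ge>K. measure circle_measure (?W \<inter> cylinder p l x) \<le> (1 - e) / real p ^ l)"
        using measure_zero_if_thin_cylinders[OF p hit_limsup_sets[of p \<kappa> N] e] pos by auto
      then show thesis using that by (meson not_le)
    qed 
    have x1: "x \<in> {0..<1}" using x by (simp add: hit_limsup_def)
    let ?V = "hit_limsup p (\<lambda>n. \<kappa> n - K) N"
    have "?W \<inter> cylinder p K x \<subseteq> {y \<in> {0..<1}. digits p K y = digits p K x \<and> (shift p ^^ K) y \<in> ?V}"
    proof
      fix y assume y: "y \<in> ?W \<inter> cylinder p K x"
      then have y1: "y \<in> {0..<1}" "digits p K y = digits p K x" by (auto simp: cylinder_def)
      have "{n \<in> N. y \<in> hit p (\<kappa> n) n} \<subseteq> {n \<in> N. (shift p ^^ K) y \<in> hit p (\<kappa> n - K) n}"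
        using shift_funpow_mem_hit[OF p] N by blast
      moreover have "infinite {n \<in> N. y \<in> hit p (\<kappa> n) n}" using y by (simp add: hit_limsup_def)
      ultimately have "infinite {n \<in> N. (shift p ^^ K) y \<in> hit p (\<kappa> n - K) n}" by (rule infinite_super)
      then have "(shift p ^^ K) y \<in> ?V" using shift_funpow_in_unit[OF y1(1)] by (simp add: hit_limsup_def)
      then show "y \<in> {y \<in> {0..<1}. digits p K y = digits p K x \<and> (shift p ^^ K) y \<in> ?V}" using y1 by simp
    qed
    moreover have "{y \<in> space circle_measure. digits p K y = digits p K x \<and> (shift p ^^ K) y \<in> ?V} \<in> sets circle_measure"
      by measurable
    ultimately have "measure circle_measure (?W \<inter> cylinder p K x) \<le>
        measure circle_measure {y \<in> {0..<1}. digits p K y = digits p K x \<and> (shift p ^^ K) y \<in> ?V}"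
      by (intro finite_measure_mono) auto
    also have "\<dots> = measure circle_measure ?V / real p ^ K"
      using digits_less[OF x1 p0] by (intro measure_digits_branch p0 hit_limsup_sets) 
    finally have "(1 - e) / real p ^ K < measure circle_measure ?V / real p ^ K" using K[of K] by simp
    then have "1 - e < measure circle_measure ?V" using p0 by (simp add: divide_less_cancel)
    also have "\<dots> \<le> measure circle_measure ?W" by (rule measure_hit_limsup_enlarge_le[OF p N \<kappa>])
    finally show ?thesis by simp
  qed
  note * = this
  have "1 \<le> measure circle_measure ?W"
  proof (rule field_le_epsilon)
    fix e :: real assume "e > 0"
    then have "1 - min e 1 \<le> measure circle_measure ?W" by (intro *) auto
    then show "1 \<le> measure circle_measure ?W + e" using min.cobounded1[of e 1] by linarith
  qed
  moreover have "measure circle_measure ?W \<le> measure circle_measure (space circle_measure)"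
    by (rule bounded_measure)
  moreover have "measure circle_measure (space circle_measure) = 1"
    using prob_space_circle by (simp add: measure_def)
  ultimately show ?thesis by simp
qed

section \<open>Positive measure of the limsup set\<close>

text \<open>A Kochen--Stone lemma for weights instead of indicator functions. Counting balls with
  multiplicity avoids lower bounds for the measure of a union of overlapping balls.\<close>

lemma measure_limsup_pos:
  fixes f :: "nat \<Rightarrow> 'a \<Rightarrow> real"
  assumes "finite_measure M" and M1: "measure M (space M) \<le> 1"
    and f[measurable]: "\<And>n. f n \<in> borel_measurable M"
    and f0: "\<And>n x. x \<in> space M \<Longrightarrow> 0 \<le> f n x" and fB: "\<And>n x. x \<in> space M \<Longrightarrow> f n x \<le> B n"
    and C: "C > 0"
    and div: "\<And>Z. \<exists>N. (\<Sum>n<N. integral\<^sup>L M (f n)) \<ge> Z"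
    and var: "\<exists>\<^sub>\<infinity>N. integral\<^sup>L M (\<lambda>x. (\<Sum>n<N. f n x)\<^sup>2) \<le> C * (\<Sum>n<N. integral\<^sup>L M (f n))\<^sup>2"
  shows "measure M {x \<in> space M. infinite {n. f n x \<noteq> 0}} > 0"
proof -
  interpret finite_measure M by fact
  define F where "F = (\<lambda>N x. \<Sum>n<N. f n x)"
  define S where "S = (\<lambda>N. \<Sum>n<N. integral\<^sup>L M (f n))"
  have F[measurable]: "F N \<in> borel_measurable M" for N unfolding F_def by measurable
  have F0: "0 \<le> F N x" if "x \<in> space M" for N x unfolding F_def using f0[OF that] by (intro sum_nonneg) auto
  have FB: "F N x \<le> (\<Sum>n<N. B n)" if "x \<in> space M" for N x unfolding F_def using fB[OF that] by (intro sum_mono) auto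
  have int_f: "integrable M (f n)" for n
    using f0 fB by (intro integrable_const_bound[of _ "B n"]) (auto intro!: AE_I2 simp: abs_le_iff)
  have int_F: "integrable M (F N)" for N unfolding F_def using int_f by (intro Bochner_Integration.integrable_sum)
  have int_F2: "integrable M (\<lambda>x. (F N x)\<^sup>2)" for N
    using F0 FB by (intro integrable_const_bound[of _ "(\<Sum>n<N. B n)\<^sup>2"]) (auto intro!: AE_I2 power_mono)
  have S_eq: "S N = integral\<^sup>L M (F N)" for N
    unfolding S_def F_def using int_f by (intro Bochner_Integration.integral_sum[symmetric]) auto
  have S_mono: "S N \<le> S N'" if "N \<le> N'" for N N'
    unfolding S_def using that f0 by (intro sum_mono2 integral_nonneg_AE AE_I2) auto
  define V where "V = (\<lambda>K::nat. {x \<in> space M. \<exists>N. F N x > real K})"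
  have V[measurable]: "V K \<in> sets M" for K unfolding V_def by measurable
  have lower: "1 / (4 * C) \<le> measure M (V K)" for K
  proof -
    obtain N0 where N0: "S N0 \<ge> 2 * real K + 1" using div[of "2 * real K + 1"] unfolding S_def by blast
    obtain N where N: "N \<ge> N0" "integral\<^sup>L M (\<lambda>x. (F N x)\<^sup>2) \<le> C * (S N)\<^sup>2"
      using var unfolding INFM_nat_le F_def S_def by blast
    have SN: "S N \<ge> 2 * real K + 1" using S_mono[OF N(1)] N0 by simp
    then have S0: "S N > 0" by simp
    define G where "G = {x \<in> space M. F N x > S N / 2}"
    have G[measurable]: "G \<in> sets M" unfolding G_def by measurable
    have int_G: "integrable M (indicator G :: _ \<Rightarrow> real)"
      by (intro integrable_real_indicator) (simp_all add: less_top[symmetric])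
    \<comment> \<open>The inequality F <= (t F^2 + 1/t)/2 replaces Cauchy-Schwarz on
      \<open>G\<close>. This t turns the second moment term into S/4, which together with S/2 from
      outside \<open>G\<close> leaves S/4 <= C S times the measure of \<open>G\<close>.\<close>
    define t where "t = 1 / (2 * C * S N)"
    have t0: "t > 0" using C S0 by (simp add: t_def)
    have "S N = integral\<^sup>L M (F N)" by (rule S_eq)
    also have "\<dots> \<le> integral\<^sup>L M (\<lambda>x. S N / 2 + (t * (F N x)\<^sup>2 + indicator G x / t) / 2)"
    proof (rule integral_mono[OF int_F])
      show "integrable M (\<lambda>x. S N / 2 + (t * (F N x)\<^sup>2 + indicator G x / t) / 2)"
        using int_F2 int_G by (intro Bochner_Integration.integrable_add integrable_divide integrable_mult_right) auto
      fix x assume x: "x \<in> space M"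
      show "F N x \<le> S N / 2 + (t * (F N x)\<^sup>2 + indicator G x / t) / 2"
      proof (cases "x \<in> G")
        case True
        have "0 \<le> (t * F N x - 1)\<^sup>2 / t" using t0 by simp
        also have "\<dots> = t * (F N x)\<^sup>2 + 1 / t - 2 * F N x"
          using t0 by (simp add: power2_eq_square field_simps)
        finally have "F N x \<le> (t * (F N x)\<^sup>2 + 1 / t) / 2" by simp
        then show ?thesis using True S0 by (simp add: add_increasing)
      next
        case False
        then have "F N x \<le> S N / 2" using x by (simp add: G_def)
        then show ?thesis using False t0 by (simp add: add_increasing2)
      qed
    qed
    also have "\<dots> = S N / 2 * measure M (space M) + (t * integral\<^sup>L M (\<lambda>x. (F N x)\<^sup>2) + measure M G / t) / 2"
      using int_F2 int_G by simp
    also have "\<dots> \<le> S N / 2 * 1 + (t * (C * (S N)\<^sup>2) + measure M G / t) / 2"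
      using S0 M1 N(2) t0 by (intro add_mono mult_left_mono divide_right_mono) auto
    also have "t * (C * (S N)\<^sup>2) = S N / 2" using C S0 by (simp add: t_def power2_eq_square field_simps)
    also have "measure M G / t = 2 * C * S N * measure M G" by (simp add: t_def)
    finally have "S N * (1 / 4) \<le> S N * (C * measure M G)" by (simp add: field_simps)
    then have "1 / 4 \<le> C * measure M G" using S0 by (simp add: mult_le_cancel_left)
    then have "1 / (4 * C) \<le> measure M G" using C by (simp add: field_simps)
    also have "\<dots> \<le> measure M (V K)"
    proof (rule finite_measure_mono[OF _ V])
      show "G \<subseteq> V K"
      proof
        fix x assume "x \<in> G"
        then have "x \<in> space M" "F N x > S N / 2" by (auto simp: G_def)
        moreover have "S N / 2 > real K" using SN by simp
        ultimately show "x \<in> V K" by (auto simp: V_def intro!: exI[of _ N])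
      qed
    qed
    finally show ?thesis .
  qed
  have "decseq V" unfolding decseq_def
  proof (intro allI impI subsetI)
    fix K L x assume KL: "K \<le> L" "x \<in> V L"
    then obtain N where N: "x \<in> space M" "F N x > real L" by (auto simp: V_def)
    have "F N x > real K" using N(2) KL(1) by linarith
    then show "x \<in> V K" using N(1) by (auto simp: V_def)
  qed
  then have "(\<lambda>K. measure M (V K)) \<longlonglongrightarrow> measure M (\<Inter>K. V K)"
    using V by (intro finite_Lim_measure_decseq) auto
  then have "1 / (4 * C) \<le> measure M (\<Inter>K. V K)"
    by (rule LIMSEQ_le_const) (use lower in auto)
  also have "\<dots> \<le> measure M {x \<in> space M. infinite {n. f n x \<noteq> 0}}"
  proof (rule finite_measure_mono)
    have "{x \<in> space M. infinite {n. f n x \<noteq> 0}} = {x \<in> space M. \<forall>m. \<exists>n>m. f n x \<noteq> 0}"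
      by (simp add: infinite_nat_iff_unbounded)
    also have "\<dots> \<in> sets M" by measurable
    finally show "{x \<in> space M. infinite {n. f n x \<noteq> 0}} \<in> sets M" .
    show "(\<Inter>K. V K) \<subseteq> {x \<in> space M. infinite {n. f n x \<noteq> 0}}"
    proof
      fix x assume x: "x \<in> (\<Inter>K. V K)"
      then have sp: "x \<in> space M" by (auto simp: V_def)
      \<comment> \<open>Finitely many nonzero terms would bound all partial sums at x.\<close>
      have "infinite {n. f n x \<noteq> 0}"
      proof
        assume fin: "finite {n. f n x \<noteq> 0}"
        obtain K :: nat where K: "(\<Sum>n\<in>{n. f n x \<noteq> 0}. f n x) < real K" using reals_Archimedean2 by blast
        obtain N where N: "F N x > real K" using x by (auto simp: V_def)
        have "F N x = (\<Sum>n\<in>{..<N} \<inter> {n. f n x \<noteq> 0}. f n x)"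
          unfolding F_def by (rule sum.mono_neutral_right) auto
        also have "\<dots> \<le> (\<Sum>n\<in>{n. f n x \<noteq> 0}. f n x)" using fin f0[OF sp] by (intro sum_mono2) auto
        finally show False using N K by simp
      qed
      then show "x \<in> {x \<in> space M. infinite {n. f n x \<noteq> 0}}" using sp by simp
    qed
  qed
  finally show ?thesis using C by (smt (verit) divide_pos_pos)
qed

section \<open>First and second moments of the ball-counting weights\<close>

definition near :: "nat \<Rightarrow> nat \<Rightarrow> nat \<Rightarrow> int \<Rightarrow> real set" where
  "near p k n a = {y \<in> {0..<1}. int (p ^ k) dvd int n * int (digits p k y) - a}"

lemma near_sets [measurable]: "near p k n a \<in> sets circle_measure"
proof -
  have "{y \<in> space circle_measure. int (p ^ k) dvd int n * int (digits p k y) - a} \<in> sets circle_measure"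
    by measurable
  then show ?thesis by (simp add: near_def)
qed

lemma near_Int_space [simp]: "near p k n a \<inter> {0..<1} = near p k n a"
  by (auto simp: near_def)

lemma integrable_indicator_circle: "A \<in> sets circle_measure \<Longrightarrow> integrable circle_measure (indicator A :: _ \<Rightarrow> real)"
  using finite_measure.emeasure_finite[OF finite_measure_circle]
  by (intro integrable_real_indicator) (simp_all add: less_top)

lemma measure_near:
  assumes "p > 0" "coprime p n"
  shows "measure circle_measure (near p k n a) = 1 / real p ^ k"
proof -
  obtain j where j: "j < p ^ k" "int (p ^ k) dvd int n * int j - a"
    using exists_congruent_root[OF assms(2,1)] by blast
  have "near p k n a = {y \<in> {0..<1}. digits p k y = j}"
    unfolding near_def
  proof (rule Collect_cong, rule conj_cong[OF refl], rule iffI)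
    fix y :: real assume y: "y \<in> {0..<1}"
    show "int (p ^ k) dvd int n * int (digits p k y) - a" if "digits p k y = j" using j(2) that by simp
    assume "int (p ^ k) dvd int n * int (digits p k y) - a"
    then have "int (p ^ k) dvd int (digits p k y) - int j" using j(2) by (rule congruent_root_unique[OF assms(2)])
    then have "int (digits p k y) mod int (p ^ k) = int j mod int (p ^ k)" by (simp only: mod_eq_dvd_iff)
    then have "digits p k y mod p ^ k = j mod p ^ k" by (simp flip: of_nat_mod of_nat_power)
    then show "digits p k y = j" using j(1) digits_less[OF y assms(1), of k] by simp
  qed
  then show ?thesis using measure_digits_eq[OF assms(1) j(1)] by simp
qed

definition multiplicity_fun :: "nat \<Rightarrow> (nat \<Rightarrow> nat) \<Rightarrow> nat set \<Rightarrow> nat \<Rightarrow> real \<Rightarrow> real" where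
  "multiplicity_fun p \<kappa> N n y = (if n \<in> N then \<Sum>a\<in>signed_totatives n. indicator (near p (\<kappa> n) n a) y else 0)"

lemma multiplicity_fun_measurable [measurable]: "multiplicity_fun p \<kappa> N n \<in> borel_measurable circle_measure"
  unfolding multiplicity_fun_def by measurable

lemma multiplicity_fun_bounds:
  "0 \<le> multiplicity_fun p \<kappa> N n y" "multiplicity_fun p \<kappa> N n y \<le> real (card (signed_totatives n))"
proof -
  show "0 \<le> multiplicity_fun p \<kappa> N n y" by (auto simp: multiplicity_fun_def intro!: sum_nonneg)
  have "(\<Sum>a\<in>signed_totatives n. indicator (near p (\<kappa> n) n a) y) \<le> (\<Sum>a\<in>signed_totatives n. 1 :: real)"
    by (intro sum_mono) (simp add: indicator_le_1)
  then show "multiplicity_fun p \<kappa> N n y \<le> real (card (signed_totatives n))" by (simp add: multiplicity_fun_def)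
qed

lemma multiplicity_fun_nonzero:
  assumes "multiplicity_fun p \<kappa> N n y \<noteq> 0"
  shows "n \<in> N \<and> y \<in> hit p (\<kappa> n) n"
proof -
  have n: "n \<in> N" using assms by (auto simp: multiplicity_fun_def split: if_splits)
  then have "(\<Sum>a\<in>signed_totatives n. indicator (near p (\<kappa> n) n a) y) \<noteq> (0::real)"
    using assms by (simp add: multiplicity_fun_def)
  then obtain a where "a \<in> signed_totatives n" "indicator (near p (\<kappa> n) n a) y \<noteq> (0::real)"
    by (meson sum.neutral)
  then show ?thesis using n by (auto simp: hit_def near_def indicator_def split: if_splits)
qed

lemma integral_multiplicity_fun:
  assumes "p > 0" "n \<in> N" "coprime p n"
  shows "integral\<^sup>L circle_measure (multiplicity_fun p \<kappa> N n) = real (card (signed_totatives n)) / real p ^ \<kappa> n"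
proof -
  interpret finite_measure circle_measure by (rule finite_measure_circle)
  have eq: "multiplicity_fun p \<kappa> N n = (\<lambda>y. \<Sum>a\<in>signed_totatives n. indicator (near p (\<kappa> n) n a) y)"
    using assms(2) by (simp add: multiplicity_fun_def fun_eq_iff)
  have "integral\<^sup>L circle_measure (multiplicity_fun p \<kappa> N n) = (\<Sum>a\<in>signed_totatives n. measure circle_measure (near p (\<kappa> n) n a))"
    unfolding eq by (subst Bochner_Integration.integral_sum) (auto intro: integrable_indicator_circle)
  also have "\<dots> = real (card (signed_totatives n)) / real p ^ \<kappa> n"
    using measure_near[OF assms(1,3)] by simp
  finally show ?thesis .
qed

text \<open>Two balls meet only if their centres are within the larger radius
  p^(-\<open>\<kappa> m\<close>), which is the divisibility in \<open>close_pairs\<close>; the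
  intersection then has at most the measure of the smaller ball.\<close>

lemma integral_multiplicity_fun_mult:
  assumes "p > 0" "m \<in> N" "n \<in> N" "coprime p m" "coprime p n" "\<kappa> m \<le> \<kappa> n"
  shows "integral\<^sup>L circle_measure (\<lambda>y. multiplicity_fun p \<kappa> N m y * multiplicity_fun p \<kappa> N n y) \<le>
    real (card (close_pairs (p ^ \<kappa> m) m n)) / real p ^ \<kappa> n"
proof -
  interpret finite_measure circle_measure by (rule finite_measure_circle)
  let ?P = "signed_totatives m \<times> signed_totatives n"
  let ?I = "\<lambda>a b. near p (\<kappa> m) m a \<inter> near p (\<kappa> n) n b"
  have eq: "(\<lambda>y. multiplicity_fun p \<kappa> N m y * multiplicity_fun p \<kappa> N n y) =
      (\<lambda>y. \<Sum>(a, b)\<in>?P. indicator (?I a b) y)"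
    using assms(2,3) by (intro ext) (simp only: multiplicity_fun_def if_True sum_product sum.cartesian_product indicator_inter_arith)
  have "integral\<^sup>L circle_measure (\<lambda>y. multiplicity_fun p \<kappa> N m y * multiplicity_fun p \<kappa> N n y) =
      (\<Sum>(a, b)\<in>?P. measure circle_measure (?I a b))"
    unfolding eq
  proof (subst Bochner_Integration.integral_sum)
    show "(\<Sum>i\<in>?P. integral\<^sup>L circle_measure (\<lambda>x. case i of (a, b) \<Rightarrow> indicator (?I a b) x)) = (\<Sum>(a, b)\<in>?P. measure circle_measure (?I a b))"
    proof (rule sum.cong[OF refl])
      fix i assume "i \<in> ?P"
      obtain a b where i: "i = (a, b)" by fastforce
      have "?I a b \<inter> space circle_measure = ?I a b" by (auto simp: near_def)
      then show "integral\<^sup>L circle_measure (\<lambda>x. case i of (a, b) \<Rightarrow> indicator (?I a b) x) = (case i of (a, b) \<Rightarrow> measure circle_measure (?I a b))"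
        by (simp add: i)
    qed
    fix i assume "i \<in> ?P"
    show "integrable circle_measure (\<lambda>x. case i of (a, b) \<Rightarrow> indicat_real (?I a b) x)"
      by (cases i) (auto intro!: integrable_indicator_circle)
  qed
  also have "\<dots> \<le> (\<Sum>(a, b)\<in>?P. if (a, b) \<in> close_pairs (p ^ \<kappa> m) m n then 1 / real p ^ \<kappa> n else 0)"
  proof (rule sum_mono)
    fix i assume "i \<in> ?P"
    then obtain a b where i: "i = (a, b)" "a \<in> signed_totatives m" "b \<in> signed_totatives n" by blast
    have "measure circle_measure (?I a b) \<le> measure circle_measure (near p (\<kappa> n) n b)"
      by (intro finite_measure_mono) auto
    then have le: "measure circle_measure (?I a b) \<le> 1 / real p ^ \<kappa> n" using measure_near[OF assms(1,5)] by simp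
    have "(a, b) \<in> close_pairs (p ^ \<kappa> m) m n" if ne: "?I a b \<noteq> {}"
    proof -
      obtain y where y: "y \<in> {0..<1}" "int (p ^ \<kappa> m) dvd int m * int (digits p (\<kappa> m) y) - a"
          "int (p ^ \<kappa> n) dvd int n * int (digits p (\<kappa> n) y) - b"
        using ne by (auto simp: near_def)
      define r s where "r = int (digits p (\<kappa> m) y)" and "s = int (digits p (\<kappa> n) y)"
      have "digits p (\<kappa> n) y mod p ^ \<kappa> m = digits p (\<kappa> m) y" by (rule digits_mod[OF y(1) assms(1,6)])
      then have "s mod int (p ^ \<kappa> m) = r" unfolding r_def s_def by (simp flip: of_nat_mod of_nat_power)
      then have rs: "int (p ^ \<kappa> m) dvd s - r" by (metis dvd_minus_mod)
      have "int (p ^ \<kappa> m) dvd int (p ^ \<kappa> n)" using assms(6) by (simp add: le_imp_power_dvd)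
      then have ns: "int (p ^ \<kappa> m) dvd int n * s - b" unfolding s_def using y(3) by (rule dvd_trans)
      have mr: "int (p ^ \<kappa> m) dvd int m * r - a" using y(2) by (simp add: r_def)
      have "int (p ^ \<kappa> m) dvd (int n * s - b) * int m - (int m * r - a) * int n - (s - r) * (int m * int n)"
        by (intro dvd_diff dvd_mult2 ns mr rs)
      also have "(int n * s - b) * int m - (int m * r - a) * int n - (s - r) * (int m * int n) = a * int n - b * int m"
        by (simp add: algebra_simps)
      finally show ?thesis using i by (simp add: close_pairs_def)
    qed
    then show "(case i of (a, b) \<Rightarrow> measure circle_measure (?I a b)) \<le>
        (case i of (a, b) \<Rightarrow> if (a, b) \<in> close_pairs (p ^ \<kappa> m) m n then 1 / real p ^ \<kappa> n else 0)"
      using le by (cases "?I a b = {}") (auto simp: i)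
  qed
  also have "\<dots> = (\<Sum>i\<in>?P \<inter> close_pairs (p ^ \<kappa> m) m n. 1 / real p ^ \<kappa> n)"
    by (subst sum.inter_restrict) (auto intro!: sum.cong)
  also have "?P \<inter> close_pairs (p ^ \<kappa> m) m n = close_pairs (p ^ \<kappa> m) m n" by (auto simp: close_pairs_def)
  finally show ?thesis by simp
qed

text \<open>The common frame of both ranges of radii: each range supplies a symmetric bound
  \<open>b\<close> for the correlations. The premise \<open>var\<close> is stated for every w above
  phi(n)/p^(\<open>\<kappa> n\<close>), so that neither range has to know the exact number of signed
  numerators.\<close>

lemma hit_limsup_pos_if_variance:
  assumes p: "p > 0" and N: "\<And>n. n \<in> N \<Longrightarrow> n > 0 \<and> coprime p n"
    and ns: "\<not> summable (\<lambda>n. if n \<in> N then real (totient n) / real p ^ \<kappa> n else 0)"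
    and bound: "\<And>m n. m \<in> N \<Longrightarrow> n \<in> N \<Longrightarrow> \<kappa> m \<le> \<kappa> n \<Longrightarrow>
      real (card (close_pairs (p ^ \<kappa> m) m n)) / real p ^ \<kappa> n \<le> b m n"
    and b: "\<And>m n. b m n = b n m" "\<And>m n. 0 \<le> b m n"
    and C: "C > 0"
    and var: "\<And>w. (\<And>n. n \<in> N \<Longrightarrow> real (totient n) / real p ^ \<kappa> n \<le> w n) \<Longrightarrow> (\<And>n. 0 \<le> w n) \<Longrightarrow> 
      (\<And>Z. \<exists>K. (\<Sum>n<K. w n) \<ge> Z) \<Longrightarrow>
      \<exists>\<^sub>\<infinity>K. (\<Sum>m<K. \<Sum>n<K. b m n) \<le> C * (\<Sum>n<K. w n)\<^sup>2"
  shows "measure circle_measure (hit_limsup p \<kappa> N) > 0"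
proof -
  interpret finite_measure circle_measure by (rule finite_measure_circle)
  define f where "f = multiplicity_fun p \<kappa> N"
  define w where "w = (\<lambda>n. integral\<^sup>L circle_measure (f n))"
  have f_meas [measurable]: "f n \<in> borel_measurable circle_measure" for n by (simp add: f_def)
  have w0: "0 \<le> w n" for n
    unfolding w_def f_def using multiplicity_fun_bounds by (intro integral_nonneg_AE AE_I2)
  have w_ge: "real (totient n) / real p ^ \<kappa> n \<le> w n" if "n \<in> N" for n
    unfolding w_def f_def using integral_multiplicity_fun[OF p that] N[OF that] card_signed_totatives_ge[of n]
    by (simp add: divide_right_mono)
  have div: "\<exists>K. (\<Sum>n<K. w n) \<ge> Z" for Z
  proof (rule ccontr)
    assume "\<not> (\<exists>K. (\<Sum>n<K. w n) \<ge> Z)"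
    then have le: "(\<Sum>n<K. w n) \<le> Z" for K by (auto simp: not_le intro: less_imp_le)
    have "summable w" by (rule summableI_nonneg_bounded[OF w0 le])
    then have "summable (\<lambda>n. if n \<in> N then real (totient n) / real p ^ \<kappa> n else 0)"
      by (rule summable_comparison_test'[of _ 0]) (use w0 w_ge in auto)
    then show False using ns by simp
  qed
  have mixed: "integral\<^sup>L circle_measure (\<lambda>y. f m y * f n y) \<le> b m n" for m n
  proof (cases "m \<in> N \<and> n \<in> N")
    case True
    show ?thesis
    proof (cases "\<kappa> m \<le> \<kappa> n")
      case le: True
      show ?thesis
        unfolding f_def
        by (rule order_trans[OF integral_multiplicity_fun_mult[where m=m and n=n and N=N and \<kappa>=\<kappa>, OF p _ _ _ _ le] bound[OF _ _ le]]) (use True N in auto)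
    next
      case False
      then have le: "\<kappa> n \<le> \<kappa> m" by simp
      have "integral\<^sup>L circle_measure (\<lambda>y. f n y * f m y) \<le> b n m"
        unfolding f_def
        by (rule order_trans[OF integral_multiplicity_fun_mult[where m=n and n=m and N=N and \<kappa>=\<kappa>, OF p _ _ _ _ le] bound[OF _ _ le]]) (use True N in auto)
      then show ?thesis by (simp add: mult.commute b(1)[of m n])
    qed
  next
    case False
    then have "(\<lambda>y. f m y * f n y) = (\<lambda>_. 0)" by (auto simp: f_def multiplicity_fun_def)
    then show ?thesis using b(2) by simp
  qed
  have "measure circle_measure {x \<in> space circle_measure. infinite {n. f n x \<noteq> 0}} > 0"
  proof (rule measure_limsup_pos[OF finite_measure_circle _ f_meas _ _ C])
    show "measure circle_measure (space circle_measure) \<le> 1" using prob_space_circle by (simp add: measure_def)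
    show "0 \<le> f n x" "f n x \<le> real (card (signed_totatives n))" for n x
      unfolding f_def by (rule multiplicity_fun_bounds)+
    show "\<exists>K. (\<Sum>n<K. integral\<^sup>L circle_measure (f n)) \<ge> Z" for Z using div[of Z] by (simp add: w_def)
    have int: "integrable circle_measure (\<lambda>y. f m y * f n y)" for m n
      using multiplicity_fun_bounds unfolding f_def
      by (intro integrable_const_bound[of _ "real (card (signed_totatives m)) * real (card (signed_totatives n))"])
         (auto intro!: AE_I2 mult_mono simp: abs_mult)
    have "integral\<^sup>L circle_measure (\<lambda>x. (\<Sum>n<K. f n x)\<^sup>2) \<le> (\<Sum>m<K. \<Sum>n<K. b m n)" for K
    proof -
      have "integral\<^sup>L circle_measure (\<lambda>x. (\<Sum>n<K. f n x)\<^sup>2) = (\<Sum>m<K. \<Sum>n<K. integral\<^sup>L circle_measure (\<lambda>y. f m y * f n y))"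
        unfolding power2_eq_square sum_product
        by (subst Bochner_Integration.integral_sum, intro Bochner_Integration.integrable_sum int)
           (intro sum.cong refl Bochner_Integration.integral_sum int)
      also have "\<dots> \<le> (\<Sum>m<K. \<Sum>n<K. b m n)" by (intro sum_mono mixed)
      finally show ?thesis .
    qed
    note le = this
    have inf: "\<exists>\<^sub>\<infinity>K. (\<Sum>m<K. \<Sum>n<K. b m n) \<le> C * (\<Sum>n<K. w n)\<^sup>2"
      by (rule var[OF w_ge w0 div])
    show "\<exists>\<^sub>\<infinity>K. integral\<^sup>L circle_measure (\<lambda>x. (\<Sum>n<K. f n x)\<^sup>2) \<le> C * (\<Sum>n<K. integral\<^sup>L circle_measure (f n))\<^sup>2"
      using INFM_mono[OF inf order_trans[OF le]] by (simp only: w_def)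
  qed
  also have "\<dots> \<le> measure circle_measure (hit_limsup p \<kappa> N)"
  proof (rule finite_measure_mono[OF _ hit_limsup_sets])
    show "{x \<in> space circle_measure. infinite {n. f n x \<noteq> 0}} \<subseteq> hit_limsup p \<kappa> N"
    proof
      fix x assume x: "x \<in> {x \<in> space circle_measure. infinite {n. f n x \<noteq> 0}}"
      have "{n. f n x \<noteq> 0} \<subseteq> {n \<in> N. x \<in> hit p (\<kappa> n) n}"
        using multiplicity_fun_nonzero unfolding f_def by blast
      moreover have "infinite {n. f n x \<noteq> 0}" using x by simp
      ultimately have "infinite {n \<in> N. x \<in> hit p (\<kappa> n) n}" by (rule infinite_super)
      then show "x \<in> hit_limsup p \<kappa> N" using x by (simp add: hit_limsup_def)
    qed
  qed
  finally show ?thesis .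
qed

text \<open>For \<open>\<kappa> m \<le> \<kappa> n\<close> the inverse radius of m is at most 2m and
  at most 2n, as the sieve bound requires. That bound is a product of first moments plus a diagonal
  term.\<close>

lemma hit_limsup_pos_overlapping:
  assumes p: "p > 0" and N: "\<And>n. n \<in> N \<Longrightarrow> n > 0 \<and> coprime p n"
    and ns: "\<not> summable (\<lambda>n. if n \<in> N then real (totient n) / real p ^ \<kappa> n else 0)"
    and small: "\<And>n. n \<in> N \<Longrightarrow> p ^ \<kappa> n \<le> 2 * n"
  shows "measure circle_measure (hit_limsup p \<kappa> N) > 0"
proof -
  define C :: real where "C = 40 * exp 6"
  have C: "C > 0" by (simp add: C_def)
  define w0 where "w0 = (\<lambda>n. if n \<in> N then real (totient n) / real p ^ \<kappa> n else 0)"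
  have w00: "0 \<le> w0 n" for n by (simp add: w0_def)
  define b where "b = (\<lambda>m n. C * (w0 m * w0 n) + (if m = n then 3 * w0 n else 0))"
  show ?thesis
  proof (rule hit_limsup_pos_if_variance[OF p N ns, where b = b and C = "C + 3"])
    fix m n assume mn: "m \<in> N" "n \<in> N" "\<kappa> m \<le> \<kappa> n"
    have "p ^ \<kappa> m \<le> p ^ \<kappa> n" using mn(3) p by (intro power_increasing) auto
    then have "p ^ \<kappa> m \<le> 2 * n" using small[OF mn(2)] by simp
    then have "real (card (close_pairs (p ^ \<kappa> m) m n)) \<le>
        C * (real (totient m) * real (totient n) / real (p ^ \<kappa> m)) + (if m = n then 3 * real (totient n) else 0)"
      unfolding C_def using N[OF mn(1)] N[OF mn(2)] p small[OF mn(1)]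
      by (intro card_close_pairs_le) auto
    then have "real (card (close_pairs (p ^ \<kappa> m) m n)) / real p ^ \<kappa> n \<le>
        (C * (real (totient m) * real (totient n) / real (p ^ \<kappa> m)) + (if m = n then 3 * real (totient n) else 0)) / real p ^ \<kappa> n"
      by (intro divide_right_mono) auto
    also have "\<dots> = b m n" using mn by (simp add: b_def w0_def add_divide_distrib)
    finally show "real (card (close_pairs (p ^ \<kappa> m) m n)) / real p ^ \<kappa> n \<le> b m n" .
  next
    fix m n show "b m n = b n m" by (simp add: b_def)
    show "0 \<le> b m n" using C w00 by (simp add: b_def)
  next
    fix w :: "nat \<Rightarrow> real"
    assume ge: "\<And>n. n \<in> N \<Longrightarrow> real (totient n) / real p ^ \<kappa> n \<le> w n" and w0: "\<And>n. 0 \<le> w n"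
      and div: "\<And>Z. \<exists>K. (\<Sum>n<K. w n) \<ge> Z"
    \<comment> \<open>Once the sum of first moments is at least 1, its square absorbs the diagonal
      term, which is linear in it.\<close>
    obtain K0 where K0: "(\<Sum>n<K0. w n) \<ge> 1" using div by blast
    have le: "w0 n \<le> w n" for n using ge w0 by (simp add: w0_def)
    have "(\<Sum>m<K. \<Sum>n<K. b m n) \<le> (C + 3) * (\<Sum>n<K. w n)\<^sup>2" if K: "K \<ge> K0" for K
    proof -
      have S1: "1 \<le> (\<Sum>n<K. w n)"
        using K0 sum_mono2[of "{..<K}" "{..<K0}" w] K w0 by (auto simp: subset_iff)
      have S0: "0 \<le> (\<Sum>n<K. w0 n)" "(\<Sum>n<K. w0 n) \<le> (\<Sum>n<K. w n)"
        using w00 le by (auto intro: sum_nonneg sum_mono)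
      have "(\<Sum>m<K. \<Sum>n<K. b m n) = C * (\<Sum>n<K. w0 n)\<^sup>2 + 3 * (\<Sum>n<K. w0 n)"
        by (simp add: b_def sum.distrib sum_distrib_left[symmetric] sum_product power2_eq_square)
      also have "\<dots> \<le> C * (\<Sum>n<K. w n)\<^sup>2 + 3 * (\<Sum>n<K. w n)"
        using S0 C by (intro add_mono mult_left_mono power_mono) auto
      also have "3 * (\<Sum>n<K. w n) \<le> 3 * (\<Sum>n<K. w n)\<^sup>2"
        using S1 self_le_power[of "\<Sum>n<K. w n" 2] by simp
      finally show ?thesis by (simp add: algebra_simps)
    qed
    then show "\<exists>\<^sub>\<infinity>K. (\<Sum>m<K. \<Sum>n<K. b m n) \<le> (C + 3) * (\<Sum>n<K. w n)\<^sup>2"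
      unfolding INFM_nat_le by (meson max.cobounded1 max.cobounded2)
  qed (use C in auto)
qed

lemma QIA_imp_frequently:
  assumes QIA: "QIA_infty" and \<psi>: "\<And>n. \<psi> n \<ge> 0"
    and ns: "\<not> summable (\<lambda>n. measure circle_measure (approx_set \<psi> n))"
  obtains c where "c > 0" "\<exists>\<^sub>\<infinity>K. c * (\<Sum>m<K. \<Sum>n<K. measure circle_measure (approx_set \<psi> m \<inter> approx_set \<psi> n)) \<le>
    (\<Sum>n<K. measure circle_measure (approx_set \<psi> n))\<^sup>2"
proof -
  interpret finite_measure circle_measure by (rule finite_measure_circle)
  define l where "l = (\<lambda>n. measure circle_measure (approx_set \<psi> n))"
  define k where "k = (\<lambda>m n. measure circle_measure (approx_set \<psi> m \<inter> approx_set \<psi> n))"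
  have A0: "approx_set \<psi> 0 = {}" by (simp add: approx_set_def)
  have ns': "\<not> summable (\<lambda>n. l (Suc n))" using ns unfolding l_def by (subst summable_Suc_iff)
  have "(\<Sum>n. emeasure circle_measure (approx_set \<psi> (Suc n))) = \<infinity>"
  proof (rule ccontr)
    assume "(\<Sum>n. emeasure circle_measure (approx_set \<psi> (Suc n))) \<noteq> \<infinity>"
    then have "(\<Sum>n. ennreal (l (Suc n))) \<noteq> \<infinity>" by (simp add: l_def emeasure_eq_measure)
    then have "summable (\<lambda>n. l (Suc n))" by (intro summable_suminf_not_top) (auto simp: l_def infinity_ennreal_def)
    then show False using ns' by simp
  qed
  then have lim: "limsup (\<lambda>N. ereal ((\<Sum>n=1..N. l n)\<^sup>2 * inverse (\<Sum>m=1..N. \<Sum>n=1..N. k m n))) > 0" (is "limsup ?u > 0")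
    using QIA \<psi> unfolding QIA_infty_def l_def k_def by blast
  obtain c where c: "0 < ereal c" "ereal c < limsup ?u" using ereal_dense2[OF lim] by blast
  have fr: "\<exists>\<^sub>\<infinity>N. ?u N > ereal c"
  proof (rule ccontr)
    assume "\<not> (\<exists>\<^sub>\<infinity>N. ?u N > ereal c)"
    then have "eventually (\<lambda>N. ?u N \<le> ereal c) sequentially"
      by (simp add: frequently_cofinite[symmetric] cofinite_eq_sequentially not_frequently not_less)
    then have "limsup ?u \<le> ereal c" by (rule Limsup_bounded)
    then show False using c(2) by simp
  qed
  \<comment> \<open>The hypothesis sums over 1 to N, the second moment lemma over n < K. The index 0
    contributes nothing because there is no a with 1 <= a <= 0.\<close>
  have shift: "(\<Sum>n<Suc N. g n) = (\<Sum>n=1..N. g n)" if "g 0 = 0" for g :: "nat \<Rightarrow> real" and N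
  proof -
    have "{..<Suc N} = insert 0 {1..N}" by auto
    then show ?thesis using that by simp
  qed
  have "c * (\<Sum>m<Suc N. \<Sum>n<Suc N. k m n) \<le> (\<Sum>n<Suc N. l n)\<^sup>2" if u: "?u N > ereal c" for N
  proof -
    let ?Y = "\<Sum>m=1..N. \<Sum>n=1..N. k m n"
    have Y0: "0 \<le> ?Y" by (auto simp: k_def intro!: sum_nonneg)
    have lt: "c < (\<Sum>n=1..N. l n)\<^sup>2 * inverse ?Y" using u by simp
    \<comment> \<open>With \<open>inverse 0 = 0\<close> a vanishing denominator would make the
      quotient 0, below c.\<close>
    then have "?Y \<noteq> 0" using c(1) by (intro notI) simp
    then have "c * ?Y \<le> (\<Sum>n=1..N. l n)\<^sup>2" using lt Y0 by (simp add: field_simps)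
    moreover have "(\<Sum>n<Suc N. l n) = (\<Sum>n=1..N. l n)" by (rule shift) (simp add: l_def A0)
    moreover have "(\<Sum>m<Suc N. \<Sum>n<Suc N. k m n) = (\<Sum>m=1..N. \<Sum>n<Suc N. k m n)" by (rule shift) (simp add: k_def A0)
    moreover have "(\<Sum>n<Suc N. k m n) = (\<Sum>n=1..N. k m n)" for m by (rule shift) (simp add: k_def A0)
    ultimately show ?thesis by simp
  qed
  note imp = this
  have "\<exists>\<^sub>\<infinity>K. c * (\<Sum>m<K. \<Sum>n<K. k m n) \<le> (\<Sum>n<K. l n)\<^sup>2"
    unfolding INFM_nat_le
  proof
    fix M
    obtain N where "N \<ge> M" "?u N > ereal c" using fr unfolding INFM_nat_le by blast
    then show "\<exists>K\<ge>M. c * (\<Sum>m<K. \<Sum>n<K. k m n) \<le> (\<Sum>n<K. l n)\<^sup>2" using imp[of N] by (intro exI[of _ "Suc N"]) simp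
  qed
  then show thesis using that[of c] c(1) unfolding k_def l_def by simp
qed

text \<open>The hypothesis is applied to radii 3/J_n on \<open>N\<close> and 0 elsewhere, where the
  approximation sets are null. Their measures lie between phi(n)/J_n and 30 phi(n)/J_n. In the final
  constant, 18 comes from the comparison of pairs with measures, 900 is 30 squared and c comes from
  the hypothesis.\<close>

lemma hit_limsup_pos_disjoint:
  assumes QIA: "QIA_infty" and p: "p > 0" and N: "\<And>n. n \<in> N \<Longrightarrow> n > 0 \<and> coprime p n"
    and ns: "\<not> summable (\<lambda>n. if n \<in> N then real (totient n) / real p ^ \<kappa> n else 0)"
    and large: "\<And>n. n \<in> N \<Longrightarrow> 2 * n < p ^ \<kappa> n"
  shows "measure circle_measure (hit_limsup p \<kappa> N) > 0"
proof -
  define \<psi> where "\<psi> = (\<lambda>n. if n \<in> N then 3 / real (p ^ \<kappa> n) else 0)"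
  define l where "l = (\<lambda>n. measure circle_measure (approx_set \<psi> n))"
  define k where "k = (\<lambda>m n. measure circle_measure (approx_set \<psi> m \<inter> approx_set \<psi> n))"
  have l_ge: "real (totient n) / real p ^ \<kappa> n \<le> l n" if "n \<in> N" for n
    using measure_approx_set_ge[of n \<psi> "p ^ \<kappa> n"] that N[OF that] large[OF that]
    by (simp add: l_def \<psi>_def)
  have l_le: "l n \<le> (if n \<in> N then 30 * (real (totient n) / real p ^ \<kappa> n) else 0)" for n
  proof (cases "n = 0")
    case True
    then show ?thesis using N by (auto simp: l_def approx_set_def)
  next
    case False
    have "\<psi> n \<le> 3 / 2"
    proof (cases "n \<in> N")
      case True
      then have "2 \<le> p ^ \<kappa> n" using large[OF True] False by linarith
      then have "2 \<le> real (p ^ \<kappa> n)" by linarith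
      then have "3 / real (p ^ \<kappa> n) \<le> 3 / 2" using p by (intro divide_left_mono) auto
      then show ?thesis using True by (simp add: \<psi>_def)
    qed (simp add: \<psi>_def)
    then have "l n \<le> 10 * real (totient n) * \<psi> n" unfolding l_def using False
      by (intro measure_approx_set_le) (auto simp: \<psi>_def)
    then show ?thesis by (cases "n \<in> N") (simp_all add: \<psi>_def)
  qed
  have "\<not> summable l"
  proof
    assume "summable l"
    then have "summable (\<lambda>n. if n \<in> N then real (totient n) / real p ^ \<kappa> n else 0)"
      by (rule summable_comparison_test'[of _ 0]) (use l_ge in \<open>auto simp: l_def\<close>)
    then show False using ns by simp
  qed
  then have nl: "\<not> summable (\<lambda>n. measure circle_measure (approx_set \<psi> n))" by (simp add: l_def)
  have \<psi>0: "0 \<le> \<psi> n" for n by (simp add: \<psi>_def)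
  obtain c where c: "c > 0" "\<exists>\<^sub>\<infinity>K. c * (\<Sum>m<K. \<Sum>n<K. k m n) \<le> (\<Sum>n<K. l n)\<^sup>2"
    using QIA_imp_frequently[OF QIA \<psi>0 nl] unfolding l_def k_def by blast
  show ?thesis
  proof (rule hit_limsup_pos_if_variance[OF p N ns, where b = "\<lambda>m n. 18 * k m n" and C = "18 * 900 / c"])
    fix m n assume mn: "m \<in> N" "n \<in> N" "\<kappa> m \<le> \<kappa> n"
    have "p ^ \<kappa> m \<le> p ^ \<kappa> n" using mn(3) p by (intro power_increasing) auto
    then have "real (card (close_pairs (p ^ \<kappa> m) m n)) / real (p ^ \<kappa> n) \<le> 18 * k m n"
      unfolding k_def using N[OF mn(1)] N[OF mn(2)] large[OF mn(1)] large[OF mn(2)] mn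
      by (intro card_close_pairs_le_measure) (auto simp: \<psi>_def)
    then show "real (card (close_pairs (p ^ \<kappa> m) m n)) / real p ^ \<kappa> n \<le> 18 * k m n" by simp
  next
    fix m n show "18 * k m n = 18 * k n m" by (simp add: k_def Int_commute)
    show "0 \<le> 18 * k m n" by (simp add: k_def)
  next
    fix w :: "nat \<Rightarrow> real"
    assume ge: "\<And>n. n \<in> N \<Longrightarrow> real (totient n) / real p ^ \<kappa> n \<le> w n" and w0: "\<And>n. 0 \<le> w n"
    have lw: "l n \<le> 30 * w n" for n using l_le[of n] ge[of n] w0[of n] by (cases "n \<in> N") auto
    have "(\<Sum>m<K. \<Sum>n<K. 18 * k m n) \<le> 18 * 900 / c * (\<Sum>n<K. w n)\<^sup>2"
      if K: "c * (\<Sum>m<K. \<Sum>n<K. k m n) \<le> (\<Sum>n<K. l n)\<^sup>2" for K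
    proof -
      have "(\<Sum>n<K. l n) \<le> (\<Sum>n<K. 30 * w n)" by (intro sum_mono lw)
      then have "(\<Sum>n<K. l n)\<^sup>2 \<le> (30 * (\<Sum>n<K. w n))\<^sup>2"
        by (intro power_mono) (auto simp: sum_distrib_left l_def intro!: sum_nonneg)
      then have "c * (\<Sum>m<K. \<Sum>n<K. k m n) \<le> 900 * (\<Sum>n<K. w n)\<^sup>2" using K by (simp add: power_mult_distrib)
      then have "(\<Sum>m<K. \<Sum>n<K. k m n) \<le> 900 * (\<Sum>n<K. w n)\<^sup>2 / c"
        using c(1) by (simp add: pos_le_divide_eq mult.commute)
      then show ?thesis by (simp add: sum_distrib_left[symmetric])
    qed
    then show "\<exists>\<^sub>\<infinity>K. (\<Sum>m<K. \<Sum>n<K. 18 * k m n) \<le> 18 * 900 / c * (\<Sum>n<K. w n)\<^sup>2"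
      by (rule INFM_mono[OF c(2)])
  qed (use c in auto)
qed

text \<open>One of the two partial series diverges. Positive measure for that part of
  \<open>N\<close> is enough, since the zero-one law is applied to \<open>N\<close> as a
  whole.\<close>

proposition hit_limsup_full:
  assumes QIA: "QIA_infty" and p: "p \<ge> 2" and N: "\<And>n. n \<in> N \<Longrightarrow> n > 0 \<and> coprime p n"
    and ns: "\<not> summable (\<lambda>n. if n \<in> N then real (totient n) / real p ^ \<kappa> n else 0)"
    and \<kappa>: "\<And>K. finite {n \<in> N. \<kappa> n < K}"
  shows "measure circle_measure (hit_limsup p \<kappa> N) = 1"
proof -
  interpret finite_measure circle_measure by (rule finite_measure_circle)
  define N1 where "N1 = {n \<in> N. p ^ \<kappa> n \<le> 2 * n}"
  define N2 where "N2 = {n \<in> N. 2 * n < p ^ \<kappa> n}"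
  have p0: "p > 0" using p by simp
  let ?t = "\<lambda>N n. if n \<in> N then real (totient n) / real p ^ \<kappa> n else 0"
  have mono: "measure circle_measure (hit_limsup p \<kappa> M) \<le> measure circle_measure (hit_limsup p \<kappa> N)" if "M \<subseteq> N" for M
  proof (rule finite_measure_mono[OF _ hit_limsup_sets])
    have "{n \<in> M. y \<in> hit p (\<kappa> n) n} \<subseteq> {n \<in> N. y \<in> hit p (\<kappa> n) n}" for y using that by blast
    then show "hit_limsup p \<kappa> M \<subseteq> hit_limsup p \<kappa> N"
      unfolding hit_limsup_def using infinite_super by blast
  qed
  have "\<not> summable (?t N1) \<or> \<not> summable (?t N2)"
  proof (rule ccontr)
    assume "\<not> (\<not> summable (?t N1) \<or> \<not> summable (?t N2))"
    then have "summable (\<lambda>n. ?t N1 n + ?t N2 n)" by (intro summable_add) auto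
    moreover have "(\<lambda>n. ?t N1 n + ?t N2 n) = ?t N" by (auto simp: N1_def N2_def fun_eq_iff)
    ultimately show False using ns by simp
  qed
  then have "measure circle_measure (hit_limsup p \<kappa> N) > 0"
  proof
    assume 1: "\<not> summable (?t N1)"
    have "measure circle_measure (hit_limsup p \<kappa> N1) > 0"
      by (rule hit_limsup_pos_overlapping[OF p0 _ 1]) (use N in \<open>auto simp: N1_def\<close>)
    then show ?thesis using mono[of N1] by (auto simp: N1_def)
  next
    assume 2: "\<not> summable (?t N2)"
    have "measure circle_measure (hit_limsup p \<kappa> N2) > 0"
      by (rule hit_limsup_pos_disjoint[OF QIA p0 _ 2]) (use N in \<open>auto simp: N2_def\<close>)
    then show ?thesis using mono[of N2] by (auto simp: N2_def)
  qed
  then show ?thesis by (intro zero_one_hit_limsup[OF p _ \<kappa>]) (use N in auto)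
qed

section \<open>The completion and its Haar measure\<close>

locale padic =
  fixes p :: nat
  assumes prime_p: "prime p"
begin

lemma p_gt_1: "p > 1" using prime_p by (rule prime_gt_1_nat)

lemma prime_int_p: "prime (int p)" using prime_p by simp

abbreviation "pabs \<equiv> padic_abs_rat p"

text \<open>The valuation is defined by lowest terms; cross-multiplication and additivity of
  multiplicities carry the formula over to any fraction.\<close>

lemma padic_val_rat_divide:
  assumes "a \<noteq> 0" "b \<noteq> 0"
  shows "padic_val_rat p (of_int a / of_int b) = int (multiplicity (int p) a) - int (multiplicity (int p) b)"
proof -
  define q :: rat where "q = of_int a / of_int b"
  obtain u v where uv: "quotient_of q = (u, v)" by fastforce
  have v: "v > 0" using quotient_of_denom_pos[OF uv] .
  have q: "q = of_int u / of_int v" using quotient_of_div[OF uv] .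
  have "of_int (a * v) = (of_int (u * b) :: rat)" using q v assms(2) unfolding q_def by (simp add: field_simps)
  then have eq: "a * v = u * b" by (simp only: of_int_eq_iff)
  then have "u \<noteq> 0" using assms v by auto
  then have "multiplicity (int p) a + multiplicity (int p) v = multiplicity (int p) u + multiplicity (int p) b"
    using prime_int_p assms v eq
      prime_elem_multiplicity_mult_distrib[of "int p" a v] prime_elem_multiplicity_mult_distrib[of "int p" u b]
    by simp
  then show ?thesis unfolding q_def[symmetric] padic_val_rat_def uv by simp
qed

lemma pabs_0 [simp]: "pabs 0 = 0" by (simp add: padic_abs_rat_def)

lemma pabs_pos: "q \<noteq> 0 \<Longrightarrow> pabs q > 0" using p_gt_1 by (simp add: padic_abs_rat_def)

lemma pabs_nonneg [simp]: "pabs q \<ge> 0" using pabs_pos[of q] by (cases "q = 0") auto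

lemma pabs_of_int: "a \<noteq> 0 \<Longrightarrow> pabs (of_int a) = 1 / real p ^ multiplicity (int p) a"
  using padic_val_rat_divide[of a 1] by (simp add: padic_abs_rat_def power_int_minus divide_inverse)

lemma pabs_of_int_divide: "b \<noteq> 0 \<Longrightarrow> pabs (of_int a / of_int b) = pabs (of_int a) / pabs (of_int b)"
proof (cases "a = 0")
  case False
  assume b: "b \<noteq> 0"
  have "pabs (of_int a / of_int b) = real p powi (int (multiplicity (int p) b) - int (multiplicity (int p) a))"
    using False b by (simp add: padic_abs_rat_def padic_val_rat_divide)
  also have "\<dots> = real p ^ multiplicity (int p) b / real p ^ multiplicity (int p) a"
    using p_gt_1 by (simp add: power_int_diff)
  finally show ?thesis using False b by (simp add: pabs_of_int)
qed simp

lemma rat_cases: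
  obtains a b :: int where "(q :: rat) = of_int a / of_int b" "b > 0" "coprime a b"
proof -
  obtain a b where ab: "quotient_of q = (a, b)" by fastforce
  show thesis using that[of a b] quotient_of_div[OF ab] quotient_of_denom_pos[OF ab] quotient_of_coprime[OF ab] by simp
qed

lemma pabs_of_int_mult: "pabs (of_int (a * b)) = pabs (of_int a) * pabs (of_int b)"
proof (cases "a = 0 \<or> b = 0")
  case False
  then have "multiplicity (int p) (a * b) = multiplicity (int p) a + multiplicity (int p) b"
    using prime_int_p by (intro prime_elem_multiplicity_mult_distrib) auto
  then show ?thesis using False pabs_of_int[of "a * b"] pabs_of_int[of a] pabs_of_int[of b] by (simp add: power_add)
qed auto

lemma pabs_mult: "pabs (x * y) = pabs x * pabs y"
proof -
  obtain a b where x: "x = of_int a / of_int b" "b > 0" by (rule rat_cases)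
  obtain c d where y: "y = of_int c / of_int d" "d > 0" by (rule rat_cases)
  have "x * y = of_int (a * c) / of_int (b * d)" by (simp add: x y)
  also have "pabs \<dots> = pabs (of_int (a * c)) / pabs (of_int (b * d))" using x y by (intro pabs_of_int_divide) auto
  also have "\<dots> = pabs x * pabs y"
    using x y pabs_of_int_divide[of b a] pabs_of_int_divide[of d c] by (simp only: pabs_of_int_mult) simp
  finally show ?thesis .
qed

text \<open>The dictionary between balls and congruences through which all digit arguments enter the
  completion.\<close>

lemma pabs_of_int_le_iff: "pabs (of_int a) \<le> 1 / real p ^ k \<longleftrightarrow> int (p ^ k) dvd a"
proof (cases "a = 0")
  case False
  have nu: "\<not> is_unit (int p)" using prime_int_p by auto
  have "pabs (of_int a) \<le> 1 / real p ^ k \<longleftrightarrow> real p ^ k \<le> real p ^ multiplicity (int p) a"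
    using p_gt_1 by (simp add: pabs_of_int[OF False] field_simps)
  also have "\<dots> \<longleftrightarrow> k \<le> multiplicity (int p) a" using p_gt_1 by (intro power_increasing_iff) simp
  also have "\<dots> \<longleftrightarrow> int p ^ k dvd a" using False nu by (simp add: power_dvd_iff_le_multiplicity)
  finally show ?thesis by simp
qed simp

lemma pabs_of_int_add: "pabs (of_int (a + b)) \<le> max (pabs (of_int a)) (pabs (of_int b))"
proof (cases "a = 0 \<or> b = 0")
  case False
  define k where "k = min (multiplicity (int p) a) (multiplicity (int p) b)"
  have "pabs (of_int a) \<le> 1 / real p ^ multiplicity (int p) a" "pabs (of_int b) \<le> 1 / real p ^ multiplicity (int p) b"
    using False by (simp_all add: pabs_of_int)
  then have d: "int (p ^ multiplicity (int p) a) dvd a" "int (p ^ multiplicity (int p) b) dvd b"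
    by (simp_all only: pabs_of_int_le_iff)
  have "int (p ^ k) dvd a" "int (p ^ k) dvd b"
    unfolding k_def
    by (rule dvd_trans[OF _ d(1)] dvd_trans[OF _ d(2)], simp add: le_imp_power_dvd)+
  then have "int (p ^ k) dvd a + b" by (rule dvd_add)
  then have "pabs (of_int (a + b)) \<le> 1 / real p ^ k" by (simp only: pabs_of_int_le_iff)
  moreover have "1 / real p ^ k = pabs (of_int a) \<or> 1 / real p ^ k = pabs (of_int b)"
    using False by (auto simp: k_def min_def pabs_of_int)
  ultimately show ?thesis by auto
qed auto

lemma pabs_add: "pabs (x + y) \<le> max (pabs x) (pabs y)"
proof -
  obtain a b where x: "x = of_int a / of_int b" "b > 0" by (rule rat_cases)
  obtain c d where y: "y = of_int c / of_int d" "d > 0" by (rule rat_cases)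
  have x': "x = of_int (a * d) / of_int (b * d)" and y': "y = of_int (c * b) / of_int (b * d)"
    using x y by simp_all
  have nz: "b * d \<noteq> 0" using x y by simp
  have pos: "pabs (of_int (b * d)) > 0" using nz by (intro pabs_pos) simp
  have "x + y = of_int (a * d + c * b) / of_int (b * d)" unfolding x' y' by (simp add: add_divide_distrib)
  then have "pabs (x + y) = pabs (of_int (a * d + c * b)) / pabs (of_int (b * d))" by (simp only: pabs_of_int_divide[OF nz])
  also have "\<dots> \<le> max (pabs (of_int (a * d))) (pabs (of_int (c * b))) / pabs (of_int (b * d))"
    using pos pabs_of_int_add[of "a * d" "c * b"] by (intro divide_right_mono) simp_all
  also have "\<dots> = max (pabs x) (pabs y)"
    unfolding x' y' pabs_of_int_divide[OF nz] using pos by (simp add: max_divide_distrib_right)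
  finally show ?thesis .
qed

lemma pabs_minus [simp]: "pabs (- x) = pabs x"
proof -
  have "pabs (- 1) = 1" using pabs_of_int[of "- 1"] by (simp add: multiplicity_unit_right)
  then show ?thesis using pabs_mult[of "- 1" x] by simp
qed

lemma pabs_diff: "pabs (x - y) \<le> max (pabs x) (pabs y)" using pabs_add[of x "- y"] by simp

lemma pabs_diff_commute: "pabs (x - y) = pabs (y - x)" using pabs_minus[of "x - y"] by simp

lemma pabs_diff_triangle: "pabs (x - z) \<le> max (pabs (x - y)) (pabs (y - z))"
  using pabs_add[of "x - y" "y - z"] by simp

lemma pabs_add_le: "pabs (x + y) \<le> pabs x + pabs y"
proof -
  have "max (pabs x) (pabs y) \<le> pabs x + pabs y" by simp
  then show ?thesis using pabs_add[of x y] by linarith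
qed

lemma abs_A_diff_le: "\<bar>pabs x - pabs y\<bar> \<le> pabs (x - y)"
proof -
  have "pabs x \<le> pabs y + pabs (x - y)" using pabs_add_le[of y "x - y"] by simp
  moreover have "pabs y \<le> pabs x + pabs (x - y)"
    using pabs_add_le[of x "y - x"] pabs_diff_commute[of x y] by simp
  ultimately show ?thesis by linarith
qed

lemma pabs_of_nat_le_1 [simp]: "pabs (of_nat n) \<le> 1" using pabs_of_int_le_iff[of "int n" 0] by simp

text \<open>Nonzero values are integral powers of p, so a strict inequality between them improves by
  a factor p.\<close>

lemma pabs_discrete:
  assumes "pabs q < 1 / real p ^ k"
  shows "pabs q \<le> 1 / real p ^ Suc k"
proof (cases "q = 0")
  case False
  define v where "v = padic_val_rat p q"
  have pabs: "pabs q = real p powi (- v)" using False by (simp add: padic_abs_rat_def v_def)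
  have P: "1 / real p ^ j = real p powi (- int j)" for j by (simp add: power_int_minus divide_inverse)
  have "real p powi (- v) < real p powi (- int k)" using assms pabs P by simp
  moreover have "real p powi (- int k) \<le> real p powi (- v)" if "- int k \<le> - v"
    using that p_gt_1 by (intro power_int_increasing) auto
  ultimately have "- v < - int k" by (meson not_le)
  then have "- v \<le> - int (Suc k)" by simp
  then have "real p powi (- v) \<le> real p powi (- int (Suc k))" using p_gt_1 by (intro power_int_increasing) auto
  then show ?thesis using pabs P by metis
qed simp

section \<open>Cauchy sequences modulo null sequences\<close>

abbreviation "R \<equiv> padic_cauchy_ring p"
abbreviation "I \<equiv> padic_null p"
abbreviation "C \<equiv> padic_cauchy p"

lemma R_simps [simp]:
  "carrier R = C" "X \<otimes>\<^bsub>R\<^esub> Y = (\<lambda>n. X n * Y n)" "\<one>\<^bsub>R\<^esub> = (\<lambda>_. 1)" "\<zero>\<^bsub>R\<^esub> = (\<lambda>_. 0)"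
  "X \<oplus>\<^bsub>R\<^esub> Y = (\<lambda>n. X n + Y n)"
  by (simp_all add: padic_cauchy_ring_def)

lemma cauchyI: "(\<And>e. e > 0 \<Longrightarrow> \<exists>N. \<forall>m\<ge>N. \<forall>n\<ge>N. pabs (X m - X n) < e) \<Longrightarrow> X \<in> C"
  by (simp add: padic_cauchy_def)

lemma cauchyD: "X \<in> C \<Longrightarrow> e > 0 \<Longrightarrow> \<exists>N. \<forall>m\<ge>N. \<forall>n\<ge>N. pabs (X m - X n) < e"
  by (simp add: padic_cauchy_def)

lemma cauchy_const [simp]: "(\<lambda>_. q) \<in> C"
  by (intro cauchyI) simp

lemma cauchy_add: assumes "X \<in> C" "Y \<in> C" shows "(\<lambda>n. X n + Y n) \<in> C"
proof (rule cauchyI)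
  fix e :: real assume e: "e > 0"
  obtain N1 where N1: "\<forall>m\<ge>N1. \<forall>n\<ge>N1. pabs (X m - X n) < e" using cauchyD[OF assms(1) e] by blast
  obtain N2 where N2: "\<forall>m\<ge>N2. \<forall>n\<ge>N2. pabs (Y m - Y n) < e" using cauchyD[OF assms(2) e] by blast
  have "pabs ((X m + Y m) - (X n + Y n)) < e" if "m \<ge> max N1 N2" "n \<ge> max N1 N2" for m n
  proof -
    have eq: "(X m + Y m) - (X n + Y n) = (X m - X n) + (Y m - Y n)" by simp
    have "pabs (X m - X n) < e" "pabs (Y m - Y n) < e" using N1 N2 that by auto
    then show ?thesis unfolding eq using le_less_trans[OF pabs_add[of "X m - X n" "Y m - Y n"]] by simp
  qed
  then show "\<exists>N. \<forall>m\<ge>N. \<forall>n\<ge>N. pabs ((X m + Y m) - (X n + Y n)) < e" by blast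
qed

lemma cauchy_uminus: "X \<in> C \<Longrightarrow> (\<lambda>n. - X n) \<in> C"
proof -
  have "pabs (- X m - - X n) = pabs (X m - X n)" for m n using pabs_minus[of "X m - X n"] by (simp add: algebra_simps)
  then show "X \<in> C \<Longrightarrow> (\<lambda>n. - X n) \<in> C" by (simp add: padic_cauchy_def)
qed

lemma cauchy_diff: "X \<in> C \<Longrightarrow> Y \<in> C \<Longrightarrow> (\<lambda>n. X n - Y n) \<in> C"
  using cauchy_add[OF _ cauchy_uminus] by simp

lemma cauchy_A_convergent: assumes "X \<in> C" shows "convergent (\<lambda>n. pabs (X n))"
proof -
  have "Cauchy (\<lambda>n. pabs (X n))"
    unfolding Cauchy_def
  proof (intro allI impI)
    fix e :: real assume "e > 0"
    then obtain N where N: "\<forall>m\<ge>N. \<forall>n\<ge>N. pabs (X m - X n) < e" using cauchyD[OF assms] by blast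
    then have "\<forall>m\<ge>N. \<forall>n\<ge>N. dist (pabs (X m)) (pabs (X n)) < e"
      unfolding dist_real_def by (meson abs_A_diff_le le_less_trans)
    then show "\<exists>M. \<forall>m\<ge>M. \<forall>n\<ge>M. dist (pabs (X m)) (pabs (X n)) < e" by blast
  qed
  then show ?thesis by (rule Cauchy_convergent)
qed

lemma cauchy_bounded: assumes "X \<in> C" obtains B where "B > 0" "\<And>n. pabs (X n) \<le> B"
proof -
  have "Bseq (\<lambda>n. pabs (X n))" using cauchy_A_convergent[OF assms] by (rule convergent_imp_Bseq)
  then show thesis using that unfolding Bseq_def by auto
qed

lemma pabs_tendsto_0_squeeze:
  assumes "Y \<longlonglongrightarrow> 0" "\<And>n. pabs (X n) \<le> Y n"
  shows "(\<lambda>n. pabs (X n)) \<longlonglongrightarrow> 0"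
  by (rule tendsto_sandwich[OF _ _ tendsto_const assms(1)]) (use assms(2) in auto)

lemma cauchy_mult: assumes "X \<in> C" "Y \<in> C" shows "(\<lambda>n. X n * Y n) \<in> C"
proof (rule cauchyI)
  fix e :: real assume e: "e > 0"
  obtain B1 where B1: "B1 > 0" "\<And>n. pabs (X n) \<le> B1" using cauchy_bounded[OF assms(1)] by blast
  obtain B2 where B2: "B2 > 0" "\<And>n. pabs (Y n) \<le> B2" using cauchy_bounded[OF assms(2)] by blast
  obtain N1 where N1: "\<forall>m\<ge>N1. \<forall>n\<ge>N1. pabs (X m - X n) < e / B2" using cauchyD[OF assms(1), of "e / B2"] e B2 by auto
  obtain N2 where N2: "\<forall>m\<ge>N2. \<forall>n\<ge>N2. pabs (Y m - Y n) < e / B1" using cauchyD[OF assms(2), of "e / B1"] e B1 by auto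
  have "pabs (X m * Y m - X n * Y n) < e" if mn: "m \<ge> max N1 N2" "n \<ge> max N1 N2" for m n
  proof -
    have "X m * Y m - X n * Y n = (X m - X n) * Y m + X n * (Y m - Y n)" by (simp add: algebra_simps)
    then have le: "pabs (X m * Y m - X n * Y n) \<le> max (pabs (X m - X n) * pabs (Y m)) (pabs (X n) * pabs (Y m - Y n))"
      using pabs_add[of "(X m - X n) * Y m" "X n * (Y m - Y n)"] by (simp only: pabs_mult)
    have "pabs (X m - X n) * pabs (Y m) \<le> pabs (X m - X n) * B2" using B2 by (intro mult_left_mono) auto
    also have "\<dots> < e / B2 * B2" using N1 mn B2(1) by (intro mult_strict_right_mono) auto
    finally have 1: "pabs (X m - X n) * pabs (Y m) < e" using B2(1) by simp
    have "pabs (X n) * pabs (Y m - Y n) \<le> B1 * pabs (Y m - Y n)" using B1 by (intro mult_right_mono) auto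
    also have "\<dots> < B1 * (e / B1)" using N2 mn B1(1) by (intro mult_strict_left_mono) auto
    finally have 2: "pabs (X n) * pabs (Y m - Y n) < e" using B1(1) by simp
    show ?thesis using le 1 2 by simp
  qed
  then show "\<exists>N. \<forall>m\<ge>N. \<forall>n\<ge>N. pabs (X m * Y m - X n * Y n) < e" by blast
qed

lemma R_cring: "cring R"
proof (rule cringI)
  show "abelian_group R"
  proof (rule abelian_groupI)
    fix X assume "X \<in> carrier R"
    then show "\<exists>Y\<in>carrier R. Y \<oplus>\<^bsub>R\<^esub> X = \<zero>\<^bsub>R\<^esub>"
      by (intro bexI[of _ "\<lambda>n. - X n"]) (simp_all add: cauchy_uminus)
  qed (auto simp: cauchy_add fun_eq_iff)
  show "comm_monoid R"
    by (rule comm_monoidI) (auto simp: cauchy_mult fun_eq_iff)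
qed (auto simp: fun_eq_iff algebra_simps)

lemma R_ring: "ring R" using R_cring by (rule cring.axioms)

lemma R_minus: "X \<in> C \<Longrightarrow> \<ominus>\<^bsub>R\<^esub> X = (\<lambda>n. - X n)"
proof -
  interpret R: ring R by (rule R_ring)
  assume "X \<in> C"
  then show ?thesis by (intro R.minus_equality) (auto simp: cauchy_uminus)
qed

lemma null_iff: "X \<in> I \<longleftrightarrow> (\<lambda>n. pabs (X n)) \<longlonglongrightarrow> 0"
  by (simp add: padic_null_def)

lemma null_cauchy: assumes "X \<in> I" shows "X \<in> C"
proof (rule cauchyI)
  fix e :: real assume "e > 0"
  then obtain N where N: "\<forall>n\<ge>N. pabs (X n) < e"
    using assms unfolding null_iff by (auto dest: LIMSEQ_D)
  have "pabs (X m - X n) < e" if "m \<ge> N" "n \<ge> N" for m n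
    using pabs_diff[of "X m" "X n"] N that by (auto simp: max_def split: if_splits intro: le_less_trans)
  then show "\<exists>N. \<forall>m\<ge>N. \<forall>n\<ge>N. pabs (X m - X n) < e" by blast
qed

lemma null_add: assumes "X \<in> I" "Y \<in> I" shows "(\<lambda>n. X n + Y n) \<in> I"
  unfolding null_iff
proof (rule pabs_tendsto_0_squeeze)
  show "(\<lambda>n. pabs (X n) + pabs (Y n)) \<longlonglongrightarrow> 0" using tendsto_add[of _ 0 _ _ 0] assms unfolding null_iff by fastforce
  show "pabs (X n + Y n) \<le> pabs (X n) + pabs (Y n)" for n
    by (rule pabs_add_le)
qed

lemma null_mult: assumes "X \<in> I" "Y \<in> C" shows "(\<lambda>n. Y n * X n) \<in> I"
proof -
  obtain B where B: "B > 0" "\<And>n. pabs (Y n) \<le> B" using cauchy_bounded[OF assms(2)] by blast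
  show ?thesis unfolding null_iff
  proof (rule pabs_tendsto_0_squeeze)
    show "(\<lambda>n. B * pabs (X n)) \<longlonglongrightarrow> 0" using assms(1) unfolding null_iff by (rule tendsto_mult_right_zero)
    show "pabs (Y n * X n) \<le> B * pabs (X n)" for n using B(2) by (simp add: pabs_mult mult_right_mono)
  qed
qed

lemma I_ideal: "ideal I R"
proof -
  interpret R: ring R by (rule R_ring)
  show ?thesis
  proof (rule idealI[OF R_ring])
    show "subgroup I (add_monoid R)"
    proof (rule R.add.subgroupI)
      show "I \<subseteq> carrier R" using null_cauchy by auto
      have "(\<lambda>_. 0) \<in> I" by (simp add: null_iff)
      then show "I \<noteq> {}" by blast
      fix X assume X: "X \<in> I"
      then show "\<ominus>\<^bsub>R\<^esub> X \<in> I" using R_minus[OF null_cauchy[OF X]] by (simp add: null_iff)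
      fix Y assume "Y \<in> I"
      with X show "X \<oplus>\<^bsub>R\<^esub> Y \<in> I" by (simp add: null_add)
    qed
    fix X Y assume "X \<in> I" "Y \<in> carrier R"
    then show "Y \<otimes>\<^bsub>R\<^esub> X \<in> I" "X \<otimes>\<^bsub>R\<^esub> Y \<in> I"
      using null_mult[of X Y] by (simp_all add: mult.commute)
  qed
qed

definition cls :: "(nat \<Rightarrow> rat) \<Rightarrow> (nat \<Rightarrow> rat) set" where
  "cls X = I +>\<^bsub>R\<^esub> X"

lemma cls_def': "cls X = {\<lambda>n. Z n + X n |Z. Z \<in> I}"
  by (auto simp: cls_def a_r_coset_def')

abbreviation "Q \<equiv> Qp p"

lemma Q_ring: "ring Q"
  unfolding Qp_def by (rule ideal.quotient_is_ring[OF I_ideal])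

lemma cls_hom: "cls \<in> ring_hom R Q"
proof -
  have "(+>\<^bsub>R\<^esub>) I \<in> ring_hom R Q" unfolding Qp_def by (rule ideal.rcos_ring_hom[OF I_ideal])
  then show ?thesis by (simp add: cls_def[abs_def])
qed

lemma cls_carrier [simp]: "X \<in> C \<Longrightarrow> cls X \<in> carrier Q"
  using ring_hom_closed[OF cls_hom] by simp

lemma cls_add: "X \<in> C \<Longrightarrow> Y \<in> C \<Longrightarrow> cls X \<oplus>\<^bsub>Q\<^esub> cls Y = cls (\<lambda>n. X n + Y n)"
  using ring_hom_add[OF cls_hom, of X Y] by simp

lemma cls_diff: "X \<in> C \<Longrightarrow> Y \<in> C \<Longrightarrow> cls X \<ominus>\<^bsub>Q\<^esub> cls Y = cls (\<lambda>n. X n - Y n)"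
proof -
  assume X: "X \<in> C" and Y: "Y \<in> C"
  interpret R: ring R by (rule R_ring)
  interpret Q: ring Q by (rule Q_ring)
  interpret h: ring_hom_ring R Q cls by (intro ring_hom_ringI2 R_ring Q_ring cls_hom)
  have "\<ominus>\<^bsub>Q\<^esub> cls Y = cls (\<lambda>n. - Y n)" using h.hom_a_inv[of Y] Y by (simp add: R_minus)
  then show ?thesis using cls_add[OF X cauchy_uminus[OF Y]] by (simp add: a_minus_def)
qed

lemma carrier_cases:
  assumes "x \<in> carrier Q" obtains X where "X \<in> C" "x = cls X"
  using assms that unfolding Qp_def FactRing_def A_RCOSETS_def' cls_def by auto

lemma of_rat_eq: "padic_of_rat p q = cls (\<lambda>_. q)"
  by (simp add: padic_of_rat_def cls_def)

text \<open>The reason why \<open>padic_abs\<close> is well defined on classes: a null sequence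
  added to a representative leaves the limit of the absolute values unchanged.\<close>

lemma pabs_diff_tendsto:
  assumes "(\<lambda>n. pabs (Z n)) \<longlonglongrightarrow> 0" "(\<lambda>n. pabs (X n)) \<longlonglongrightarrow> L"
  shows "(\<lambda>n. pabs (Z n + X n)) \<longlonglongrightarrow> L"
proof -
  have "(\<lambda>n. pabs (Z n + X n) - pabs (X n)) \<longlonglongrightarrow> 0"
  proof (rule tendsto_rabs_zero_cancel, rule tendsto_sandwich[OF _ _ tendsto_const assms(1)])
    have "\<bar>pabs (Z n + X n) - pabs (X n)\<bar> \<le> pabs (Z n)" for n using abs_A_diff_le[of "Z n + X n" "X n"] by simp
    then show "\<forall>\<^sub>F n in sequentially. \<bar>pabs (Z n + X n) - pabs (X n)\<bar> \<le> pabs (Z n)" by simp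
  qed simp
  from tendsto_add[OF this assms(2)] show ?thesis by simp
qed

lemma padic_abs_eqI:
  assumes "(\<lambda>n. pabs (X n)) \<longlonglongrightarrow> L"
  shows "padic_abs p (cls X) = L"
  unfolding padic_abs_def
proof (rule the_equality)
  show *: "\<forall>Y\<in>cls X. (\<lambda>n. pabs (Y n)) \<longlonglongrightarrow> L"
    using pabs_diff_tendsto[OF _ assms] by (auto simp: cls_def' null_iff)
  have "X \<in> cls X" unfolding cls_def' by (rule CollectI, rule exI[of _ "\<lambda>_. 0"]) (simp add: null_iff)
  then show "l = L" if "\<forall>Y\<in>cls X. (\<lambda>n. pabs (Y n)) \<longlonglongrightarrow> l" for l
    using that * LIMSEQ_unique by blast
qed

lemma padic_abs_cls: "X \<in> C \<Longrightarrow> (\<lambda>n. pabs (X n)) \<longlonglongrightarrow> padic_abs p (cls X)"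
proof -
  assume "X \<in> C"
  then obtain L where L: "(\<lambda>n. pabs (X n)) \<longlonglongrightarrow> L" using cauchy_A_convergent convergent_def by blast
  then show ?thesis using padic_abs_eqI[OF L] by simp
qed

section \<open>The ultrametric on the completion\<close>

abbreviation pdist :: "(nat \<Rightarrow> rat) set \<Rightarrow> (nat \<Rightarrow> rat) set \<Rightarrow> real" where
  "pdist x y \<equiv> padic_abs p (x \<ominus>\<^bsub>Q\<^esub> y)"

abbreviation rat_emb :: "rat \<Rightarrow> (nat \<Rightarrow> rat) set" where
  "rat_emb \<equiv> padic_of_rat p"

lemma rat_emb_carrier [simp]: "rat_emb q \<in> carrier Q" by (simp add: of_rat_eq)

lemma pdist_cls: "X \<in> C \<Longrightarrow> Y \<in> C \<Longrightarrow> (\<lambda>n. pabs (X n - Y n)) \<longlonglongrightarrow> pdist (cls X) (cls Y)"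
  using padic_abs_cls[OF cauchy_diff] by (simp add: cls_diff)

lemma pdist_nonneg:
  assumes "x \<in> carrier Q" "y \<in> carrier Q" shows "pdist x y \<ge> 0"
proof -
  obtain X where X: "X \<in> C" "x = cls X" using assms(1) by (rule carrier_cases)
  obtain Y where Y: "Y \<in> C" "y = cls Y" using assms(2) by (rule carrier_cases)
  show ?thesis using pdist_cls[OF X(1) Y(1)] by (auto simp: X Y intro: LIMSEQ_le_const)
qed

lemma pdist_commute:
  assumes "x \<in> carrier Q" "y \<in> carrier Q" shows "pdist x y = pdist y x"
proof -
  obtain X where X: "X \<in> C" "x = cls X" using assms(1) by (rule carrier_cases)
  obtain Y where Y: "Y \<in> C" "y = cls Y" using assms(2) by (rule carrier_cases)
  have "(\<lambda>n. pabs (X n - Y n)) \<longlonglongrightarrow> pdist y x" using pdist_cls[OF Y(1) X(1)] by (simp add: X Y pabs_diff_commute)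
  then show ?thesis using pdist_cls[OF X(1) Y(1)] LIMSEQ_unique by (auto simp: X Y)
qed

lemma pdist_triangle:
  assumes "x \<in> carrier Q" "y \<in> carrier Q" "z \<in> carrier Q" shows "pdist x z \<le> max (pdist x y) (pdist y z)"
proof -
  obtain X where X: "X \<in> C" "x = cls X" using assms(1) by (rule carrier_cases)
  obtain Y where Y: "Y \<in> C" "y = cls Y" using assms(2) by (rule carrier_cases)
  obtain Z where Z: "Z \<in> C" "z = cls Z" using assms(3) by (rule carrier_cases)
  have "(\<lambda>n. max (pabs (X n - Y n)) (pabs (Y n - Z n))) \<longlonglongrightarrow> max (pdist x y) (pdist y z)"
    unfolding X Y Z by (intro tendsto_max pdist_cls X Y Z)
  moreover have "(\<lambda>n. pabs (X n - Z n)) \<longlonglongrightarrow> pdist x z" unfolding X Z by (intro pdist_cls X Z)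
  ultimately show ?thesis using pabs_diff_triangle by (intro LIMSEQ_le[of "\<lambda>n. pabs (X n - Z n)"]) auto
qed

lemma pdist_eq_0_iff:
  assumes "x \<in> carrier Q" "y \<in> carrier Q" shows "pdist x y = 0 \<longleftrightarrow> x = y"
proof -
  interpret Q: ring Q by (rule Q_ring)
  obtain X where X: "X \<in> C" "x = cls X" using assms(1) by (rule carrier_cases)
  obtain Y where Y: "Y \<in> C" "y = cls Y" using assms(2) by (rule carrier_cases)
  show ?thesis
  proof
    assume "pdist x y = 0"
    then have "(\<lambda>n. X n - Y n) \<in> I" using pdist_cls[OF X(1) Y(1)] by (simp add: X Y null_iff)
    then have "cls (\<lambda>n. X n - Y n) = \<zero>\<^bsub>Q\<^esub>"
      using ideal.rcos_const_imp_mem abelian_subgroup.a_rcos_const[of I R "\<lambda>n. X n - Y n"] I_ideal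
      by (simp add: cls_def Qp_def FactRing_def ideal.axioms(1) abelian_subgroupI3 additive_subgroup.a_subgroup R_ring ring.is_abelian_group)
    then have "x \<ominus>\<^bsub>Q\<^esub> y = \<zero>\<^bsub>Q\<^esub>" using X Y by (simp add: cls_diff)
    then show "x = y" using assms by (simp add: Q.r_right_minus_eq)
  next
    assume "x = y"
    then have "(\<lambda>n. pabs (0::rat)) \<longlonglongrightarrow> pdist x y" using pdist_cls[OF X(1) X(1)] by (simp add: X)
    then show "pdist x y = 0" using LIMSEQ_unique[OF tendsto_const] by fastforce
  qed
qed

lemma pdist_rat: "pdist (rat_emb a) (rat_emb b) = pabs (a - b)"
  using pdist_cls[of "\<lambda>_. a" "\<lambda>_. b"] LIMSEQ_unique[OF _ tendsto_const] by (force simp: of_rat_eq)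

lemma pdist_add_right:
  assumes "x \<in> carrier Q" "y \<in> carrier Q" "z \<in> carrier Q" 
  shows "pdist (x \<oplus>\<^bsub>Q\<^esub> z) (y \<oplus>\<^bsub>Q\<^esub> z) = pdist x y"
proof -
  obtain X where X: "X \<in> C" "x = cls X" using assms(1) by (rule carrier_cases)
  obtain Y where Y: "Y \<in> C" "y = cls Y" using assms(2) by (rule carrier_cases)
  obtain Z where Z: "Z \<in> C" "z = cls Z" using assms(3) by (rule carrier_cases)
  show ?thesis using X Y Z by (simp add: cls_add cls_diff cauchy_add)
qed

lemma padic_abs_eq_pdist: "x \<in> carrier Q \<Longrightarrow> padic_abs p x = pdist x (rat_emb 0)"
proof -
  assume "x \<in> carrier Q"
  then obtain X where X: "X \<in> C" "x = cls X" by (rule carrier_cases)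
  then show ?thesis by (simp add: of_rat_eq cls_diff)
qed

lemma rat_emb_add: "rat_emb a \<oplus>\<^bsub>Q\<^esub> rat_emb b = rat_emb (a + b)"
  by (simp add: of_rat_eq cls_add)

lemma rat_dense:
  assumes "x \<in> carrier Q" "e > 0" obtains q where "pdist x (rat_emb q) < e"
proof -
  obtain X where X: "X \<in> C" "x = cls X" using assms(1) by (rule carrier_cases)
  obtain M where M: "\<forall>m\<ge>M. \<forall>n\<ge>M. pabs (X m - X n) < e / 2" using cauchyD[OF X(1), of "e / 2"] assms(2) by auto
  have "(\<lambda>n. pabs (X n - X M)) \<longlonglongrightarrow> pdist x (rat_emb (X M))"
    using pdist_cls[OF X(1) cauchy_const[of "X M"]] by (simp add: X of_rat_eq)
  then have "pdist x (rat_emb (X M)) \<le> e / 2"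
    by (rule LIMSEQ_le_const2) (use M in \<open>auto intro!: exI[of _ M] less_imp_le\<close>)
  then show thesis using assms(2) by (intro that[of "X M"]) simp
qed

lemma pdist_isosceles:
  assumes "x \<in> carrier Q" "y \<in> carrier Q" "z \<in> carrier Q" "pdist x y < pdist y z"
  shows "pdist x z = pdist y z"
  using pdist_triangle[OF assms(1,2,3)] pdist_triangle[OF assms(2,1,3)] pdist_commute[OF assms(1,2)] assms(4)
  by (auto simp: max_def split: if_splits)

text \<open>Discreteness passes from the rationals to the completion: points closer to x and y than
  these are to each other have the same mutual distance, by the isosceles property, and rational
  ones exist by density.\<close>

lemma pdist_discrete:
  assumes "x \<in> carrier Q" "y \<in> carrier Q" "pdist x y < 1 / real p ^ k"
  shows "pdist x y \<le> 1 / real p ^ Suc k"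
proof (cases "pdist x y = 0")
  case True
  then show ?thesis using p_gt_1 by simp
next
  case False
  then have pos: "pdist x y > 0" using pdist_nonneg[OF assms(1,2)] by simp
  obtain a where a: "pdist x (rat_emb a) < pdist x y" using rat_dense[OF assms(1) pos] by blast
  obtain b where b: "pdist y (rat_emb b) < pdist x y" using rat_dense[OF assms(2) pos] by blast
  have 1: "pdist (rat_emb a) y = pdist x y"
    using pdist_isosceles[of "rat_emb a" x y] a assms(1,2) by (simp add: pdist_commute[of "rat_emb a" x])
  have "pdist (rat_emb b) (rat_emb a) = pdist y (rat_emb a)"
    using pdist_isosceles[of "rat_emb b" y "rat_emb a"] b 1 assms(1,2)
    by (simp add: pdist_commute[of "rat_emb b" y] pdist_commute[of y "rat_emb a"])
  then have "pabs (b - a) = pdist x y" using 1 assms(2) by (simp add: pdist_rat pdist_commute[of y "rat_emb a"])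
  then show ?thesis using pabs_discrete[of "b - a" k] assms(3) by simp
qed

section \<open>The p-adic integers and their balls\<close>

abbreviation "Z \<equiv> Zp p"

lemma Zp_iff: "x \<in> Z \<longleftrightarrow> x \<in> carrier Q \<and> pdist x (rat_emb 0) \<le> 1"
  unfolding Zp_def using padic_abs_eq_pdist by auto

lemma Zp_carrier: "x \<in> Z \<Longrightarrow> x \<in> carrier Q" by (simp add: Zp_iff)

lemma Zp_pdist_le_1: "x \<in> Z \<Longrightarrow> y \<in> Z \<Longrightarrow> pdist x y \<le> 1"
  using pdist_triangle[of x "rat_emb 0" y] pdist_commute[of y "rat_emb 0"] by (auto simp: Zp_iff)

lemma Zp_if_close: "x \<in> carrier Q \<Longrightarrow> y \<in> Z \<Longrightarrow> pdist x y \<le> 1 \<Longrightarrow> x \<in> Z"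
  using pdist_triangle[of x y "rat_emb 0"] by (auto simp: Zp_iff)

lemma rat_emb_Zp_iff: "rat_emb q \<in> Z \<longleftrightarrow> pabs q \<le> 1"
  by (simp add: Zp_iff pdist_rat)

lemma rat_emb_nat_Zp [simp]: "rat_emb (of_nat j) \<in> Z" by (simp add: rat_emb_Zp_iff)

lemma Zp_add: "x \<in> Z \<Longrightarrow> y \<in> Z \<Longrightarrow> x \<oplus>\<^bsub>Q\<^esub> y \<in> Z"
proof -
  assume x: "x \<in> Z" and y: "y \<in> Z"
  interpret Qr: ring Q by (rule Q_ring)
  have c: "x \<in> carrier Q" "y \<in> carrier Q" using x y by (simp_all add: Zp_iff)
  have "rat_emb 0 \<oplus>\<^bsub>Q\<^esub> y = y"
  proof -
    obtain Y where Y: "Y \<in> C" "y = cls Y" using c(2) by (rule carrier_cases)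
    then show ?thesis by (simp add: of_rat_eq cls_add)
  qed
  then have "pdist (x \<oplus>\<^bsub>Q\<^esub> y) y = pdist x (rat_emb 0)" using pdist_add_right[of x "rat_emb 0" y] c by simp
  then have "pdist (x \<oplus>\<^bsub>Q\<^esub> y) y \<le> 1" using x by (simp add: Zp_iff)
  then show ?thesis by (rule Zp_if_close[OF Qr.a_closed[OF c] y])
qed

lemma Metric_space_Zp: "Metric_space Z (padic_dist p)"
proof
  show "0 \<le> padic_dist p x y" for x y using pdist_nonneg by (simp add: padic_dist_def)
  show "padic_dist p x y = padic_dist p y x" for x y using pdist_commute by (simp add: padic_dist_def)
  show "padic_dist p x y = 0 \<longleftrightarrow> x = y" if "x \<in> Z" "y \<in> Z" for x y
    using that pdist_eq_0_iff by (simp add: padic_dist_def Zp_iff)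
  show "padic_dist p x z \<le> padic_dist p x y + padic_dist p y z" if "x \<in> Z" "y \<in> Z" "z \<in> Z" for x y z
  proof -
    have c: "x \<in> carrier Q" "y \<in> carrier Q" "z \<in> carrier Q" using that by (simp_all add: Zp_iff)
    have "max (pdist x y) (pdist y z) \<le> pdist x y + pdist y z" using pdist_nonneg c by simp
    then have "pdist x z \<le> pdist x y + pdist y z" using pdist_triangle[OF c] by linarith
    then show ?thesis using c by (simp add: padic_dist_def)
  qed
qed

definition opens :: "(nat \<Rightarrow> rat) set set set" where
  "opens = {U. openin (Metric_space.mtopology Z (padic_dist p)) U}"

lemma opens_iff: "U \<in> opens \<longleftrightarrow> U \<subseteq> Z \<and> (\<forall>x\<in>U. \<exists>r>0. \<forall>y\<in>Z. pdist x y < r \<longrightarrow> y \<in> U)"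
proof -
  interpret MS: Metric_space Z "padic_dist p" by (rule Metric_space_Zp)
  have "U \<in> opens \<longleftrightarrow> U \<subseteq> Z \<and> (\<forall>x\<in>U. \<exists>r>0. MS.mball x r \<subseteq> U)"
    by (auto simp: opens_def MS.openin_mtopology)
  also have "\<dots> \<longleftrightarrow> U \<subseteq> Z \<and> (\<forall>x\<in>U. \<exists>r>0. \<forall>y\<in>Z. pdist x y < r \<longrightarrow> y \<in> U)"
  proof (rule conj_cong[OF refl], rule ball_cong[OF refl])
    fix x assume "U \<subseteq> Z" "x \<in> U"
    then have x: "x \<in> Z" by blast
    then have "y \<in> MS.mball x r \<longleftrightarrow> y \<in> Z \<and> pdist x y < r" for r y
      by (simp add: MS.in_mball padic_dist_def Zp_carrier conj_commute cong: conj_cong)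
    then show "(\<exists>r>0. MS.mball x r \<subseteq> U) \<longleftrightarrow> (\<exists>r>0. \<forall>y\<in>Z. pdist x y < r \<longrightarrow> y \<in> U)"
      unfolding subset_iff by blast
  qed
  finally show ?thesis .
qed

lemma inverse_power_less:
  assumes "r > 0" obtains k where "1 / real p ^ k < r"
proof -
  obtain k where "(1 / real p) ^ k < r" using real_arch_pow_inv[of r "1 / real p"] assms p_gt_1 by auto
  then show thesis using that by (simp add: power_one_over)
qed

definition residue_ball :: "nat \<Rightarrow> nat \<Rightarrow> (nat \<Rightarrow> rat) set set" where
  "residue_ball k j = {x \<in> Z. pdist x (rat_emb (of_nat j)) \<le> 1 / real p ^ k}"

lemma pabs_of_nat_diff_le_iff: "pabs (of_nat i - of_nat j) \<le> 1 / real p ^ k \<longleftrightarrow> i mod p ^ k = j mod p ^ k"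
proof -
  have "pabs (of_nat i - of_nat j) = pabs (of_int (int i - int j))" by simp
  then have "pabs (of_nat i - of_nat j) \<le> 1 / real p ^ k \<longleftrightarrow> int (p ^ k) dvd int i - int j"
    by (simp only: pabs_of_int_le_iff)
  also have "\<dots> \<longleftrightarrow> int i mod int (p ^ k) = int j mod int (p ^ k)" by (simp only: mod_eq_dvd_iff)
  also have "\<dots> \<longleftrightarrow> i mod p ^ k = j mod p ^ k" by (simp flip: of_nat_mod of_nat_power)
  finally show ?thesis .
qed

text \<open>Approximate x by a rational a/b in lowest terms. It lies in the unit ball, so p does not
  divide b, and the congruence b j = a modulo p^k has a solution j.\<close>

lemma Zp_residue:
  assumes "x \<in> Z" obtains j where "j < p ^ k" "x \<in> residue_ball k j"
proof -
  have pk: "1 / real p ^ k > 0" "1 / real p ^ k \<le> 1" using p_gt_1 by (simp_all add: field_simps)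
  have xc: "x \<in> carrier Q" using assms by (rule Zp_carrier)
  obtain q where q: "pdist x (rat_emb q) < 1 / real p ^ k" using rat_dense[OF xc pk(1)] by blast
  have "pdist (rat_emb q) x \<le> 1" using q pk(2) pdist_commute[OF xc, of "rat_emb q"] by simp
  then have "rat_emb q \<in> Z" by (rule Zp_if_close[OF rat_emb_carrier assms])
  then have "pabs q \<le> 1" by (simp add: rat_emb_Zp_iff)
  obtain a b where ab: "q = of_int a / of_int b" "b > 0" "coprime a b" by (rule rat_cases)
  have "\<not> p dvd nat b"
  proof
    assume "p dvd nat b"
    then have "int p dvd int (nat b)" by (simp only: int_dvd_int_iff)
    then have pb: "int p dvd b" using ab(2) by simp
    then have "\<not> int p dvd a" using coprime_common_divisor[OF ab(3), of "int p"] prime_int_p not_prime_unit by blast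
    then have "\<not> pabs (of_int a) \<le> 1 / real p ^ 1" using pabs_of_int_le_iff[of a 1] by simp
    moreover have "pabs (of_int b) \<le> 1 / real p ^ 1" using pb pabs_of_int_le_iff[of b 1] by simp
    moreover have "pabs (of_int a) = pabs q * pabs (of_int b)" using ab by (simp add: pabs_mult[symmetric])
    moreover have "pabs q * pabs (of_int b) \<le> 1 * pabs (of_int b)" using \<open>pabs q \<le> 1\<close> by (intro mult_right_mono) auto
    ultimately show False by simp
  qed
  then have cop: "coprime p (nat b)" using prime_p by (simp add: prime_imp_coprime)
  obtain j where j: "j < p ^ k" "int (p ^ k) dvd int (nat b) * int j - a"
    using exists_congruent_root[OF cop] p_gt_1 by auto
  have "pabs (of_int b) = 1"
  proof -
    have "\<not> int p dvd int (nat b)" using \<open>\<not> p dvd nat b\<close> by (simp only: int_dvd_int_iff simp_thms)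
    then have "\<not> int p dvd b" using ab(2) by simp
    then have "multiplicity (int p) b = 0" by (rule not_dvd_imp_multiplicity_0)
    then show ?thesis using ab(2) by (simp add: pabs_of_int)
  qed
  then have "pabs (q - of_nat j) = pabs (of_int b) * pabs (q - of_nat j)" by simp
  also have "\<dots> = pabs (of_int (a - b * int j))" using ab(2) by (simp add: pabs_mult[symmetric] ab(1) right_diff_distrib)
  also have "\<dots> \<le> 1 / real p ^ k"
  proof -
    have "int (p ^ k) dvd - (int (nat b) * int j - a)" using j(2) by (simp only: dvd_minus_iff)
    then show ?thesis unfolding pabs_of_int_le_iff using ab(2) by simp
  qed
  finally have "pdist (rat_emb q) (rat_emb (of_nat j)) \<le> 1 / real p ^ k" by (simp add: pdist_rat)
  then have "pdist x (rat_emb (of_nat j)) \<le> 1 / real p ^ k"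
    using pdist_triangle[of x "rat_emb q" "rat_emb (of_nat j)"] q xc by auto
  then show thesis using that[OF j(1)] assms by (simp add: residue_ball_def)
qed

lemma residue_ball_subset: "residue_ball k j \<subseteq> Z" by (auto simp: residue_ball_def)

lemma residue_ball_cong:
  assumes "x \<in> residue_ball k i" "y \<in> Z" "l \<ge> k"
  shows "pdist x y \<le> 1 / real p ^ l \<Longrightarrow> y \<in> residue_ball k i"
proof -
  assume xy: "pdist x y \<le> 1 / real p ^ l"
  have "1 / real p ^ l \<le> 1 / real p ^ k" using assms(3) p_gt_1 by (intro divide_left_mono power_increasing) auto
  moreover have "x \<in> Z" using assms(1) residue_ball_subset by blast
  ultimately have "pdist y x \<le> 1 / real p ^ k" using xy assms(2) pdist_commute[of x y] by (simp add: Zp_iff)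
  then show "y \<in> residue_ball k i"
    using assms pdist_triangle[of y x "rat_emb (of_nat i)"] by (auto simp: residue_ball_def Zp_iff)
qed

lemma residue_ball_dist:
  assumes "x \<in> residue_ball k j" "y \<in> residue_ball k j"
  shows "pdist x y \<le> 1 / real p ^ k"
  using assms pdist_triangle[of x "rat_emb (of_nat j)" y] pdist_commute[of y "rat_emb (of_nat j)"]
  by (auto simp: residue_ball_def Zp_iff)

lemma residue_ball_nested:
  assumes "k \<le> l" "residue_ball k i \<inter> residue_ball l j \<noteq> {}"
  shows "residue_ball l j \<subseteq> residue_ball k i"
proof
  obtain x where x: "x \<in> residue_ball k i" "x \<in> residue_ball l j" using assms(2) by blast
  fix y assume y: "y \<in> residue_ball l j"
  then have "pdist x y \<le> 1 / real p ^ l" using residue_ball_dist x(2) by blast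
  then show "y \<in> residue_ball k i"
    using residue_ball_cong[OF x(1) _ assms(1)] y residue_ball_subset by blast
qed

lemma residue_ball_eq:
  assumes "x \<in> Z" "x \<in> residue_ball k j"
  shows "residue_ball k j = {y \<in> Z. pdist y x \<le> 1 / real p ^ k}"
proof (intro equalityI subsetI)
  fix y assume y: "y \<in> residue_ball k j"
  then have "y \<in> Z" using residue_ball_subset by blast
  then show "y \<in> {y \<in> Z. pdist y x \<le> 1 / real p ^ k}" using residue_ball_dist[OF y assms(2)] by simp
next
  fix y assume y: "y \<in> {y \<in> Z. pdist y x \<le> 1 / real p ^ k}"
  then have "pdist x y \<le> 1 / real p ^ k" using pdist_commute[of x y] assms(1) by (simp add: Zp_iff)
  then show "y \<in> residue_ball k j" using y residue_ball_cong[OF assms(2) _ order_refl] by blast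
qed

lemma residue_ball_unique:
  assumes "x \<in> residue_ball k i" "x \<in> residue_ball k j"
  shows "i mod p ^ k = j mod p ^ k"
proof -
  have x: "x \<in> carrier Q" using assms by (simp add: residue_ball_def Zp_iff)
  have "pdist (rat_emb (of_nat i)) (rat_emb (of_nat j)) \<le> 1 / real p ^ k"
  proof (rule order_trans[OF pdist_triangle[of _ x]])
    show "max (pdist (rat_emb (of_nat i)) x) (pdist x (rat_emb (of_nat j))) \<le> 1 / real p ^ k"
      using pdist_commute[of x "rat_emb (of_nat i)"] assms x by (simp add: residue_ball_def)
  qed (use x in auto)
  then show ?thesis by (simp add: pdist_rat pabs_of_nat_diff_le_iff)
qed

lemma residue_ball_mod: "residue_ball k (j mod p ^ k) = residue_ball k j"
proof -
  have "pdist (rat_emb (of_nat j)) (rat_emb (of_nat (j mod p ^ k))) \<le> 1 / real p ^ k"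
    by (simp add: pdist_rat pabs_of_nat_diff_le_iff)
  then have 1: "rat_emb (of_nat j) \<in> residue_ball k (j mod p ^ k)" by (simp add: residue_ball_def)
  have 2: "rat_emb (of_nat j) \<in> residue_ball k j" using p_gt_1 by (simp add: residue_ball_def pdist_rat)
  show ?thesis using residue_ball_eq[OF _ 1] residue_ball_eq[OF _ 2] by simp
qed

lemma residue_ball_opens: "residue_ball k j \<in> opens"
  unfolding opens_iff
proof (intro conjI ballI residue_ball_subset)
  fix x assume x: "x \<in> residue_ball k j"
  show "\<exists>r>0. \<forall>y\<in>Z. pdist x y < r \<longrightarrow> y \<in> residue_ball k j"
    using residue_ball_cong[OF x _ order_refl] p_gt_1 by (intro exI[of _ "1 / real p ^ k"]) auto
qed

section \<open>Balls as a generator of the Borel sets\<close>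

definition ball_system :: "(nat \<Rightarrow> rat) set set set" where
  "ball_system = insert {} (range (\<lambda>(k, j). residue_ball k j))"

lemma residue_ball_in_system: "residue_ball k j \<in> ball_system"
  unfolding ball_system_def by (rule insertI2, rule image_eqI[of _ _ "(k, j)"]) simp_all

lemma ball_system_Pow: "ball_system \<subseteq> Pow Z"
  using residue_ball_subset by (auto simp: ball_system_def)

text \<open>Balls of an ultrametric are nested or disjoint; the empty set belongs to
  \<open>ball_system\<close> for the disjoint case.\<close>

lemma Int_stable_ball_system: "Int_stable ball_system"
proof (rule Int_stableI)
  fix a b assume ab: "a \<in> ball_system" "b \<in> ball_system"
  show "a \<inter> b \<in> ball_system"
  proof (cases "a \<inter> b = {}")
    case False
    then have "a \<noteq> {}" "b \<noteq> {}" by blast+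
    then have "a \<in> range (\<lambda>(k, j). residue_ball k j)" "b \<in> range (\<lambda>(k, j). residue_ball k j)"
      using ab by (simp_all only: ball_system_def insert_iff simp_thms)
    then obtain k i l j where a: "a = residue_ball k i" and b: "b = residue_ball l j" by auto
    have "a \<inter> b = b \<or> a \<inter> b = a"
    proof (cases "k \<le> l")
      case True
      then show ?thesis using residue_ball_nested[of k l i j] False unfolding a b by blast
    next
      case k: False
      then have "l \<le> k" by simp
      then show ?thesis using residue_ball_nested[of l k j i] False unfolding a b by blast
    qed
    then show ?thesis using ab by auto
  qed (simp add: ball_system_def)
qed

definition borel_Zp :: "(nat \<Rightarrow> rat) set measure" where
  "borel_Zp = sigma Z ball_system"

lemma space_borel_Zp [simp]: "space borel_Zp = Z"
  using ball_system_Pow by (simp add: borel_Zp_def space_measure_of_conv)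

lemma sets_borel_Zp: "sets borel_Zp = sigma_sets Z ball_system"
  using ball_system_Pow by (simp add: borel_Zp_def sets_measure_of_conv)

lemma opens_countable_Union:
  assumes "U \<in> opens" shows "U = \<Union>{B \<in> ball_system. B \<subseteq> U}"
proof
  show "U \<subseteq> \<Union>{B \<in> ball_system. B \<subseteq> U}"
  proof
    fix x assume x: "x \<in> U"
    then have xZ: "x \<in> Z" using assms unfolding opens_iff by (meson subsetD)
    obtain r where r: "r > 0" "\<And>y. y \<in> Z \<Longrightarrow> pdist x y < r \<Longrightarrow> y \<in> U"
      using assms x unfolding opens_iff by blast
    obtain k where k: "1 / real p ^ k < r" using r(1) by (rule inverse_power_less)
    obtain j where j: "x \<in> residue_ball k j" using Zp_residue[OF xZ, of k] by blast
    have "residue_ball k j \<subseteq> U"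
    proof
      fix y assume y: "y \<in> residue_ball k j"
      then have "pdist x y \<le> 1 / real p ^ k" using residue_ball_dist[OF j] by blast
      then show "y \<in> U" using k r(2) y residue_ball_subset by fastforce
    qed
    then show "x \<in> \<Union>{B \<in> ball_system. B \<subseteq> U}" using j residue_ball_in_system by blast
  qed
qed auto

lemma sigma_sets_opens: "sigma_sets Z opens = sigma_sets Z ball_system"
proof (rule sigma_sets_eqI)
  fix U assume "U \<in> opens"
  have "countable ball_system" unfolding ball_system_def by (intro countable_insert countable_image countableI_type)
  then have "countable {B \<in> ball_system. B \<subseteq> U}" by (rule countable_subset[rotated]) blast
  then have "\<Union>{B \<in> ball_system. B \<subseteq> U} \<in> sigma_sets Z ball_system"
    by (rule sigma_sets_UNION) auto
  then show "U \<in> sigma_sets Z ball_system" using opens_countable_Union[OF \<open>U \<in> opens\<close>] by simp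
next
  fix B assume "B \<in> ball_system"
  moreover have "{} \<in> opens" by (simp add: opens_iff)
  ultimately show "B \<in> sigma_sets Z opens"
    using residue_ball_opens unfolding ball_system_def by auto
qed

lemma opens_sets: "U \<in> opens \<Longrightarrow> U \<in> sets borel_Zp"
  unfolding sets_borel_Zp sigma_sets_opens[symmetric] by auto

lemma residue_ball_sets [measurable]: "residue_ball k j \<in> sets borel_Zp"
  using residue_ball_opens by (rule opens_sets)

section \<open>The digit map and Haar measure\<close>

definition expansion :: "real \<Rightarrow> (nat \<Rightarrow> rat) set" where
  "expansion y = cls (\<lambda>k. of_nat (digits p k y))"

lemma pabs_digits_diff: "y \<in> {0..<1} \<Longrightarrow> k \<le> l \<Longrightarrow> pabs (of_nat (digits p l y) - of_nat (digits p k y)) \<le> 1 / real p ^ k"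
  unfolding pabs_of_nat_diff_le_iff using digits_mod[of y p k l] digits_less[of y p k] p_gt_1 by simp

lemma digits_cauchy:
  assumes y: "y \<in> {0..<1}" shows "(\<lambda>k. of_nat (digits p k y)) \<in> C"
proof (rule cauchyI)
  fix e :: real assume "e > 0"
  then obtain k where k: "1 / real p ^ k < e" by (rule inverse_power_less)
  have "pabs (of_nat (digits p m y) - of_nat (digits p n y)) < e" if "m \<ge> k" "n \<ge> k" for m n
  proof -
    have "pabs (of_nat (digits p m y) - of_nat (digits p n y)) \<le>
        max (pabs (of_nat (digits p m y) - of_nat (digits p k y))) (pabs (of_nat (digits p k y) - of_nat (digits p n y)))"
      by (rule pabs_diff_triangle)
    also have "\<dots> \<le> 1 / real p ^ k"
      using pabs_digits_diff[OF y that(1)] pabs_digits_diff[OF y that(2)] by (simp add: pabs_diff_commute[of "of_nat (digits p k y)"])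
    finally show ?thesis using k by simp
  qed
  then show "\<exists>k. \<forall>m\<ge>k. \<forall>n\<ge>k. pabs (of_nat (digits p m y) - of_nat (digits p n y)) < e" by blast
qed

lemma expansion_near_digits:
  assumes y: "y \<in> {0..<1}" shows "pdist (expansion y) (rat_emb (of_nat (digits p k y))) \<le> 1 / real p ^ k"
proof -
  have "(\<lambda>l. pabs (of_nat (digits p l y) - of_nat (digits p k y))) \<longlonglongrightarrow> pdist (expansion y) (rat_emb (of_nat (digits p k y)))"
    unfolding expansion_def of_rat_eq using digits_cauchy[OF y] by (intro pdist_cls) auto
  then show ?thesis by (rule LIMSEQ_le_const2) (use pabs_digits_diff[OF y] in blast)
qed

lemma expansion_carrier: "y \<in> {0..<1} \<Longrightarrow> expansion y \<in> carrier Q"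
  unfolding expansion_def using digits_cauchy by simp

lemma expansion_Zp: assumes "y \<in> {0..<1}" shows "expansion y \<in> Z"
  using expansion_near_digits[OF assms, of 0] expansion_carrier[OF assms] by (simp add: Zp_iff)

lemma expansion_residue_ball: "y \<in> {0..<1} \<Longrightarrow> expansion y \<in> residue_ball k (digits p k y)"
  using expansion_near_digits expansion_Zp by (simp add: residue_ball_def)

lemma expansion_in_residue_ball_iff:
  assumes "y \<in> {0..<1}" "j < p ^ k"
  shows "expansion y \<in> residue_ball k j \<longleftrightarrow> digits p k y = j"
proof
  assume "expansion y \<in> residue_ball k j"
  then have "j mod p ^ k = digits p k y mod p ^ k"
    using expansion_residue_ball[OF assms(1), of k] by (rule residue_ball_unique)
  then show "digits p k y = j" using assms digits_less[OF assms(1), of p k] p_gt_1 by simp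
next
  assume "digits p k y = j"
  then show "expansion y \<in> residue_ball k j" using expansion_residue_ball[OF assms(1)] by blast
qed

lemma expansion_vimage_residue_ball:
  "j < p ^ k \<Longrightarrow> expansion -` residue_ball k j \<inter> {0..<1} = {y \<in> {0..<1}. digits p k y = j}"
  using expansion_in_residue_ball_iff by auto

lemma expansion_measurable [measurable]: "expansion \<in> measurable circle_measure borel_Zp"
  unfolding borel_Zp_def
proof (rule measurable_measure_of[OF ball_system_Pow])
  show "expansion \<in> space circle_measure \<rightarrow> Z" using expansion_Zp by (simp add: Pi_iff)
  fix B assume "B \<in> ball_system"
  then consider "B = {}" | k j where "B = residue_ball k j" by (auto simp: ball_system_def)
  then show "expansion -` B \<inter> space circle_measure \<in> sets circle_measure"
  proof cases
    case 2
    \<comment> \<open>Centres of balls are arbitrary naturals, whereas the first k digits form a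
      number below p^k.\<close>
    have "j mod p ^ k < p ^ k" using p_gt_1 by simp
    then show ?thesis
      using expansion_vimage_residue_ball[of "j mod p ^ k" k] digits_vimage_sets[of p k "j mod p ^ k"]
      by (simp only: 2 residue_ball_mod space_circle)
  qed simp
qed

definition haar :: "(nat \<Rightarrow> rat) set measure" where
  "haar = distr circle_measure borel_Zp expansion"

lemma sets_haar [simp]: "sets haar = sets borel_Zp" by (simp add: haar_def)

lemma space_haar [simp]: "space haar = Z" by (simp add: haar_def)

lemma emeasure_haar: "B \<in> sets borel_Zp \<Longrightarrow> emeasure haar B = emeasure circle_measure (expansion -` B \<inter> {0..<1})"
  by (simp add: haar_def emeasure_distr)

lemma emeasure_haar_residue_ball: "emeasure haar (residue_ball k j) = ennreal (1 / real p ^ k)"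
proof -
  interpret finite_measure circle_measure by (rule finite_measure_circle)
  have j: "j mod p ^ k < p ^ k" using p_gt_1 by simp
  have "emeasure haar (residue_ball k j) = emeasure circle_measure {y \<in> {0..<1}. digits p k y = j mod p ^ k}"
    using expansion_vimage_residue_ball[OF j] by (simp add: emeasure_haar residue_ball_mod)
  also have "\<dots> = ennreal (1 / real p ^ k)"
    using measure_digits_eq[OF _ j] p_gt_1 by (simp add: emeasure_eq_measure)
  finally show ?thesis .
qed

lemma emeasure_haar_Zp: "emeasure haar Z = 1"
proof -
  have "expansion -` Z \<inter> {0..<1} = {0..<1}" by (intro Int_absorb1 subsetI vimageI2 expansion_Zp)
  moreover have "Z \<in> sets borel_Zp" using sets.top[of borel_Zp] by simp
  ultimately show ?thesis using prob_space_circle by (simp add: emeasure_haar)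
qed

lemma Zp_residue_ball_0: "residue_ball 0 j = Z"
  using Zp_pdist_le_1 by (auto simp: residue_ball_def)

lemma residue_ball_translate:
  assumes "y \<in> Z" "x \<in> Z" "x \<oplus>\<^bsub>Q\<^esub> y \<in> residue_ball k i" "x \<in> residue_ball k j"
  shows "(\<lambda>x. x \<oplus>\<^bsub>Q\<^esub> y) ` residue_ball k j = residue_ball k i"
proof -
  interpret Qr: ring Q by (rule Q_ring)
  have c: "x \<in> carrier Q" "y \<in> carrier Q" using assms(1,2) by (simp_all add: Zp_iff)
  show ?thesis
  proof (intro equalityI subsetI)
    fix z assume "z \<in> (\<lambda>x. x \<oplus>\<^bsub>Q\<^esub> y) ` residue_ball k j"
    then obtain w where w: "w \<in> residue_ball k j" "z = w \<oplus>\<^bsub>Q\<^esub> y" by blast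
    have wc: "w \<in> Z" using w(1) residue_ball_subset by blast
    then have "pdist (x \<oplus>\<^bsub>Q\<^esub> y) z = pdist x w" using c w(2) by (simp add: pdist_add_right Zp_iff)
    also have "\<dots> \<le> 1 / real p ^ k" by (rule residue_ball_dist[OF assms(4) w(1)])
    finally show "z \<in> residue_ball k i"
      using residue_ball_cong[OF assms(3) _ order_refl, of z] Zp_add[OF wc assms(1)] w(2) by simp
  next
    fix z assume z: "z \<in> residue_ball k i"
    then have zc: "z \<in> carrier Q" by (simp add: residue_ball_def Zp_iff)
    define w where "w = z \<ominus>\<^bsub>Q\<^esub> y"
    have wc: "w \<in> carrier Q" using zc c by (simp add: w_def)
    have zw: "z = w \<oplus>\<^bsub>Q\<^esub> y" using zc c by (simp add: w_def a_minus_def Qr.a_assoc Qr.l_neg)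
    have "pdist w x = pdist z (x \<oplus>\<^bsub>Q\<^esub> y)" using pdist_add_right[OF wc c] zw by simp
    also have "\<dots> \<le> 1 / real p ^ k" by (rule residue_ball_dist[OF z assms(3)])
    finally have wx: "pdist w x \<le> 1 / real p ^ k" .
    moreover have "1 / real p ^ k \<le> 1" using p_gt_1 by (simp add: field_simps)
    ultimately have "w \<in> Z" using Zp_if_close[OF wc assms(2)] by simp
    then have "w \<in> residue_ball k j" using residue_ball_eq[OF assms(2,4)] wx by simp
    then show "z \<in> (\<lambda>x. x \<oplus>\<^bsub>Q\<^esub> y) ` residue_ball k j" using zw by blast
  qed
qed

lemma residue_ball_translate_ex:
  assumes "y \<in> Z" obtains i where "(\<lambda>x. x \<oplus>\<^bsub>Q\<^esub> y) ` residue_ball k j = residue_ball k i"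
proof -
  let ?x = "rat_emb (of_nat j)"
  have x: "?x \<in> residue_ball k j" using p_gt_1 by (simp add: residue_ball_def pdist_rat)
  have "?x \<oplus>\<^bsub>Q\<^esub> y \<in> Z" by (rule Zp_add[OF rat_emb_nat_Zp assms])
  then obtain i where i: "?x \<oplus>\<^bsub>Q\<^esub> y \<in> residue_ball k i" by (rule Zp_residue)
  show thesis by (rule that[OF residue_ball_translate[OF assms rat_emb_nat_Zp i x]])
qed

text \<open>The balls form an intersection-stable generator that contains the whole space as the
  ball of level 0.\<close>

lemma measure_eq_on_balls:
  assumes "sets \<mu> = sets borel_Zp" "sets \<nu> = sets borel_Zp" "emeasure \<mu> Z \<noteq> \<infinity>"
    and "\<And>k j. emeasure \<mu> (residue_ball k j) = emeasure \<nu> (residue_ball k j)"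
  shows "\<mu> = \<nu>"
proof (rule measure_eqI_generator_eq[OF Int_stable_ball_system ball_system_Pow, where A = "\<lambda>_. Z"])
  show "emeasure \<mu> B = emeasure \<nu> B" if "B \<in> ball_system" for B
    using that assms(4) by (auto simp: ball_system_def)
  show "sets \<mu> = sigma_sets Z ball_system" "sets \<nu> = sigma_sets Z ball_system"
    using assms(1,2) by (simp_all add: sets_borel_Zp)
  have "Z \<in> ball_system" unfolding ball_system_def using Zp_residue_ball_0[of 0] by auto
  then show "range (\<lambda>_. Z) \<subseteq> ball_system" by blast
qed (use assms(3) in auto)

lemma borel_Zp_eq: "sets borel_Zp = sigma_sets (Zp p) {U. openin (Metric_space.mtopology (Zp p) (padic_dist p)) U}"
  by (simp add: sets_borel_Zp sigma_sets_opens[symmetric] opens_def)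

text \<open>The image under translation is a preimage under the subtraction \<open>\<tau>\<close>,
  so the claim concerns the image measure under \<open>\<tau>\<close>. It agrees with
  \<open>haar\<close> on balls, because preimages of balls are balls of the same level and the
  measure of a ball depends on its level only.\<close>

lemma haar_translate:
  assumes y: "y \<in> Z" and S: "S \<in> sets borel_Zp"
  shows "emeasure haar ((\<lambda>x. x \<oplus>\<^bsub>Q\<^esub> y) ` S) = emeasure haar S"
proof -
  interpret Qr: ring Q by (rule Q_ring)
  have yc: "y \<in> carrier Q" using y by (rule Zp_carrier)
  define \<tau> where "\<tau> = (\<lambda>x. x \<ominus>\<^bsub>Q\<^esub> y)"
  have \<tau>c: "\<tau> x \<in> carrier Q" "\<tau> x \<oplus>\<^bsub>Q\<^esub> y = x" if "x \<in> carrier Q" for x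
    using that yc by (simp_all add: \<tau>_def a_minus_def Qr.a_assoc Qr.l_neg)
  have \<tau>_add: "\<tau> (x \<oplus>\<^bsub>Q\<^esub> y) = x" if "x \<in> carrier Q" for x
    using that yc by (simp add: \<tau>_def a_minus_def Qr.a_assoc Qr.r_neg)
  have \<tau>Z: "\<tau> x \<in> Z" if x: "x \<in> Z" for x
  proof (rule Zp_if_close[of _ "rat_emb 0"])
    have xc: "x \<in> carrier Q" using x by (rule Zp_carrier)
    show "\<tau> x \<in> carrier Q" using \<tau>c(1)[OF xc] .
    have "rat_emb 0 \<oplus>\<^bsub>Q\<^esub> y = y"
    proof -
      obtain Y where Y: "Y \<in> C" "y = cls Y" using yc by (rule carrier_cases)
      then show ?thesis by (simp add: of_rat_eq cls_add)
    qed
    then have "pdist (\<tau> x) (rat_emb 0) = pdist x y"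
      using pdist_add_right[OF \<tau>c(1)[OF xc] rat_emb_carrier yc, of 0] \<tau>c(2)[OF xc] by simp
    then show "pdist (\<tau> x) (rat_emb 0) \<le> 1" using Zp_pdist_le_1[OF x y] by simp
  qed (simp add: rat_emb_Zp_iff)
  have im: "(\<lambda>x. x \<oplus>\<^bsub>Q\<^esub> y) ` T = \<tau> -` T \<inter> Z" if "T \<subseteq> Z" for T
  proof (intro equalityI subsetI)
    fix z assume "z \<in> (\<lambda>x. x \<oplus>\<^bsub>Q\<^esub> y) ` T"
    then obtain x where x: "x \<in> T" "z = x \<oplus>\<^bsub>Q\<^esub> y" by blast
    then have "x \<in> Z" using that by blast
    then show "z \<in> \<tau> -` T \<inter> Z" using x \<tau>_add[OF Zp_carrier] Zp_add[OF _ y] by simp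
  next
    fix z assume z: "z \<in> \<tau> -` T \<inter> Z"
    then have "z = \<tau> z \<oplus>\<^bsub>Q\<^esub> y" using \<tau>c(2)[OF Zp_carrier] by simp
    then show "z \<in> (\<lambda>x. x \<oplus>\<^bsub>Q\<^esub> y) ` T" using z by blast
  qed
  have ball: "\<exists>i. \<tau> -` residue_ball k j \<inter> Z = residue_ball k i" for k j
    using residue_ball_translate_ex[OF y, of k j] im[OF residue_ball_subset] by metis
  have \<tau>_meas: "\<tau> \<in> measurable haar borel_Zp"
    unfolding borel_Zp_def
  proof (rule measurable_measure_of[OF ball_system_Pow])
    show "\<tau> \<in> space haar \<rightarrow> Z" using \<tau>Z by simp
    fix B assume "B \<in> ball_system"
    then consider "B = {}" | k j where "B = residue_ball k j" by (auto simp: ball_system_def)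
    then show "\<tau> -` B \<inter> space haar \<in> sets haar"
    proof cases
      case 2
      then show ?thesis using ball[of k j] residue_ball_sets by auto
    qed simp
  qed
  have "haar = distr haar borel_Zp \<tau>"
  proof (rule measure_eq_on_balls)
    fix k j
    obtain i where i: "\<tau> -` residue_ball k j \<inter> Z = residue_ball k i" using ball by blast
    have "emeasure (distr haar borel_Zp \<tau>) (residue_ball k j) = emeasure haar (residue_ball k i)"
      using emeasure_distr[OF \<tau>_meas residue_ball_sets, of k j] i by simp
    then show "emeasure haar (residue_ball k j) = emeasure (distr haar borel_Zp \<tau>) (residue_ball k j)"
      by (simp add: emeasure_haar_residue_ball)
  qed (simp_all add: emeasure_haar_Zp)
  then have "emeasure haar S = emeasure (distr haar borel_Zp \<tau>) S" by simp
  also have "\<dots> = emeasure haar (\<tau> -` S \<inter> Z)" using emeasure_distr[OF \<tau>_meas S] by simp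
  also have "\<tau> -` S \<inter> Z = (\<lambda>x. x \<oplus>\<^bsub>Q\<^esub> y) ` S" using im[of S] sets.sets_into_space[OF S] by simp
  finally show ?thesis by simp
qed

lemma is_haar_prob_haar: "is_haar_prob_Zp p haar"
  unfolding is_haar_prob_Zp_def using emeasure_haar_Zp haar_translate borel_Zp_eq by simp

text \<open>The p^k balls of level k are translates of each other and tile the space, so invariance
  forces the value p^-k on each. Uniqueness is what identifies the description in
  \<open>haar_Zp\<close> with the image measure \<open>haar\<close>.\<close>

lemma haar_unique:
  assumes "is_haar_prob_Zp p \<mu>" shows "\<mu> = haar"
proof (rule measure_eq_on_balls)
  show sets: "sets \<mu> = sets borel_Zp" using assms by (simp add: is_haar_prob_Zp_def borel_Zp_eq)
  have one: "emeasure \<mu> Z = 1" using assms by (simp add: is_haar_prob_Zp_def)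
  then show "emeasure \<mu> Z \<noteq> \<infinity>" by simp
  have space: "space \<mu> = Z" using sets_eq_imp_space_eq[OF sets] by simp
  interpret finite_measure \<mu> by (rule finite_measureI) (simp add: space one)
  fix k j
  have same: "measure \<mu> (residue_ball k i) = measure \<mu> (residue_ball k 0)" for i
  proof -
    let ?y = "rat_emb (of_nat i)"
    have 0: "rat_emb 0 \<in> residue_ball k 0" using p_gt_1 by (simp add: residue_ball_def pdist_rat rat_emb_Zp_iff)
    have i: "?y \<in> residue_ball k i" using p_gt_1 by (simp add: residue_ball_def pdist_rat)
    have "(\<lambda>x. x \<oplus>\<^bsub>Q\<^esub> ?y) ` residue_ball k 0 = residue_ball k i"
      by (rule residue_ball_translate[OF _ _ _ 0]) (use i in \<open>simp_all add: rat_emb_add rat_emb_Zp_iff\<close>)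
    moreover have "emeasure \<mu> ((\<lambda>x. x \<oplus>\<^bsub>Q\<^esub> ?y) ` residue_ball k 0) = emeasure \<mu> (residue_ball k 0)"
    proof -
      have "\<forall>y\<in>Z. \<forall>S\<in>sets \<mu>. emeasure \<mu> ((\<lambda>x. x \<oplus>\<^bsub>Q\<^esub> y) ` S) = emeasure \<mu> S"
        using assms unfolding is_haar_prob_Zp_def by blast
      moreover have "residue_ball k 0 \<in> sets \<mu>" by (simp add: sets)
      ultimately show ?thesis using rat_emb_nat_Zp[of i] by blast
    qed
    ultimately show ?thesis by (simp add: measure_def)
  qed
  have "Z = (\<Union>i\<in>{..<p ^ k}. residue_ball k i)"
  proof
    show "Z \<subseteq> (\<Union>i\<in>{..<p ^ k}. residue_ball k i)"
    proof
      fix x assume "x \<in> Z"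
      then obtain i where "i < p ^ k" "x \<in> residue_ball k i" by (rule Zp_residue)
      then show "x \<in> (\<Union>i\<in>{..<p ^ k}. residue_ball k i)" by blast
    qed
  qed (use residue_ball_subset in blast)
  then have "measure \<mu> Z = measure \<mu> (\<Union>i\<in>{..<p ^ k}. residue_ball k i)" by simp
  also have "\<dots> = (\<Sum>i\<in>{..<p ^ k}. measure \<mu> (residue_ball k i))"
  proof (rule finite_measure_finite_Union)
    show "disjoint_family_on (residue_ball k) {..<p ^ k}"
      unfolding disjoint_family_on_def
    proof (intro ballI impI)
      fix i i' assume i: "i \<in> {..<p ^ k}" "i' \<in> {..<p ^ k}" "i \<noteq> i'"
      then have "i mod p ^ k \<noteq> i' mod p ^ k" by simp
      then show "residue_ball k i \<inter> residue_ball k i' = {}" using residue_ball_unique[of _ k i i'] by blast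
    qed
    show "residue_ball k ` {..<p ^ k} \<subseteq> sets \<mu>"
      unfolding sets by (rule image_subsetI) (rule residue_ball_sets)
  qed simp
  also have "\<dots> = (\<Sum>i\<in>{..<p ^ k}. measure \<mu> (residue_ball k 0))" by (intro sum.cong refl same)
  also have "\<dots> = real p ^ k * measure \<mu> (residue_ball k 0)" by simp
  finally have "real p ^ k * measure \<mu> (residue_ball k 0) = 1" using one by (simp add: measure_def)
  then have "measure \<mu> (residue_ball k j) = 1 / real p ^ k"
    using p_gt_1 by (simp add: same[of j] field_simps)
  then show "emeasure \<mu> (residue_ball k j) = emeasure haar (residue_ball k j)"
    by (simp add: emeasure_eq_measure emeasure_haar_residue_ball)
qed simp

lemma haar_Zp_eq: "haar_Zp p = haar"
  unfolding haar_Zp_def using is_haar_prob_haar haar_unique by (rule the_equality)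

text \<open>The distance to c is locally constant away from c, hence the complement is open. The
  centre may lie outside the \<open>p\<close>-adic integers, as a/n does if p divides n.\<close>

lemma closed_ball_sets:
  assumes c: "c \<in> carrier Q" shows "{x \<in> Z. pdist x c \<le> r} \<in> sets borel_Zp"
proof -
  have "{x \<in> Z. pdist x c > r} \<in> opens"
    unfolding opens_iff
  proof (intro conjI ballI)
    fix x assume "x \<in> {x \<in> Z. pdist x c > r}"
    then have x: "x \<in> Z" "pdist x c > r" "x \<in> carrier Q" by (simp_all add: Zp_iff)
    show "\<exists>e>0. \<forall>y\<in>Z. pdist x y < e \<longrightarrow> y \<in> {x \<in> Z. pdist x c > r}"
    proof (cases "pdist x c = 0")
      case True
      then have "r < 0" using x(2) by simp
      then have "pdist y c > r" if "y \<in> Z" for y using pdist_nonneg[OF Zp_carrier[OF that] c] by simp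
      then show ?thesis by (intro exI[of _ 1]) auto
    next
      case False
      then have pos: "pdist x c > 0" using pdist_nonneg[OF x(3) c] by simp
      have "pdist y c = pdist x c" if "y \<in> Z" "pdist x y < pdist x c" for y
        using pdist_isosceles[of y x c] that c x pdist_commute[of x y] by (simp add: Zp_iff)
      then show ?thesis using pos x(2) by (intro exI[of _ "pdist x c"]) auto
    qed
  qed auto
  then have "Z - {x \<in> Z. pdist x c > r} \<in> sets borel_Zp"
    using sets.compl_sets[OF opens_sets] by simp
  moreover have "Z - {x \<in> Z. pdist x c > r} = {x \<in> Z. pdist x c \<le> r}" by auto
  ultimately show ?thesis by simp
qed

section \<open>Approximation sets in digit coordinates\<close>

lemma padic_approx_set_eq:
  "padic_approx_set p \<psi> n = (\<Union>a\<in>signed_totatives n. {x \<in> Z. pdist x (rat_emb (of_int a / of_nat n)) \<le> \<psi> n})"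
  by (simp add: padic_approx_set_def signed_totatives_def)

lemma padic_approx_set_sets [measurable]: "padic_approx_set p \<psi> n \<in> sets borel_Zp"
  unfolding padic_approx_set_eq by (intro sets.finite_UN closed_ball_sets) auto

lemma pabs_of_nat_coprime: "coprime p n \<Longrightarrow> n > 0 \<Longrightarrow> pabs (of_nat n) = 1"
proof -
  assume n: "coprime p n" "n > 0"
  have "\<not> p dvd n" using n(1) prime_p by (metis coprime_absorb_left not_prime_unit)
  then have "multiplicity (int p) (int n) = 0" by (intro not_dvd_imp_multiplicity_0) simp
  then show ?thesis using pabs_of_int[of "int n"] n(2) by simp
qed

text \<open>By the ultrametric inequality the expansion may be replaced by its first k digits, and
  multiplication by n, a unit, turns the distance into that of two integers.\<close>

lemma expansion_pdist_le_iff: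
  assumes "coprime p n" "n > 0" "y \<in> {0..<1}"
  shows "pdist (expansion y) (rat_emb (of_int a / of_nat n)) \<le> 1 / real p ^ k \<longleftrightarrow>
    int (p ^ k) dvd int n * int (digits p k y) - a"
proof -
  let ?d = "rat_emb (of_nat (digits p k y))" and ?q = "rat_emb (of_int a / of_nat n)"
  have c: "expansion y \<in> carrier Q" by (rule expansion_carrier[OF assms(3)])
  have near: "pdist (expansion y) ?d \<le> 1 / real p ^ k" by (rule expansion_near_digits[OF assms(3)])
  have "pdist (expansion y) ?q \<le> 1 / real p ^ k \<longleftrightarrow> pdist ?d ?q \<le> 1 / real p ^ k"
    using pdist_triangle[of "expansion y" ?d ?q] pdist_triangle[of ?d "expansion y" ?q] pdist_commute[of "expansion y" ?d] near c
    by (auto simp: max_def split: if_splits)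
  also have "pdist ?d ?q = pabs (of_nat n) * pabs (of_nat (digits p k y) - of_int a / of_nat n)"
    using pabs_of_nat_coprime[OF assms(1,2)] by (simp add: pdist_rat)
  also have "\<dots> = pabs (of_int (int n * int (digits p k y) - a))"
    using assms(2) by (simp add: pabs_mult[symmetric] right_diff_distrib)
  finally show ?thesis by (simp only: pabs_of_int_le_iff)
qed

lemma hit_subset_vimage:
  assumes "coprime p n" "n > 0" "1 / real p ^ k \<le> \<psi> n"
  shows "hit p k n \<subseteq> expansion -` padic_approx_set p \<psi> n"
proof
  fix y assume "y \<in> hit p k n"
  then obtain a where y: "y \<in> {0..<1}" and a: "a \<in> signed_totatives n" "int (p ^ k) dvd int n * int (digits p k y) - a"
    by (auto simp: hit_def)
  have "pdist (expansion y) (rat_emb (of_int a / of_nat n)) \<le> \<psi> n"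
    using expansion_pdist_le_iff[OF assms(1,2) y] a(2) assms(3) by (meson order_trans)
  then show "y \<in> expansion -` padic_approx_set p \<psi> n"
    using a(1) expansion_Zp[OF y] unfolding padic_approx_set_eq by blast
qed

lemma vimage_subset_hit:
  assumes "coprime p n" "n > 0" "k > 0 \<Longrightarrow> \<psi> n < 1 / real p ^ (k - 1)"
  shows "expansion -` padic_approx_set p \<psi> n \<inter> {0..<1} \<subseteq> hit p k n"
proof
  fix y assume "y \<in> expansion -` padic_approx_set p \<psi> n \<inter> {0..<1}"
  then obtain a where y: "y \<in> {0..<1}" and a: "a \<in> signed_totatives n" "pdist (expansion y) (rat_emb (of_int a / of_nat n)) \<le> \<psi> n"
    unfolding padic_approx_set_eq by blast
  have "pdist (expansion y) (rat_emb (of_int a / of_nat n)) \<le> 1 / real p ^ k"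
  proof (cases k)
    case 0
    \<comment> \<open>At level 0 the congruence is void, whatever the size of the radius.\<close>
    have "int (p ^ 0) dvd int n * int (digits p 0 y) - a" by simp
    then show ?thesis using expansion_pdist_le_iff[OF assms(1,2) y, of a 0] 0 by simp
  next
    case (Suc l)
    then have "pdist (expansion y) (rat_emb (of_int a / of_nat n)) < 1 / real p ^ l"
      using a(2) assms(3) by simp
    then show ?thesis using pdist_discrete[OF expansion_carrier[OF y] rat_emb_carrier] Suc by simp
  qed
  then show "y \<in> hit p k n" using expansion_pdist_le_iff[OF assms(1,2) y] a(1) y by (auto simp: hit_def)
qed

text \<open>If p divides n, every reduced a/n has absolute value v = 1/|n|_p > 1, and so by the
  isosceles property distance v from every \<open>p\<close>-adic integer. Only the comparison of v
  with the radius matters.\<close>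

lemma padic_approx_set_dvd:
  assumes "p dvd n" "n > 0"
  shows "padic_approx_set p \<psi> n = {} \<or> padic_approx_set p \<psi> n = Z"
proof -
  define v where "v = 1 / pabs (of_nat n)"
  have An: "pabs (of_nat n) > 0" using assms(2) by (intro pabs_pos) simp
  have "pabs (of_nat n) \<le> 1 / real p ^ 1" using pabs_of_int_le_iff[of "int n" 1] assms(1) by simp
  also have "\<dots> < 1" using p_gt_1 by simp
  finally have v1: "v > 1" using An by (simp add: v_def)
  have Nv: "pdist x (rat_emb (of_int a / of_nat n)) = v" if x: "x \<in> Z" and a: "a \<in> signed_totatives n" for x a
  proof -
    have "\<not> int p dvd a"
      using a assms(1) prime_int_p by (auto simp: signed_totatives_def dest!: coprime_common_divisor[of a "int n" "int p"])
    then have "multiplicity (int p) a = 0" "a \<noteq> 0" by (auto intro: not_dvd_imp_multiplicity_0)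
    then have "pabs (of_int a) = 1" by (simp add: pabs_of_int)
    then have "pabs (of_int a / of_nat n) = v" using pabs_of_int_divide[of "int n" a] assms(2) by (simp add: v_def)
    then have "pdist (rat_emb 0) (rat_emb (of_int a / of_nat n)) = v" by (simp add: pdist_rat)
    then show ?thesis using pdist_isosceles[of x "rat_emb 0" "rat_emb (of_int a / of_nat n)"] x v1 by (simp add: Zp_iff)
  qed
  have "1 \<in> signed_totatives n" using assms(2) by (simp add: signed_totatives_def)
  then show ?thesis using Nv unfolding padic_approx_set_eq by (cases "v \<le> \<psi> n") auto
qed

section \<open>Approximation sets in the $p$-adic integers\<close>

lemma measure_haar: "B \<in> sets borel_Zp \<Longrightarrow> measure haar B = measure circle_measure (expansion -` B \<inter> {0..<1})"
  by (simp add: measure_def emeasure_haar)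

lemma finite_measure_haar: "finite_measure haar"
  by (rule finite_measureI) (simp add: emeasure_haar_Zp)

lemma limsup_set_sets: "padic_limsup_set p \<psi> \<in> sets borel_Zp"
proof -
  have "padic_limsup_set p \<psi> = {x \<in> space borel_Zp. \<forall>K. \<exists>n>K. 1 \<le> n \<and> x \<in> padic_approx_set p \<psi> n}"
    by (simp add: padic_limsup_set_def infinite_nat_iff_unbounded)
  also have "\<dots> \<in> sets borel_Zp" by measurable
  finally show ?thesis .
qed

lemma limsup_set_eq: "padic_limsup_set p \<psi> = limsup (\<lambda>n. padic_approx_set p \<psi> (Suc n))"
proof -
  have sub: "padic_approx_set p \<psi> n \<subseteq> Z" for n unfolding padic_approx_set_eq by blast
  have "infinite {n. 1 \<le> n \<and> x \<in> padic_approx_set p \<psi> n} \<longleftrightarrow> (\<forall>K. \<exists>n\<ge>K. x \<in> padic_approx_set p \<psi> (Suc n))" for x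
  proof -
    have "{n. 1 \<le> n \<and> x \<in> padic_approx_set p \<psi> n} = Suc ` {n. x \<in> padic_approx_set p \<psi> (Suc n)}"
    proof (intro equalityI subsetI)
      fix n assume "n \<in> {n. 1 \<le> n \<and> x \<in> padic_approx_set p \<psi> n}"
      then show "n \<in> Suc ` {n. x \<in> padic_approx_set p \<psi> (Suc n)}" by (intro image_eqI[of _ _ "n - 1"]) auto
    qed auto
    then show ?thesis by (simp add: finite_image_iff infinite_nat_iff_unbounded_le)
  qed
  moreover have "limsup (\<lambda>n. padic_approx_set p \<psi> (Suc n)) = {x. \<forall>K. \<exists>n\<ge>K. x \<in> padic_approx_set p \<psi> (Suc n)}"
    unfolding limsup_INF_SUP by auto
  moreover have "{x. \<forall>K. \<exists>n\<ge>K. x \<in> padic_approx_set p \<psi> (Suc n)} \<subseteq> Z" using sub by blast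
  ultimately show ?thesis unfolding padic_limsup_set_def by blast
qed

lemma limsup_set_null:
  assumes "(\<Sum>n. emeasure haar (padic_approx_set p \<psi> (Suc n))) \<noteq> \<infinity>"
  shows "emeasure haar (padic_limsup_set p \<psi>) = 0"
proof -
  interpret finite_measure haar by (rule finite_measure_haar)
  have "(\<Sum>n. ennreal (measure haar (padic_approx_set p \<psi> (Suc n)))) \<noteq> \<infinity>"
    using assms by (simp add: emeasure_eq_measure)
  then have "summable (\<lambda>n. measure haar (padic_approx_set p \<psi> (Suc n)))"
    by (intro summable_suminf_not_top) (auto simp: infinity_ennreal_def)
  then have "limsup (\<lambda>n. padic_approx_set p \<psi> (Suc n)) \<in> null_sets haar"
    by (intro borel_cantelli_limsup1) (auto simp: less_top[symmetric])
  then show ?thesis by (simp add: limsup_set_eq null_sets_def)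
qed

lemma measure_hit_le:
  assumes "coprime p n" "n > 0"
  shows "measure circle_measure (hit p k n) \<le> 3 * real (totient n) / real p ^ k"
proof -
  have "hit p k n = (\<Union>a\<in>signed_totatives n. near p k n a)" by (auto simp: hit_def near_def)
  then have "measure circle_measure (hit p k n) \<le> (\<Sum>a\<in>signed_totatives n. measure circle_measure (near p k n a))"
    using near_sets by (simp only:) (intro measure_UNION_le; simp)
  also have "\<dots> = real (card (signed_totatives n)) / real p ^ k"
    using measure_near[OF _ assms(1)] p_gt_1 by simp
  also have "\<dots> \<le> real (3 * totient n) / real p ^ k"
    using card_signed_totatives_le[OF assms(2)] by (intro divide_right_mono) (simp_all only: of_nat_le_iff zero_le_power of_nat_0_le_iff)
  finally show ?thesis by simp
qed

text \<open>Capping the levels from below makes the radii tend to \<open>0\<close>, and \<open>n \<le> 4 \<phi>(n)\<^sup>2\<close> ensures that the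
  divergence of the measures is preserved.\<close>

definition cap_level :: "nat \<Rightarrow> nat" where
  "cap_level n = Max {k. (p ^ k)\<^sup>2 \<le> n}"

lemma cap_level:
  assumes "n > 0"
  shows "(p ^ cap_level n)\<^sup>2 \<le> n" "(p ^ K)\<^sup>2 \<le> n \<Longrightarrow> K \<le> cap_level n"
proof -
  let ?S = "{k. (p ^ k)\<^sup>2 \<le> n}"
  have "?S \<subseteq> {..n}"
  proof
    fix k assume "k \<in> ?S"
    then have k: "(p ^ k)\<^sup>2 \<le> n" by simp
    have "k < p ^ k" using power_gt_expt[of p k] p_gt_1 by simp
    also have "p ^ k \<le> (p ^ k)\<^sup>2" using p_gt_1 by (intro self_le_power) auto
    finally show "k \<in> {..n}" using k by simp
  qed
  then have fin: "finite ?S" by (rule finite_subset) simp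
  have "0 \<in> ?S" using assms by simp
  then have "Max ?S \<in> ?S" using fin by (intro Max_in) blast+
  then show "(p ^ cap_level n)\<^sup>2 \<le> n" by (simp add: cap_level_def)
  show "(p ^ K)\<^sup>2 \<le> n \<Longrightarrow> K \<le> cap_level n" unfolding cap_level_def using fin by (intro Max_ge) auto
qed

text \<open>Hence an index whose level is raised to \<open>cap_level n\<close> contributes at least
  1/2 to the series of phi(n)/p^(\<open>\<kappa> n\<close>).\<close>

lemma totient_cap_level: "n > 0 \<Longrightarrow> p ^ cap_level n \<le> 2 * totient n"
proof -
  assume "n > 0"
  then have "(p ^ cap_level n)\<^sup>2 \<le> 4 * (totient n)\<^sup>2"
    using cap_level(1) le_totient_square[of n] order_trans by blast
  also have "4 * (totient n)\<^sup>2 = (2 * totient n)\<^sup>2" by (simp add: power_mult_distrib)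
  finally show ?thesis by (rule power2_le_imp_le) simp
qed

text \<open>The measure of E_n is bounded by a multiple of phi(n)/p^(\<open>\<kappa> n\<close>) for
  n prime to p, so that series diverges and the result on the circle applies. Levels are only
  raised, never lowered, so each ball used lies in the original one and every point found belongs to
  the original limsup set.\<close>

lemma limsup_set_full:
  assumes QIA: "QIA_infty" and \<psi>: "\<forall>n\<ge>1. \<psi> n \<ge> 0"
    and div: "(\<Sum>n. emeasure haar (padic_approx_set p \<psi> (Suc n))) = \<infinity>"
  shows "emeasure haar (padic_limsup_set p \<psi>) = 1"
\<comment> \<open>For p dividing n the set E_n is empty or everything. Infinitely many full sets
  decide the claim at once; finitely many do not affect divergence.\<close>
proof (cases "infinite {n. n \<ge> 1 \<and> p dvd n \<and> padic_approx_set p \<psi> n = Z}")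
  case True
  have "padic_limsup_set p \<psi> = Z"
  proof -
    have "infinite {n. 1 \<le> n \<and> x \<in> padic_approx_set p \<psi> n}" if "x \<in> Z" for x
      by (rule infinite_super[OF _ True]) (use that in auto)
    then show ?thesis by (auto simp: padic_limsup_set_def)
  qed
  then show ?thesis by (simp add: emeasure_haar_Zp)
next
  case fin: False
  interpret H: finite_measure haar by (rule finite_measure_haar)
  interpret C: finite_measure circle_measure by (rule finite_measure_circle)
  let ?E = "padic_approx_set p \<psi>"
  define S where "S = {n. n \<ge> 1 \<and> coprime p n \<and> \<psi> n > 0}"
  have S: "n > 0 \<and> coprime p n" if "n \<in> S" for n using that by (auto simp: S_def)
  \<comment> \<open>The least k with p^-k at most the radius; by discreteness of the distance, balls
    of radius p^-k then capture the whole approximation set.\<close>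
  define k where "k = (\<lambda>n. LEAST k. 1 / real p ^ k \<le> \<psi> n)"
  have k: "1 / real p ^ k n \<le> \<psi> n" "k n > 0 \<Longrightarrow> \<psi> n < 1 / real p ^ (k n - 1)" if "n \<in> S" for n
  proof -
    have "\<psi> n > 0" using that by (simp add: S_def)
    then obtain i where i: "1 / real p ^ i < \<psi> n" by (rule inverse_power_less)
    show "1 / real p ^ k n \<le> \<psi> n" unfolding k_def
      by (rule LeastI[of "\<lambda>k. 1 / real p ^ k \<le> \<psi> n" i]) (use i in simp)
    show "\<psi> n < 1 / real p ^ (k n - 1)" if "k n > 0"
      using not_less_Least[of "k n - 1" "\<lambda>k. 1 / real p ^ k \<le> \<psi> n"] that unfolding k_def by simp
  qed
  define \<kappa> where "\<kappa> = (\<lambda>n. max (k n) (cap_level n))"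
  define t where "t = (\<lambda>n. if n \<in> S then real (totient n) / real p ^ \<kappa> n else 0)"
  have t0: "0 \<le> t n" for n by (simp add: t_def)
  have measure_E: "measure haar (?E n) = measure circle_measure (expansion -` ?E n \<inter> {0..<1})" for n
    by (rule measure_haar) measurable
  have le_hit: "measure haar (?E n) \<le> 3 * real (totient n) / real p ^ j"
    if "n > 0" "coprime p n" "j > 0 \<Longrightarrow> \<psi> n < 1 / real p ^ (j - 1)" for n j
  proof -
    have "measure haar (?E n) \<le> measure circle_measure (hit p j n)"
      unfolding measure_E using vimage_subset_hit[of n j \<psi>, OF that(2,1,3)] by (intro C.finite_measure_mono) simp_all
    then show ?thesis using measure_hit_le[OF that(2,1), of j] by simp
  qed
  define B where "B = {n. n \<ge> 1 \<and> p dvd n \<and> ?E n = Z}"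
  have le_t: "measure haar (?E n) \<le> 3 * t n + (if n \<in> B then 1 else 0)" if n: "n \<ge> 1" for n
  proof (cases "p dvd n")
    case True
    then consider "?E n = {}" | "n \<in> B" using padic_approx_set_dvd[of n \<psi>] n by (auto simp: B_def)
    then show ?thesis
    proof cases
      case 2
      then have "measure haar (?E n) = 1" using emeasure_haar_Zp by (simp add: B_def measure_def)
      then show ?thesis using 2 t0[of n] by simp
    qed (use t0[of n] in simp)
  next
    case False
    then have cop: "coprime p n" using prime_p by (simp add: prime_imp_coprime)
    have "measure haar (?E n) \<le> 3 * t n"
    proof (cases "n \<in> S")
      case nN: True
      show ?thesis
      proof (cases "cap_level n \<le> k n")
        case True
        then have "\<kappa> n = k n" by (simp add: \<kappa>_def)
        then show ?thesis using le_hit[OF _ cop k(2)[OF nN]] n nN by (simp add: t_def)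
      next
        case False
        \<comment> \<open>Where the level was raised, the measure is only bounded by 1, and 1 <= 2
          t(n) by the choice of the cap.\<close>
        then have \<kappa>: "\<kappa> n = cap_level n" by (simp add: \<kappa>_def)
        have "real (p ^ cap_level n) \<le> real (2 * totient n)"
          unfolding of_nat_le_iff using n by (intro totient_cap_level) simp
        then have "1 \<le> 2 * t n" using nN p_gt_1 by (simp add: t_def \<kappa> field_simps)
        moreover have "measure haar (?E n) \<le> measure haar (space haar)" by (rule H.bounded_measure)
        moreover have "measure haar (space haar) = 1" using emeasure_haar_Zp by (simp add: measure_def)
        ultimately show ?thesis using t0[of n] by linarith
      qed
    next
      case nN: False
      then have \<psi>0: "\<psi> n = 0" using n cop \<psi> by (force simp: S_def)
      \<comment> \<open>Radius 0 admits every level j, so letting j tend to infinity shows that E_n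
        is null.\<close>
      have "measure haar (?E n) \<le> 3 * real (totient n) / real p ^ j" for j
        using p_gt_1 n by (intro le_hit cop) (auto simp: \<psi>0)
      moreover have "(\<lambda>j. 3 * real (totient n) / real p ^ j) \<longlonglongrightarrow> 0"
        using p_gt_1 by (intro LIMSEQ_divide_realpow_zero) auto
      ultimately have "measure haar (?E n) \<le> 0" by (intro LIMSEQ_le_const) auto
      then show ?thesis using t0[of n] by simp
    qed
    then show ?thesis by simp
  qed
  have "\<not> summable t"
  proof
    assume "summable t"
    then have "summable (\<lambda>n. 3 * t n + (if n \<in> B then 1 else 0))"
      using fin by (intro summable_add summable_mult summable_If_finite_set) (simp_all add: B_def)
    then have "summable (\<lambda>n. 3 * t (Suc n) + (if Suc n \<in> B then 1 else 0))"
      by (subst summable_Suc_iff)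
    then have "summable (\<lambda>n. measure haar (?E (Suc n)))"
      by (rule summable_comparison_test'[of _ 0]) (use le_t in auto)
    then have "(\<Sum>n. ennreal (measure haar (?E (Suc n)))) \<noteq> \<infinity>"
      unfolding infinity_ennreal_def by (rule ennreal_suminf_neq_top) (rule measure_nonneg)
    moreover have "(\<Sum>n. ennreal (measure haar (?E (Suc n)))) = \<infinity>"
      using div by (simp only: H.emeasure_eq_measure)
    ultimately show False by contradiction
  qed
  then have ns: "\<not> summable (\<lambda>n. if n \<in> S then real (totient n) / real p ^ \<kappa> n else 0)"
    by (simp add: t_def)
  have \<kappa>_inf: "finite {n \<in> S. \<kappa> n < K}" for K
  proof (rule finite_subset)
    show "{n \<in> S. \<kappa> n < K} \<subseteq> {..<(p ^ K)\<^sup>2}"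
    proof
      fix n assume n: "n \<in> {n \<in> S. \<kappa> n < K}"
      then have "\<not> K \<le> cap_level n" by (simp add: \<kappa>_def)
      moreover have "n > 0" using n S by blast
      ultimately have "\<not> (p ^ K)\<^sup>2 \<le> n" using cap_level(2) by blast
      then show "n \<in> {..<(p ^ K)\<^sup>2}" by simp
    qed
  qed simp
  have "measure circle_measure (hit_limsup p \<kappa> S) = 1"
    using p_gt_1 by (intro hit_limsup_full[OF QIA _ S ns \<kappa>_inf]) auto
  moreover have "hit_limsup p \<kappa> S \<subseteq> expansion -` padic_limsup_set p \<psi> \<inter> {0..<1}"
  proof
    fix y assume "y \<in> hit_limsup p \<kappa> S"
    then have y: "y \<in> {0..<1}" "infinite {n \<in> S. y \<in> hit p (\<kappa> n) n}" by (simp_all add: hit_limsup_def)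
    have "{n \<in> S. y \<in> hit p (\<kappa> n) n} \<subseteq> {n. 1 \<le> n \<and> expansion y \<in> ?E n}"
    proof
      fix n assume n: "n \<in> {n \<in> S. y \<in> hit p (\<kappa> n) n}"
      have "1 / real p ^ \<kappa> n \<le> 1 / real p ^ k n"
        using p_gt_1 by (intro divide_left_mono power_increasing) (auto simp: \<kappa>_def)
      also have "\<dots> \<le> \<psi> n" using n k(1) by blast
      finally have "hit p (\<kappa> n) n \<subseteq> expansion -` ?E n" using n S by (intro hit_subset_vimage) auto
      then show "n \<in> {n. 1 \<le> n \<and> expansion y \<in> ?E n}" using n by (auto simp: S_def)
    qed
    then have "infinite {n. 1 \<le> n \<and> expansion y \<in> ?E n}" using y(2) by (rule infinite_super)
    then show "y \<in> expansion -` padic_limsup_set p \<psi> \<inter> {0..<1}"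
      using y(1) expansion_Zp by (simp add: padic_limsup_set_def)
  qed
  moreover have "expansion -` padic_limsup_set p \<psi> \<inter> {0..<1} \<in> sets circle_measure"
    using measurable_sets[OF expansion_measurable limsup_set_sets] by simp
  ultimately have "1 \<le> measure circle_measure (expansion -` padic_limsup_set p \<psi> \<inter> {0..<1})"
    using C.finite_measure_mono by metis
  also have "\<dots> = measure haar (padic_limsup_set p \<psi>)" by (rule measure_haar[OF limsup_set_sets, symmetric])
  finally have "1 \<le> measure haar (padic_limsup_set p \<psi>)" .
  moreover have "measure haar (padic_limsup_set p \<psi>) \<le> measure haar (space haar)" by (rule H.bounded_measure)
  moreover have "measure haar (space haar) = 1" using emeasure_haar_Zp by (simp add: measure_def)
  ultimately have "measure haar (padic_limsup_set p \<psi>) = 1" by simp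
  then show ?thesis by (simp add: H.emeasure_eq_measure)
qed

end

theorem theorem2:
  fixes p :: nat and \<psi> :: "nat \<Rightarrow> real"
  assumes "QIA_infty"
    and "prime p"
    and "\<forall>n\<ge>1. \<psi> n \<ge> 0"
  shows "emeasure (haar_Zp p) (padic_limsup_set p \<psi>) =
    (if (\<Sum>n. emeasure (haar_Zp p) (padic_approx_set p \<psi> (Suc n))) = \<infinity> then 1 else 0)"
proof -
  interpret padic p by unfold_locales (rule assms(2))
  show ?thesis
    using limsup_set_full[OF assms(1,3)] limsup_set_null[of \<psi>] by (simp add: haar_Zp_eq)
qed

end
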